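(* Let $G$ be a graph and let $H$ be a full subdivision of $G$. Then: (i) if $G$ is planar, then $H$ is an $\{\llcorner\}$-graph; (ii) for any graph $G$, the complement $\bar H$ of $H$ is a $B_2$-VPG-graph.
   Context: All graphs are finite and simple. A full subdivision of $G$ is a graph obtained from $G$ by replacing each edge by a path with at least one internal vertex (i.e., each edge is subdivided at least once). The complement $\bar H$ has the same vertex set as $H$, with two distinct vertices adjacent iff they are not adjacent in $H$. An axis-aligned L-shape is the union of a horizontal and a vertical segment in the plane whose intersection is an endpoint of both; it has rotation $\llcorner$ if the common endpoint is the lower endpoint of the vertical segment and the left endpoint of the horizontal segment. A graph is an $\{\llcorner\}$-graph if one can assign to each vertex an L-shape of rotation $\llcorner$ such that two distinct vertices are adjacent iff their L-shapes intersect. An axis-aligned $k$-bend path is a simple polygonal path in the plane consisting of horizontal and vertical segments whose direction changes between horizontal and vertical at most $k$ times. A graph is a $B_k$-VPG-graph if one can assign to each vertex an axis-aligned $k$-bend path such that two distinct vertices are adjacent iff their paths intersect. *)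

theory Defs
  imports "HOL-Analysis.Analysis"
begin

definition graph :: "'a set \<Rightarrow> ('a \<Rightarrow> 'a \<Rightarrow> bool) \<Rightarrow> bool" where
  "graph V E \<longleftrightarrow> finite V \<and> (\<forall>u v. E u v \<longrightarrow> u \<in> V \<and> v \<in> V \<and> u \<noteq> v \<and> E v u)"

definition graph_complement :: "'a set \<Rightarrow> ('a \<Rightarrow> 'a \<Rightarrow> bool) \<Rightarrow> 'a \<Rightarrow> 'a \<Rightarrow> bool" where
  "graph_complement V E = (\<lambda>u v. u \<in> V \<and> v \<in> V \<and> u \<noteq> v \<and> \<not> E u v)"

definition consecutive_in :: "'a list \<Rightarrow> 'a \<Rightarrow> 'a \<Rightarrow> bool" where
  "consecutive_in xs a b \<longleftrightarrow>
     (\<exists>i. Suc i < length xs \<and> ((xs ! i = a \<and> xs ! Suc i = b) \<or> (xs ! i = b \<and> xs ! Suc i = a)))"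

definition full_subdivision ::
  "'a set \<Rightarrow> ('a \<Rightarrow> 'a \<Rightarrow> bool) \<Rightarrow> 'b set \<Rightarrow> ('b \<Rightarrow> 'b \<Rightarrow> bool) \<Rightarrow> bool" where
  "full_subdivision V E W F \<longleftrightarrow>
    (\<exists>(\<phi> :: 'a \<Rightarrow> 'b) (Q :: 'a \<Rightarrow> 'a \<Rightarrow> 'b list).
       inj_on \<phi> V \<and>
       (\<forall>u v. E u v \<longrightarrow>
          Q v u = rev (Q u v) \<and> Q u v \<noteq> [] \<and> distinct (Q u v) \<and>
          set (Q u v) \<inter> \<phi> ` V = {}) \<and>
       (\<forall>u v x y. E u v \<and> E x y \<and> {u, v} \<noteq> {x, y} \<longrightarrow> set (Q u v) \<inter> set (Q x y) = {}) \<and>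
       W = \<phi> ` V \<union> (\<Union>{set (Q u v) | u v. E u v}) \<and>
       (\<forall>a b. F a b \<longleftrightarrow> (\<exists>u v. E u v \<and> consecutive_in (\<phi> u # Q u v @ [\<phi> v]) a b)))"

definition planar :: "'a set \<Rightarrow> ('a \<Rightarrow> 'a \<Rightarrow> bool) \<Rightarrow> bool" where
  "planar V E \<longleftrightarrow>
    (\<exists>(p :: 'a \<Rightarrow> real \<times> real) (g :: 'a \<Rightarrow> 'a \<Rightarrow> real \<Rightarrow> real \<times> real).
       inj_on p V \<and>
       (\<forall>u v. E u v \<longrightarrow> arc (g u v) \<and> pathstart (g u v) = p u \<and> pathfinish (g u v) = p v \<and>
                path_image (g v u) = path_image (g u v) \<and>
                (\<forall>w\<in>V. p w \<in> path_image (g u v) \<longrightarrow> w = u \<or> w = v)) \<and>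
       (\<forall>u v x y. E u v \<and> E x y \<and> {u, v} \<noteq> {x, y} \<longrightarrow>
          path_image (g u v) \<inter> path_image (g x y) \<subseteq> p ` ({u, v} \<inter> {x, y})))"

definition Lshape :: "real \<times> real \<Rightarrow> real \<Rightarrow> real \<Rightarrow> (real \<times> real) set" where
  "Lshape c a b = {(fst c + t, snd c) | t. 0 \<le> t \<and> t \<le> a} \<union> {(fst c, snd c + t) | t. 0 \<le> t \<and> t \<le> b}"

definition is_Lshape_ll :: "(real \<times> real) set \<Rightarrow> bool" where
  "is_Lshape_ll S \<longleftrightarrow> (\<exists>c a b. a > 0 \<and> b > 0 \<and> S = Lshape c a b)"

definition L_graph :: "'a set \<Rightarrow> ('a \<Rightarrow> 'a \<Rightarrow> bool) \<Rightarrow> bool" where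
  "L_graph V E \<longleftrightarrow>
    (\<exists>f :: 'a \<Rightarrow> (real \<times> real) set. (\<forall>v\<in>V. is_Lshape_ll (f v)) \<and>
       (\<forall>u\<in>V. \<forall>v\<in>V. u \<noteq> v \<longrightarrow> (E u v \<longleftrightarrow> f u \<inter> f v \<noteq> {})))"

fun polypath :: "(real \<times> real) list \<Rightarrow> real \<Rightarrow> real \<times> real" where
  "polypath [] = linepath 0 0"
| "polypath [p] = linepath p p"
| "polypath [p, q] = linepath p q"
| "polypath (p # q # r # rs) = linepath p q +++ polypath (q # r # rs)"

definition horizontal_seg :: "real \<times> real \<Rightarrow> real \<times> real \<Rightarrow> bool" where
  "horizontal_seg p q \<longleftrightarrow> snd p = snd q \<and> fst p \<noteq> fst q"

definition vertical_seg :: "real \<times> real \<Rightarrow> real \<times> real \<Rightarrow> bool" where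
  "vertical_seg p q \<longleftrightarrow> fst p = fst q \<and> snd p \<noteq> snd q"

definition bends :: "(real \<times> real) list \<Rightarrow> nat" where
  "bends ps = card {i. Suc (Suc i) < length ps \<and>
      horizontal_seg (ps ! i) (ps ! Suc i) \<noteq> horizontal_seg (ps ! Suc i) (ps ! Suc (Suc i))}"

definition k_bend_path :: "nat \<Rightarrow> (real \<times> real) set \<Rightarrow> bool" where
  "k_bend_path k S \<longleftrightarrow>
    (\<exists>ps. length ps \<ge> 2 \<and>
       (\<forall>i. Suc i < length ps \<longrightarrow> horizontal_seg (ps ! i) (ps ! Suc i) \<or> vertical_seg (ps ! i) (ps ! Suc i)) \<and>
       arc (polypath ps) \<and> bends ps \<le> k \<and> S = path_image (polypath ps))"

definition B_VPG :: "nat \<Rightarrow> 'a set \<Rightarrow> ('a \<Rightarrow> 'a \<Rightarrow> bool) \<Rightarrow> bool" where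
  "B_VPG k V E \<longleftrightarrow>
    (\<exists>f :: 'a \<Rightarrow> (real \<times> real) set. (\<forall>v\<in>V. k_bend_path k (f v)) \<and>
       (\<forall>u\<in>V. \<forall>v\<in>V. u \<noteq> v \<longrightarrow> (E u v \<longleftrightarrow> f u \<inter> f v \<noteq> {})))"

end

(*
Part (ii) is an explicit drawing. The vertices of G become Z-shapes whose vertical ends are ordered so
that a cap-shaped 2-bend path can start just after, and stop just before, any two prescribed ones. The
caps of one subdivided edge are nested alternately, so that only consecutive ones are disjoint.

Part (i). It suffices to find a bar representation of G: vertices are horizontal bars, edges are vertical
segments between the bars of their ends, and no segment meets a third bar. The internal vertices of a
subdivided edge are then stacked along its segment. Bar representations with a prescribed lowest vertex
can be glued at a cut vertex, so G may be assumed 2-connected; the heights of the bars are then given by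
an st-order. For the horizontal order, note that the edges leaving a lower set of the st-order form a
"bundle" between two connected pieces of the drawing. Three edges a, b, c of a bundle lie on a theta graph,
and adding up the winding numbers of the three loops, each taken about the midpoint of the remaining edge,
gives a sign chi(a,b,c). As a sum of differences it is an alternating cocycle, and a cocycle with values
1 and -1 is a cyclic order; cutting it at the edge st gives a linear order on every level. Moving an edge to an
adjacent edge does not change its sign relative to edges passing by, so these orders fit
together to one left-to-right order of all edges.
*)
theory Submission
  imports Defs "HOL-Complex_Analysis.Winding_Numbers"
begin

section \<open>Coordinates on a full subdivision\<close>

text \<open>The drawing consists of arbitrary topological arcs, so there are no slopes, faces or
  rotations at a vertex from which left and right could be read off. Two edges between the same two
  connected pieces have no invariant order; three have a cyclic one, and the edge from
  \<open>s\<close> to \<open>t\<close>, which crosses every level, can serve as the third. The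
  reference paths that lead from \<open>s\<close> and \<open>t\<close> to the edges are chosen
  arbitrarily. They may overlap, so the loops they form need not be simple and no single winding
  number is controlled. A change of reference paths, however, cancels in the cyclic sum. Keeping the
  paths fixed makes the cocycle identity pure algebra; being allowed to replace them makes the sum 1
  or -1, since it can be evaluated on three arcs of a theta graph. The resulting order is known to
  be transitive only within one level. Hence it is not extended to a linear order of all edges
  directly; the horizontal positions are found by a sweep from bottom to top.\<close>

fun sub_adj :: "('a \<Rightarrow> 'a \<Rightarrow> nat) \<Rightarrow> 'a + 'a \<times> 'a \<times> nat \<Rightarrow> 'a + 'a \<times> 'a \<times> nat \<Rightarrow> bool" where
  "sub_adj m (Inl u) (Inl v) = False"
| "sub_adj m (Inl w) (Inr (u, v, i)) = (w = u \<and> i = 0 \<or> w = v \<and> Suc i = m u v)"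
| "sub_adj m (Inr (u, v, i)) (Inl w) = (w = u \<and> i = 0 \<or> w = v \<and> Suc i = m u v)"
| "sub_adj m (Inr (u, v, i)) (Inr (u', v', j)) = (u = u' \<and> v = v' \<and> (Suc i = j \<or> Suc j = i))"

text \<open>\<open>Inl v\<close> names the vertex \<open>v\<close> of the base graph,
  \<open>Inr (u, v, i)\<close> the inner vertex number \<open>i\<close> on the path from
  \<open>u\<close> to \<open>v\<close>, counted from \<open>u\<close>. A subdivision stores every
  path in both directions; \<open>y\<close> picks the upward one, so that an inner vertex has only
  one name.\<close>

definition sub_key :: "'a set \<Rightarrow> ('a \<Rightarrow> 'a \<Rightarrow> bool) \<Rightarrow> ('a \<Rightarrow> real) \<Rightarrow> ('a \<Rightarrow> 'a \<Rightarrow> nat) \<Rightarrow> ('a + 'a \<times> 'a \<times> nat) set" where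
  "sub_key V E y m = Inl ` V \<union> {Inr (u, v, i) | u v i. E u v \<and> y u < y v \<and> i < m u v}"

lemma consecutive_in_rev: "consecutive_in (rev xs) a b \<longleftrightarrow> consecutive_in xs a b"
proof -
  have *: "consecutive_in (rev xs) a b" if "consecutive_in xs a b" for xs :: "'a list"
  proof -
    obtain i where i: "Suc i < length xs" "xs ! i = a \<and> xs ! Suc i = b \<or> xs ! i = b \<and> xs ! Suc i = a"
      using \<open>consecutive_in xs a b\<close> unfolding consecutive_in_def by blast
    define j where "j = length xs - Suc (Suc i)"
    have "Suc j < length (rev xs)" "rev xs ! j = xs ! Suc i" "rev xs ! Suc j = xs ! i"
      using i(1) unfolding j_def by (auto simp: rev_nth Suc_diff_Suc)
    then show ?thesis using i(2) unfolding consecutive_in_def by metis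
  qed
  show ?thesis using *[of xs] *[of "rev xs"] by auto
qed

text \<open>Eliminates the branch map and the path lists once and for all: afterwards it is enough
  to assign shapes to names and to compare their intersections with \<open>sub_adj\<close>. The
  natural map \<open>d\<close> goes from names to vertices, and \<open>c\<close> is its
  inverse.\<close>

lemma full_subdivision_coordinates:
  fixes y :: "'a \<Rightarrow> real"
  assumes G: "graph V E" and "full_subdivision V E W F" and y: "inj_on y V"
  obtains c m where "inj_on c W" "c ` W = sub_key V E y m"
    "\<And>w w'. w \<in> W \<Longrightarrow> w' \<in> W \<Longrightarrow> F w w' \<longleftrightarrow> sub_adj m (c w) (c w')"
proof -
  obtain \<phi> Q where PQ: "inj_on \<phi> V \<and>
       (\<forall>u v. E u v \<longrightarrow>
          Q v u = rev (Q u v) \<and> Q u v \<noteq> [] \<and> distinct (Q u v) \<and>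
          set (Q u v) \<inter> \<phi> ` V = {}) \<and>
       (\<forall>u v x y. E u v \<and> E x y \<and> {u, v} \<noteq> {x, y} \<longrightarrow> set (Q u v) \<inter> set (Q x y) = {}) \<and>
       W = \<phi> ` V \<union> (\<Union>{set (Q u v) | u v. E u v}) \<and>
       (\<forall>a b. F a b \<longleftrightarrow> (\<exists>u v. E u v \<and> consecutive_in (\<phi> u # Q u v @ [\<phi> v]) a b))"
    using assms(2) unfolding full_subdivision_def by (elim exE) 
  have phi: "inj_on \<phi> V" and W: "W = \<phi> ` V \<union> (\<Union>{set (Q u v) | u v. E u v})"
    using PQ by auto
  have Q: "Q v u = rev (Q u v) \<and> Q u v \<noteq> [] \<and> distinct (Q u v) \<and> set (Q u v) \<inter> \<phi> ` V = {}"
    if "E u v" for u v using PQ that by simp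
  have QQ: "set (Q u v) \<inter> set (Q x y) = {}" if "E u v" "E x y" "{u, v} \<noteq> {x, y}" for u v x y
    using PQ that by simp
  have F: "F a b \<longleftrightarrow> (\<exists>u v. E u v \<and> consecutive_in (\<phi> u # Q u v @ [\<phi> v]) a b)" for a b
    using PQ by simp
  define m where "m = (\<lambda>u v. length (Q u v))"
  define d where "d = (\<lambda>k. case k of Inl v \<Rightarrow> \<phi> v | Inr (u, v, i) \<Rightarrow> Q u v ! i)"
  let ?K = "sub_key V E y m"
  have EV: "u \<in> V" "v \<in> V" "u \<noteq> v" "E v u" if "E u v" for u v
    using G that unfolding graph_def by blast+
  have ylt: "y u < y v \<or> y v < y u" if "E u v" for u v
    using EV[OF that] y by (meson inj_onD linorder_neqE_linordered_idom)
  have mpos: "0 < m u v" if "E u v" for u v using Q[OF that] by (simp add: m_def)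
  have inj: "inj_on d ?K"
  proof (rule inj_onI)
    fix k k' assume k: "k \<in> ?K" "k' \<in> ?K" and eq: "d k = d k'"
    have mixed: False if "v \<in> V" "E u w" "i < m u w" "\<phi> v = Q u w ! i" for v u w i
      using Q[OF that(2)] that by (metis IntI emptyE image_eqI m_def nth_mem)
    show "k = k'"
    proof (cases k)
      case (Inl v)
      show ?thesis
      proof (cases k')
        case (Inl v')
        then show ?thesis using \<open>k = Inl v\<close> k eq phi unfolding sub_key_def d_def
          by (auto dest: inj_onD)
      next
        case (Inr t)
        obtain u w i where "t = (u, w, i)" by (cases t) auto
        then show ?thesis using \<open>k = Inl v\<close> Inr k eq mixed[of v u w i] unfolding sub_key_def d_def by auto
      qed
    next
      case (Inr t)
      obtain u w i where t: "t = (u, w, i)" by (cases t) auto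
      have 1: "E u w" "y u < y w" "i < m u w" using k(1) Inr t unfolding sub_key_def by auto
      show ?thesis
      proof (cases k')
        case (Inl v')
        then show ?thesis using \<open>k = Inr t\<close> t 1 k eq mixed[of v' u w i] unfolding sub_key_def d_def by auto
      next
        case (Inr t')
        obtain u' w' i' where t': "t' = (u', w', i')" by (cases t') auto
        have 2: "E u' w'" "y u' < y w'" "i' < m u' w'" using k(2) Inr t' unfolding sub_key_def by auto
        have q: "Q u w ! i = Q u' w' ! i'" using eq \<open>k = Inr t\<close> Inr t t' by (simp add: d_def)
        have "{u, w} = {u', w'}"
        proof (rule ccontr)
          assume "{u, w} \<noteq> {u', w'}"
          then have "set (Q u w) \<inter> set (Q u' w') = {}" using QQ 1 2 by blast
          then show False using q 1 2 by (metis IntI emptyE m_def nth_mem)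
        qed
        then have uw: "u = u'" "w = w'" using 1(2) 2(2) by (auto simp: doubleton_eq_iff)
        then have "i = i'" using q 1 2 Q[OF 1(1)] by (simp add: m_def nth_eq_iff_index_eq)
        then show ?thesis using \<open>k = Inr t\<close> Inr t t' uw by simp
      qed
    qed
  qed
  have im: "d ` ?K = W"
  proof
    show "d ` ?K \<subseteq> W" 
    proof
      fix w assume "w \<in> d ` ?K"
      then consider v where "v \<in> V" "w = \<phi> v" | u v i where "E u v" "i < m u v" "w = Q u v ! i"
        unfolding d_def sub_key_def by auto
      then show "w \<in> W"
      proof cases
        case 2
        then have "w \<in> set (Q u v)" by (simp add: m_def)
        then show ?thesis using 2 unfolding W by blast
      qed (simp add: W)
    qed
    show "W \<subseteq> d ` ?K"
    proof
      fix w assume "w \<in> W"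
      then consider v where "v \<in> V" "w = \<phi> v" | u v where "E u v" "w \<in> set (Q u v)"
        unfolding W by blast
      then show "w \<in> d ` ?K"
      proof cases
        case 1
        then have "w = d (Inl v)" "Inl v \<in> ?K" by (auto simp: d_def sub_key_def)
        then show ?thesis by blast
      next
        case 2
        obtain u' v' where e: "E u' v'" "y u' < y v'" "w \<in> set (Q u' v')"
          using 2 ylt[OF 2(1)] EV(4)[OF 2(1)] Q[OF 2(1)] set_rev by metis
        then obtain i where "i < m u' v'" "Q u' v' ! i = w" by (auto simp: m_def in_set_conv_nth)
        then have "w = d (Inr (u', v', i))" "Inr (u', v', i) \<in> ?K" using e by (auto simp: d_def sub_key_def)
        then show ?thesis by blast
      qed
    qed
  qed
  \<comment> \<open>The path from \<open>u\<close> to \<open>v\<close> including its ends, as a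
    sequence of names: position 0 is \<open>u\<close>, position \<open>Suc j\<close> is inner vertex
    \<open>j\<close>, and every position beyond is \<open>v\<close>.\<close>
  define key where "key = (\<lambda>u v i. case i of 0 \<Rightarrow> Inl u | Suc j \<Rightarrow> if j < m u v then Inr (u, v, j) else Inl v)"
  have key_in: "key u v i \<in> ?K" if "E u v" "y u < y v" for u v i
    using that EV[OF that(1)] by (auto simp: key_def sub_key_def split: nat.splits)
  have dkey: "d (key u v i) = (\<phi> u # Q u v @ [\<phi> v]) ! i" if "i < m u v + 2" for u v i
    using that by (auto simp: d_def key_def m_def nth_append nth_Cons' split: nat.splits)
  have Fsym: "F a b \<longleftrightarrow> (\<exists>u v. E u v \<and> y u < y v \<and> consecutive_in (\<phi> u # Q u v @ [\<phi> v]) a b)" for a b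
  proof
    assume "F a b"
    then obtain u v where uv: "E u v" "consecutive_in (\<phi> u # Q u v @ [\<phi> v]) a b" using F by blast
    have "consecutive_in (\<phi> v # Q v u @ [\<phi> u]) a b"
      using consecutive_in_rev[of "\<phi> u # Q u v @ [\<phi> v]"] uv(2) Q[OF uv(1)] by simp
    then show "\<exists>u v. E u v \<and> y u < y v \<and> consecutive_in (\<phi> u # Q u v @ [\<phi> v]) a b"
      using uv ylt[OF uv(1)] EV(4)[OF uv(1)] by blast
  qed (use F in blast)
  have FK: "F (d k) (d k') \<longleftrightarrow> (\<exists>u v i. E u v \<and> y u < y v \<and> i \<le> m u v \<and>
      (k = key u v i \<and> k' = key u v (Suc i) \<or> k' = key u v i \<and> k = key u v (Suc i)))"
    if k: "k \<in> ?K" "k' \<in> ?K" for k k'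
  proof -
    have dd: "d (key u v i) = d k \<longleftrightarrow> k = key u v i" "d (key u v i) = d k' \<longleftrightarrow> k' = key u v i"
      if "E u v" "y u < y v" for u v i
      using inj_onD[OF inj _ key_in[OF that, of i]] k by metis+
    have "consecutive_in (\<phi> u # Q u v @ [\<phi> v]) (d k) (d k') \<longleftrightarrow> (\<exists>i. i \<le> m u v \<and>
      (k = key u v i \<and> k' = key u v (Suc i) \<or> k' = key u v i \<and> k = key u v (Suc i)))"
      if uv: "E u v" "y u < y v" for u v
    proof -
      have "consecutive_in (\<phi> u # Q u v @ [\<phi> v]) (d k) (d k') \<longleftrightarrow>
        (\<exists>i. i \<le> m u v \<and> (d (key u v i) = d k \<and> d (key u v (Suc i)) = d k' \<or> d (key u v i) = d k' \<and> d (key u v (Suc i)) = d k))"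
      proof -
        define L where "L = \<phi> u # Q u v @ [\<phi> v]"
        have "Suc i < length L \<longleftrightarrow> i \<le> m u v" for i by (auto simp: L_def m_def)
        moreover have "L ! i = d (key u v i)" "L ! Suc i = d (key u v (Suc i))" if "i \<le> m u v" for i
          using dkey[of i u v] dkey[of "Suc i" u v] that unfolding L_def by simp_all
        ultimately show ?thesis unfolding consecutive_in_def L_def[symmetric] by metis
      qed
      then show ?thesis using dd[OF uv] by metis
    qed
    then show ?thesis using Fsym by blast
  qed
  have adj: "F (d k) (d k') \<longleftrightarrow> sub_adj m k k'" if k: "k \<in> ?K" "k' \<in> ?K" for k k'
  proof
    assume "F (d k) (d k')"
    then obtain u v i where "E u v" "y u < y v" "i \<le> m u v"
      "k = key u v i \<and> k' = key u v (Suc i) \<or> k' = key u v i \<and> k = key u v (Suc i)"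
      using FK[OF k] by blast
    then show "sub_adj m k k'" using mpos[of u v]
      by (auto simp: key_def split: nat.splits if_splits)
  next
    assume a: "sub_adj m k k'"
    have mix: "\<exists>u v i. E u v \<and> y u < y v \<and> i \<le> m u v \<and> (Inl w = key u v i \<and> Inr (a, b, j) = key u v (Suc i) \<or> Inr (a, b, j) = key u v i \<and> Inl w = key u v (Suc i))"
      if "Inr (a, b, j) \<in> ?K" "sub_adj m (Inl w) (Inr (a, b, j))" for w a b j
    proof -
      have e: "E a b" "y a < y b" "j < m a b" using that(1) by (auto simp: sub_key_def)
      show ?thesis
        using that(2) e mpos[OF e(1)]
        by (intro exI[of _ a] exI[of _ b] exI[of _ "if w = a then 0 else Suc j"]) (auto simp: key_def)
    qed
    show "F (d k) (d k')" unfolding FK[OF k]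
    proof (cases k)
      case (Inl w)
      then obtain p q j where k': "k' = Inr (p, q, j)" using a by (cases k') auto
      show "\<exists>u v i. E u v \<and> y u < y v \<and> i \<le> m u v \<and> (k = key u v i \<and> k' = key u v (Suc i) \<or> k' = key u v i \<and> k = key u v (Suc i))"
        using mix[of p q j w] a k Inl k' by auto
    next
      case (Inr t)
      obtain p q j where t: "t = (p, q, j)" by (cases t) auto
      show "\<exists>u v i. E u v \<and> y u < y v \<and> i \<le> m u v \<and> (k = key u v i \<and> k' = key u v (Suc i) \<or> k' = key u v i \<and> k = key u v (Suc i))"
      proof (cases k')
        case (Inl w)
        then show ?thesis using mix[of p q j w] a k Inr t by (simp) blast
      next
        case i': (Inr t')
        obtain p' q' j' where t': "t' = (p', q', j')" by (cases t') auto
        have e: "E p q" "y p < y q" "j < m p q" "j' < m p' q'" using k Inr i' t t' by (auto simp: sub_key_def)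
        \<comment> \<open>Inner vertex \<open>j\<close> sits at position \<open>Suc j\<close> of the
          path, hence the shift by one.\<close>
        show ?thesis using e a Inr i' t t'
          by (intro exI[of _ p] exI[of _ q] exI[of _ "Suc (min j j')"]) (auto simp: key_def)
      qed
    qed
  qed
  define c where "c = inv_into ?K d"
  have bij: "bij_betw d ?K W" using inj im by (simp add: bij_betw_def)
  have cc: "bij_betw c W ?K" unfolding c_def by (rule bij_betw_inv_into[OF bij])
  have dc: "d (c w) = w" if "w \<in> W" for w using that im by (auto simp: c_def f_inv_into_f)
  show ?thesis
  proof (rule that[of c m])
    show "inj_on c W" "c ` W = ?K" using cc by (auto simp: bij_betw_def)
    show "F w w' = sub_adj m (c w) (c w')" if "w \<in> W" "w' \<in> W" for w w'
      using adj[of "c w" "c w'"] dc that cc by (auto simp: bij_betw_def)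
  qed
qed

section \<open>Complements of full subdivisions\<close>

definition vhv :: "real \<Rightarrow> real \<Rightarrow> real \<Rightarrow> real \<Rightarrow> real \<Rightarrow> (real \<times> real) set" where
  "vhv x1 y1 y2 x2 y3 =
     {x1} \<times> closed_segment y1 y2 \<union> closed_segment x1 x2 \<times> {y2} \<union> {x2} \<times> closed_segment y2 y3"

lemma k_bend_path_vhv:
  assumes "x1 \<noteq> x2" "y1 \<noteq> y2" "y2 \<noteq> y3"
  shows "k_bend_path 2 (vhv x1 y1 y2 x2 y3)"
proof -
  define ps where "ps = [(x1, y1), (x1, y2), (x2, y2), (x2, y3)]"
  have seg: "closed_segment (x1, y1) (x1, y2) = {x1} \<times> closed_segment y1 y2"
    "closed_segment (x1, y2) (x2, y2) = closed_segment x1 x2 \<times> {y2}"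
    "closed_segment (x2, y2) (x2, y3) = {x2} \<times> closed_segment y2 y3"
    by (simp_all add: closed_segment_same_fst closed_segment_same_snd)
  have im: "path_image (polypath ps) = vhv x1 y1 y2 x2 y3"
    by (simp add: ps_def path_image_join seg vhv_def Un_assoc)
  have a2: "arc (linepath (x1, y2) (x2, y2) +++ linepath (x2, y2) (x2, y3))"
    using assms by (intro arc_join) (auto simp: seg)
  have "arc (polypath ps)" unfolding ps_def polypath.simps
    using assms a2 by (intro arc_join) (auto simp: seg path_image_join)
  moreover have "bends ps \<le> 2"
  proof -
    have "{i. Suc (Suc i) < length ps \<and>
      horizontal_seg (ps ! i) (ps ! Suc i) \<noteq> horizontal_seg (ps ! Suc i) (ps ! Suc (Suc i))} \<subseteq> {..<2}"
      by (auto simp: ps_def)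
    then show ?thesis unfolding bends_def using card_mono[of "{..<2::nat}"] by fastforce
  qed
  moreover have "horizontal_seg (ps ! i) (ps ! Suc i) \<or> vertical_seg (ps ! i) (ps ! Suc i)"
    if "Suc i < length ps" for i
  proof -
    have "i = 0 \<or> i = 1 \<or> i = 2" using that by (auto simp: ps_def)
    then show ?thesis using assms by (auto simp: ps_def horizontal_seg_def vertical_seg_def)
  qed
  moreover have "length ps \<ge> 2" by (simp add: ps_def)
  ultimately show ?thesis unfolding k_bend_path_def using im by blast
qed

text \<open>The left leg goes up from the bar at height \<open>j\<close>, the right leg goes down
  from it. When \<open>j\<close> grows by one, both legs move one step to the left and the bar moves
  up; therefore any two such shapes cross, the right leg of the one with the larger index passing
  through the bar of the other. The height \<open>4 * real N\<close> lies above the caps placed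
  later.\<close>

definition zshape :: "nat \<Rightarrow> nat \<Rightarrow> (real \<times> real) set" where
  "zshape N j = vhv (- real j) (4 * real N) j (2 * real N - real j) (-1)"

text \<open>The cap of an internal vertex on the edge between the vertices numbered \<open>lo < hi\<close>: the left leg lies just
  to the right of the upper end of the \<open>lo\<close>-th Z-shape, the right leg just to the right of the lower end of
  the \<open>hi\<close>-th one. The flags \<open>p\<close> and \<open>q\<close> tell whether it must avoid these two Z-shapes; it meets all others.
  The offsets \<open>a\<close>, \<open>b\<close>, \<open>e\<close> only matter between caps of the same edge.\<close>

definition cap :: "nat \<Rightarrow> nat \<Rightarrow> nat \<Rightarrow> real \<Rightarrow> real \<Rightarrow> real \<Rightarrow> bool \<Rightarrow> bool \<Rightarrow> (real \<times> real) set" where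
  "cap N lo hi a b e p q =
     vhv (a - real lo) (if q then hi + 1/2 else lo + 1/2) (2 * real N + real hi - real lo + e)
       (2 * real N - real hi + b) (if p then lo + 1/2 else 1/2)"

lemma in_vhv:
  "(x, y) \<in> vhv x1 y1 y2 x2 y3 \<longleftrightarrow>
    x = x1 \<and> (y1 \<le> y \<and> y \<le> y2 \<or> y2 \<le> y \<and> y \<le> y1) \<or>
    y = y2 \<and> (x1 \<le> x \<and> x \<le> x2 \<or> x2 \<le> x \<and> x \<le> x1) \<or>
    x = x2 \<and> (y2 \<le> y \<and> y \<le> y3 \<or> y3 \<le> y \<and> y \<le> y2)"
  by (auto simp: vhv_def closed_segment_eq_real_ivl)

lemma in_vhv_peak:
  assumes "y1 \<le> y2" "x1 \<le> x2" "y3 \<le> y2"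
  shows "(x, y) \<in> vhv x1 y1 y2 x2 y3 \<longleftrightarrow>
    x = x1 \<and> y1 \<le> y \<and> y \<le> y2 \<or> y = y2 \<and> x1 \<le> x \<and> x \<le> x2 \<or> x = x2 \<and> y3 \<le> y \<and> y \<le> y2"
  using assms unfolding in_vhv by auto

lemma in_zshape:
  assumes "j < N"
  shows "(x, y) \<in> zshape N j \<longleftrightarrow>
    x = - real j \<and> real j \<le> y \<and> y \<le> 4 * real N \<or>
    y = real j \<and> - real j \<le> x \<and> x \<le> 2 * real N - real j \<or>
    x = 2 * real N - real j \<and> -1 \<le> y \<and> y \<le> real j"
  using assms unfolding zshape_def in_vhv by auto

lemma in_capE:
  assumes "(x, y) \<in> cap N lo hi a b e p q"
    and "lo < hi" "hi < N" "0 < a" "a < 1" "0 < b" "b < 1" "0 \<le> e" "e < 1"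
  obtains "x = a - real lo" "(if q then real hi else real lo) + 1/2 \<le> y" "y \<le> 2 * real N + real hi - real lo + e"
  | "y = 2 * real N + real hi - real lo + e" "a - real lo \<le> x" "x \<le> 2 * real N - real hi + b"
  | "x = 2 * real N - real hi + b" "(if p then real lo else 0) + 1/2 \<le> y" "y \<le> 2 * real N + real hi - real lo + e"
proof -
  have r: "real lo + 1 \<le> hi" "real hi + 1 \<le> N" using assms by linarith+
  define T where "T = 2 * real N + real hi - real lo + e"
  have o: "(if q then hi + 1/2 else lo + 1/2) \<le> T" "a - real lo \<le> 2 * real N - real hi + b"
    "(if p then lo + 1/2 else 1/2) \<le> T" using r assms(4-) by (auto simp: T_def)
  have "(x, y) \<in> vhv (a - real lo) (if q then hi + 1/2 else lo + 1/2) T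
       (2 * real N - real hi + b) (if p then lo + 1/2 else 1/2)"
    using assms(1) by (simp add: cap_def T_def)
  from this[unfolded in_vhv_peak[OF o]] show ?thesis
    using that unfolding T_def by (cases p; cases q; simp only: if_True if_False; auto)
qed

lemma zshape_meet:
  assumes "j < k" "k < N" shows "zshape N j \<inter> zshape N k \<noteq> {}"
proof -
  have "(2 * real N - real k, real j) \<in> zshape N j \<inter> zshape N k"
    using assms unfolding zshape_def by (auto simp: in_vhv)
  then show ?thesis by blast
qed

text \<open>Each part of the cap takes care of one range of indices: the top segment cuts the left
  legs for \<open>j < lo\<close>, the right leg cuts the bars for \<open>lo < j < hi\<close>, the
  left leg cuts the bars for \<open>j > hi\<close>. The Z-shape of \<open>lo\<close> can be met only
  by the right leg, through its bar, and that of \<open>hi\<close> only by the left leg. Letting the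
  leg in question end half a unit above that bar is what the flags \<open>p\<close> and
  \<open>q\<close> do.\<close>

lemma cap_zshape:
  assumes "1 \<le> lo" "lo < hi" "hi < N" "1 \<le> j" "j < N" "0 < a" "a < 1" "0 < b" "b < 1" "0 \<le> e" "e < 1"
  shows "cap N lo hi a b e p q \<inter> zshape N j = {} \<longleftrightarrow> p \<and> j = lo \<or> q \<and> j = hi"
proof -
  have r: "1 \<le> real lo" "real lo + 1 \<le> hi" "real hi + 1 \<le> N" "1 \<le> real j" "real j + 1 \<le> N"
    using assms by linarith+
  show ?thesis
  proof
    assume av: "p \<and> j = lo \<or> q \<and> j = hi"
    have False if c: "(x, y) \<in> cap N lo hi a b e p q" and z: "(x, y) \<in> zshape N j" for x y
    proof -
      have z: "x = - real j \<and> real j \<le> y \<and> y \<le> 4 * real N \<or> y = real j \<and> - real j \<le> x \<and> x \<le> 2 * real N - real j \<or>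
        x = 2 * real N - real j \<and> -1 \<le> y \<and> y \<le> real j"
        using z unfolding in_zshape[OF assms(5)] .
      have av: "p \<and> real j = real lo \<or> q \<and> real j = real hi" using av by auto
      from c assms(2,3,6-) show False
      proof (cases rule: in_capE)
        case 1
        then have "real lo + 1/2 \<le> y" "q \<Longrightarrow> real hi + 1/2 \<le> y" using r by (auto split: if_splits)
        then show ?thesis using z av 1(1,3) r assms(6-) by (elim disjE conjE; linarith)
      next
        case 2
        then show ?thesis using z av r assms(6-) by (elim disjE conjE; linarith)
      next
        case 3
        then have "1/2 \<le> y" "p \<Longrightarrow> real lo + 1/2 \<le> y" using r by (auto split: if_splits)
        then show ?thesis using z av 3(1,3) r assms(6-) by (elim disjE conjE; linarith)
      qed
    qed
    then show "cap N lo hi a b e p q \<inter> zshape N j = {}" by fast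
  next
    assume empty: "cap N lo hi a b e p q \<inter> zshape N j = {}"
    show "p \<and> j = lo \<or> q \<and> j = hi"
    proof (rule ccontr)
      assume nav: "\<not> (p \<and> j = lo \<or> q \<and> j = hi)"
      consider "j < lo" | "j = lo" "\<not> p" | "lo < j" "j < hi" | "j = hi" "\<not> q" | "hi < j"
        using nav by linarith
      then have "\<exists>z. z \<in> cap N lo hi a b e p q \<and> z \<in> zshape N j"
      proof cases
        case 1
        then have "real j + 1 \<le> lo" by linarith
        then show ?thesis using r assms(6-) unfolding cap_def zshape_def
          by (intro exI[of _ "(- real j, 2 * real N + real hi - real lo + e)"]) (simp add: in_vhv)
      next
        case 2
        then show ?thesis using r assms(6-) unfolding cap_def zshape_def
          by (intro exI[of _ "(2 * real N - real hi + b, real j)"]) (simp add: in_vhv)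
      next
        case 3
        then have "real lo + 1 \<le> j" "real j + 1 \<le> hi" by linarith+
        then show ?thesis using r assms(6-) unfolding cap_def zshape_def
          by (intro exI[of _ "(2 * real N - real hi + b, real j)"]) (simp add: in_vhv)
      next
        case 4
        then show ?thesis using r assms(6-) unfolding cap_def zshape_def
          by (intro exI[of _ "(a - real lo, real j)"]) (simp add: in_vhv)
      next
        case 5
        then have "real hi + 1 \<le> j" by linarith
        then show ?thesis using r assms(6-) unfolding cap_def zshape_def
          by (intro exI[of _ "(a - real lo, real j)"]) (simp add: in_vhv)
      qed
      then show False using empty by blast
    qed
  qed
qed

text \<open>All top segments cross the vertical line through the origin, so two of equal height
  share a point of it.\<close>

lemma cap_meet_level:
  assumes "lo < hi" "hi < N" "0 < a" "a < 1" "0 < b" "b < 1"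
    and "1 \<le> lo" "1 \<le> lo'" "lo' < hi'" "hi' < N" "0 < a'" "a' < 1" "0 < b'" "b' < 1"
    and "real hi - real lo + e = real hi' - real lo' + e'"
  shows "cap N lo hi a b e p q \<inter> cap N lo' hi' a' b' e' p' q' \<noteq> {}"
proof -
  have r: "1 \<le> real lo" "1 \<le> real lo'" "real lo + 1 \<le> hi" "real hi + 1 \<le> N" "real lo' + 1 \<le> hi'" "real hi' + 1 \<le> N"
    using assms by linarith+
  have "(0, 2 * real N + real hi - real lo + e) \<in> cap N lo hi a b e p q \<inter> cap N lo' hi' a' b' e' p' q'"
    using assms r unfolding cap_def by (simp add: in_vhv)
  then show ?thesis by blast
qed

text \<open>Unless the higher cap strictly encloses the lower one on both sides, one of its legs
  comes down through the top segment of the lower one.\<close>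

lemma cap_meet_higher:
  assumes "lo < hi" "hi < N" "0 < a" "a < 1" "0 < b" "b < 1" "0 \<le> e"
    and "1 \<le> lo" "1 \<le> lo'" "lo' < hi'" "hi' < N" "0 < a'" "a' < 1" "0 < b'" "b' < 1"
    and T: "real hi - real lo + e < real hi' - real lo' + e'"
    and leg: "a - real lo \<le> a' - real lo' \<or> b' - real hi' \<le> b - real hi"
  shows "cap N lo hi a b e p q \<inter> cap N lo' hi' a' b' e' p' q' \<noteq> {}"
proof -
  have r: "1 \<le> real lo" "1 \<le> real lo'" "real lo + 1 \<le> hi" "real hi + 1 \<le> N" "real lo' + 1 \<le> hi'" "real hi' + 1 \<le> N"
    using assms by linarith+
  have "\<exists>z. z \<in> cap N lo hi a b e p q \<and> z \<in> cap N lo' hi' a' b' e' p' q'"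
  proof (cases "a - real lo \<le> a' - real lo'")
    case True
    then show ?thesis using assms(1-16) r unfolding cap_def
      by (intro exI[of _ "(a' - real lo', 2 * real N + real hi - real lo + e)"]) (simp add: in_vhv)
  next
    case False
    then have "b' - real hi' \<le> b - real hi" using leg by simp
    then show ?thesis using assms(1-16) r unfolding cap_def
      by (intro exI[of _ "(2 * real N - real hi' + b', 2 * real N + real hi - real lo + e)"]) (simp add: in_vhv)
  qed
  then show ?thesis by blast
qed

text \<open>This is why the height of a cap grows with \<open>hi - lo\<close>. To enclose another
  cap, a cap must have an index range contained in the range of the other one; if the ranges differ,
  it is then lower by at least one unit up to the offsets \<open>e\<close>, which are too small to
  make up for that. So caps of different edges are never nested.\<close>

lemma cap_meet:
  assumes "1 \<le> lo" "lo < hi" "hi < N" "0 < a" "a < 1" "0 < b" "b < 1" "0 \<le> e" "e < 1"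
    and "1 \<le> lo'" "lo' < hi'" "hi' < N" "0 < a'" "a' < 1" "0 < b'" "b' < 1" "0 \<le> e'" "e' < 1"
    and ne: "(lo, hi) \<noteq> (lo', hi')"
  shows "cap N lo hi a b e p q \<inter> cap N lo' hi' a' b' e' p' q' \<noteq> {}"
proof -
  have *: "cap N lo hi a b e p q \<inter> cap N lo' hi' a' b' e' p' q' \<noteq> {}"
    if T: "real hi - real lo + e < real hi' - real lo' + e'"
      and A: "1 \<le> lo" "lo < hi" "hi < N" "0 < a" "a < 1" "0 < b" "b < 1" "0 \<le> e" "e < 1"
        "1 \<le> lo'" "lo' < hi'" "hi' < N" "0 < a'" "a' < 1" "0 < b'" "b' < 1" "0 \<le> e'" "e' < 1" 
        "(lo, hi) \<noteq> (lo', hi')"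
    for lo hi lo' hi' a b e a' b' e' p q p' q'
  proof -
    have "real (hi + lo') < real (hi' + lo + 1)" using T A by simp
    then have "hi + lo' \<le> hi' + lo" by linarith
    then have "lo' < lo \<or> hi < hi'" using A(19) by auto
    then have "real lo' + 1 \<le> lo \<or> real hi + 1 \<le> hi'" by linarith
    then have leg: "a - real lo \<le> a' - real lo' \<or> b' - real hi' \<le> b - real hi" using A by linarith
    show ?thesis by (rule cap_meet_higher) (use leg A T in simp_all)
  qed
  consider "real hi - real lo + e < real hi' - real lo' + e'" | "real hi - real lo + e = real hi' - real lo' + e'"
    | "real hi' - real lo' + e' < real hi - real lo + e" by linarith
  then show ?thesis
  proof cases
    case 1
    then show ?thesis using *[OF 1] assms by blast
  next
    case 2
    show ?thesis by (rule cap_meet_level) (use 2 assms in simp_all)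
  next
    case 3
    then show ?thesis using *[OF 3] assms by (metis Int_commute)
  qed
qed

lemma cap_disjoint:
  assumes "1 \<le> lo" "lo < hi" "hi < N" "0 < a'" "a' < a" "a < 1" "0 < b" "b < b'" "b' < 1" "0 \<le> e" "e < e'" "e' < 1"
  shows "cap N lo hi a b e p q \<inter> cap N lo hi a' b' e' p' q' = {}"
proof -
  have r: "1 \<le> real lo" "real lo + 1 \<le> hi" "real hi + 1 \<le> N" using assms by linarith+
  have False if c: "(x, y) \<in> cap N lo hi a b e p q" and c': "(x, y) \<in> cap N lo hi a' b' e' p' q'" for x y
    
  proof -
    have A: "0 < a" "a < 1" "0 < b" "b < 1" "0 \<le> e" "e < 1" "0 < a'" "a' < 1" "0 < b'" "b' < 1" "0 \<le> e'" "e' < 1"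
      using assms by linarith+
    show False
      by (rule in_capE[OF c assms(2,3) A(1-6)]; rule in_capE[OF c' assms(2,3) A(7-12)]; use r assms(4-) in linarith)
  qed
  then show ?thesis by fast
qed

text \<open>Odd positions get the outer caps (\<open>s = -1\<close> for the left leg, \<open>s = 1\<close> for the right one), widened by
  3/2 steps, so that the \<open>i\<close>-th outer cap encloses exactly the inner caps \<open>i - 1\<close> and \<open>i + 1\<close>.\<close>

definition cap_pos :: "real \<Rightarrow> nat \<Rightarrow> nat \<Rightarrow> real" where
  "cap_pos s m i = 1/2 + (real i + (if odd i then s * (3/2) else 0)) / (4 * (real m + 2))"

lemma cap_pos_bounds:
  assumes "i < m" "\<bar>s\<bar> = 1" shows "0 < cap_pos s m i" "cap_pos s m i < 1"
proof -
  have "\<bar>real i + (if odd i then s * (3/2) else 0)\<bar> \<le> real m + 2" using assms by (auto simp: abs_if split: if_splits)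
  then have "\<bar>(real i + (if odd i then s * (3/2) else 0)) / (4 * (real m + 2))\<bar> \<le> 1/4"
    by (simp add: abs_divide field_simps)
  then show "0 < cap_pos s m i" "cap_pos s m i < 1" unfolding cap_pos_def by linarith+
qed

lemma cap_pos_less:
  "cap_pos s m i < cap_pos s m j \<longleftrightarrow>
    real i + (if odd i then s * (3/2) else 0) < real j + (if odd j then s * (3/2) else 0)"
  unfolding cap_pos_def by (simp add: divide_less_cancel)

text \<open>Shapes have to be disjoint exactly for adjacent vertices of the subdivision. Caps of one
  edge have two heights, according to parity: caps of equal parity overlap in their top segments,
  and for opposite parity the widening by 3/2 nests \<open>i\<close> in \<open>j\<close> exactly
  when their distance is below 3/2, that is, when they are consecutive.\<close>

theorem B_VPG_complement_subdivision:
  fixes V :: "'a set" and F :: "'b \<Rightarrow> 'b \<Rightarrow> bool"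
  assumes G: "graph V E" and sub: "full_subdivision V E W F"
  shows "B_VPG 2 W (graph_complement W F)"
proof -
  obtain g :: "'a \<Rightarrow> nat" and n where g: "inj_on g V" "g ` V = {i. i < n}"
    using G unfolding graph_def by (metis finite_imp_inj_to_nat_seg)
  define idx where "idx v = Suc (g v)" for v
  define N where "N = n + 2"
  have idx: "1 \<le> idx v" "idx v < N" if "v \<in> V" for v
  proof -
    have "g v < n" using that g(2) by blast
    then show "1 \<le> idx v" "idx v < N" by (auto simp: idx_def N_def)
  qed
  have idx_inj: "u = v" if "u \<in> V" "v \<in> V" "idx u = idx v" for u v
    using that g(1) by (auto simp: idx_def dest: inj_onD)
  have "inj_on (\<lambda>v. real (idx v)) V" using idx_inj by (auto intro: inj_onI)
  then obtain c m where c: "inj_on c W" "c ` W = sub_key V E (\<lambda>v. real (idx v)) m"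
    and F: "\<And>w w'. w \<in> W \<Longrightarrow> w' \<in> W \<Longrightarrow> F w w' \<longleftrightarrow> sub_adj m (c w) (c w')"
    using full_subdivision_coordinates[OF G sub] by metis
  define R where "R k = (case k of Inl v \<Rightarrow> zshape N (idx v)
    | Inr (u, v, i) \<Rightarrow> cap N (idx u) (idx v) (cap_pos (-1) (m u v) i) (cap_pos 1 (m u v) i)
        (if odd i then 1/4 else 0) (i = 0) (Suc i = m u v))" for k
  let ?K = "sub_key V E (\<lambda>v. real (idx v)) m"
  have EV: "u \<in> V" "v \<in> V" if "E u v" for u v using G that unfolding graph_def by blast+
  have key: "1 \<le> idx u \<and> idx u < idx v \<and> idx v < N \<and> i < m u v \<and> u \<in> V \<and> v \<in> V"
    if "Inr (u, v, i) \<in> ?K" for u v i using that EV idx by (auto simp: sub_key_def)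
  note posb = cap_pos_bounds[where s="-1", simplified] cap_pos_bounds[where s=1, simplified]
  have bend: "k_bend_path 2 (R k)" if "k \<in> ?K" for k
  proof (cases k)
    case (Inl v)
    then have "1 \<le> idx v" "idx v < N" using that idx by (auto simp: sub_key_def)
    then show ?thesis unfolding R_def Inl zshape_def by (auto intro!: k_bend_path_vhv)
  next
    case (Inr t)
    obtain u v i where t: "t = (u, v, i)" by (cases t) auto
    have k: "1 \<le> idx u" "idx u < idx v" "idx v < N" "i < m u v" using key that Inr t by blast+
    have "real (idx u) + 1 \<le> idx v" "real (idx v) + 1 \<le> N" "1 \<le> real (idx u)" using k by linarith+
    then show ?thesis unfolding R_def Inr t cap_def sum.case prod.case
      using posb[OF k(4)] by (intro k_bend_path_vhv) auto
  qed
  have mixed: "R (Inr (u, v, i)) \<inter> R (Inl w) = {} \<longleftrightarrow> sub_adj m (Inl w) (Inr (u, v, i))"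
    if "Inr (u, v, i) \<in> ?K" "Inl w \<in> ?K" for u v i w
  proof -
    have k: "1 \<le> idx u" "idx u < idx v" "idx v < N" "i < m u v" "u \<in> V" "v \<in> V" using key[OF that(1)] by auto
    have w: "w \<in> V" "1 \<le> idx w" "idx w < N" using that(2) idx by (auto simp: sub_key_def)
    have "R (Inr (u, v, i)) \<inter> R (Inl w) = {} \<longleftrightarrow> i = 0 \<and> idx w = idx u \<or> Suc i = m u v \<and> idx w = idx v"
      unfolding R_def sum.case prod.case
      using k w posb[OF k(4)] by (intro cap_zshape) auto
    also have "\<dots> \<longleftrightarrow> sub_adj m (Inl w) (Inr (u, v, i))" using idx_inj k w by auto
    finally show ?thesis .
  qed
  have inner: "R (Inr (u, v, i)) \<inter> R (Inr (u', v', j)) = {} \<longleftrightarrow> sub_adj m (Inr (u, v, i)) (Inr (u', v', j))"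
    if "Inr (u, v, i) \<in> ?K" "Inr (u', v', j) \<in> ?K" "(u, v, i) \<noteq> (u', v', j)" for u v i u' v' j
  proof -
    have k: "1 \<le> idx u" "idx u < idx v" "idx v < N" "i < m u v" "u \<in> V" "v \<in> V" using key[OF that(1)] by auto
    have k': "1 \<le> idx u'" "idx u' < idx v'" "idx v' < N" "j < m u' v'" "u' \<in> V" "v' \<in> V" using key[OF that(2)] by auto
    show ?thesis
    proof (cases "u = u' \<and> v = v'")
      case False
      then have "(idx u, idx v) \<noteq> (idx u', idx v')" using idx_inj k k' by auto
      then have "R (Inr (u, v, i)) \<inter> R (Inr (u', v', j)) \<noteq> {}"
        unfolding R_def sum.case prod.case
        using k k' posb[OF k(4)] posb[OF k'(4)] by (intro cap_meet) auto
      then show ?thesis using False by auto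
    next
      case uv: True
      have ij: "i \<noteq> j" using that(3) uv by auto
      have main: "R (Inr (u, v, i)) \<inter> R (Inr (u, v, j)) = {} \<longleftrightarrow> Suc i = j \<or> Suc j = i"
        if ev: "even i" "odd j" and k: "i < m u v" "j < m u v" for i j
      proof (cases "Suc i = j \<or> Suc j = i")
        case True
        then have "cap_pos (-1) (m u v) j < cap_pos (-1) (m u v) i" "cap_pos 1 (m u v) i < cap_pos 1 (m u v) j"
          using ev by (auto simp: cap_pos_less)
        then show ?thesis using True ev key[OF \<open>Inr (u, v, _) \<in> ?K\<close>] posb[OF k(1)] posb[OF k(2)]
          unfolding R_def sum.case prod.case
          by (simp, intro cap_disjoint) auto
      next
        case False
        then have "i + 2 \<le> j \<or> j + 2 \<le> i" using ev by (metis Suc_leI add_2_eq_Suc' le_neq_implies_less nat_le_linear not_less_eq_eq)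
        then have "\<not> cap_pos (-1) (m u v) j < cap_pos (-1) (m u v) i \<or> \<not> cap_pos 1 (m u v) i < cap_pos 1 (m u v) j"
          using ev by (auto simp: cap_pos_less)
        then have "R (Inr (u, v, i)) \<inter> R (Inr (u, v, j)) \<noteq> {}"
          using ev key[OF \<open>Inr (u, v, _) \<in> ?K\<close>] posb[OF k(1)] posb[OF k(2)]
          unfolding R_def sum.case prod.case
          by (intro cap_meet_higher) auto
        then show ?thesis using False by simp
      qed
      have same: "R (Inr (u, v, i)) \<inter> R (Inr (u, v, j)) \<noteq> {}" if "even i \<longleftrightarrow> even j"
        unfolding R_def sum.case prod.case
        using k k' uv posb[OF k(4)] posb[OF k'(4)] that by (intro cap_meet_level) auto
      consider "even i \<longleftrightarrow> even j" | "even i" "odd j" | "odd i" "even j" by blast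
      then show ?thesis
      proof cases
        case 1
        then show ?thesis using same uv by auto
      next
        case 2
        then show ?thesis using main[OF 2] k k' uv by auto
      next
        case 3
        then show ?thesis using main[OF 3(2,1)] k k' uv by (auto simp: Int_commute)
      qed
    qed
  qed
  have "R k \<inter> R k' = {} \<longleftrightarrow> sub_adj m k k'" if k: "k \<in> ?K" "k' \<in> ?K" "k \<noteq> k'" for k k'
  proof (cases k)
    case (Inl v)
    show ?thesis
    proof (cases k')
      case i': (Inl v')
      have v: "v \<in> V" "v' \<in> V" "v \<noteq> v'" using k Inl i' by (auto simp: sub_key_def)
      then have "idx v < idx v' \<or> idx v' < idx v" using idx_inj by (meson linorder_neqE_nat)
      then have "zshape N (idx v) \<inter> zshape N (idx v') \<noteq> {}"
        using zshape_meet[of "idx v" "idx v'" N] zshape_meet[of "idx v'" "idx v" N] idx v by blast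
      then show ?thesis using Inl i' by (simp add: R_def)
    next
      case (Inr t)
      then show ?thesis using mixed[of _ _ _ v] k Inl by (cases t) (auto simp: Int_commute)
    qed
  next
    case (Inr t)
    obtain u v i where t: "t = (u, v, i)" by (cases t) auto
    show ?thesis
    proof (cases k')
      case (Inl w)
      then show ?thesis using mixed[of u v i w] k Inr t by simp
    next
      case i': (Inr t')
      obtain u' v' j where t': "t' = (u', v', j)" by (cases t') auto
      show ?thesis using inner[of u v i u' v' j] k Inr i' t t' by blast
    qed
  qed
  then have "graph_complement W F w w' \<longleftrightarrow> R (c w) \<inter> R (c w') \<noteq> {}" if "w \<in> W" "w' \<in> W" "w \<noteq> w'" for w w'
    using that c F unfolding graph_complement_def by (metis image_eqI inj_onD)
  moreover have "k_bend_path 2 (R (c w))" if "w \<in> W" for w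
    using bend c(2) that by blast
  ultimately show ?thesis unfolding B_VPG_def
    by (intro exI[of _ "R \<circ> c"]) simp
qed

section \<open>From bar representations to L-shapes\<close>

text \<open>\<open>y\<close> gives the heights of the bars, \<open>l\<close> and \<open>r\<close>
  their ends, \<open>x\<close> the positions of the vertical segments; \<open>x\<close> takes
  unordered pairs because both orientations of an edge share a segment. A bar may be a single point.
  The strict inequalities in the last clause leave a margin by which bars can be widened.\<close>

definition bar_rep ::
  "'a set \<Rightarrow> ('a \<Rightarrow> 'a \<Rightarrow> bool) \<Rightarrow> ('a \<Rightarrow> real) \<Rightarrow> ('a set \<Rightarrow> real) \<Rightarrow> ('a \<Rightarrow> real) \<Rightarrow> ('a \<Rightarrow> real) \<Rightarrow> bool" where
  "bar_rep S E y x l r \<longleftrightarrow> inj_on y S \<and> (\<forall>u\<in>S. l u \<le> r u) \<and>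
    (\<forall>u\<in>S. \<forall>v\<in>S. E u v \<longrightarrow> l u \<le> x {u, v} \<and> x {u, v} \<le> r u) \<and>
    (\<forall>u\<in>S. \<forall>v\<in>S. \<forall>u'\<in>S. \<forall>v'\<in>S. E u v \<longrightarrow> E u' v' \<longrightarrow> x {u, v} = x {u', v'} \<longrightarrow> {u, v} = {u', v'}) \<and>
    (\<forall>u\<in>S. \<forall>v\<in>S. \<forall>w\<in>S. E u v \<longrightarrow> y u < y w \<longrightarrow> y w < y v \<longrightarrow> x {u, v} < l w \<or> r w < x {u, v})"

lemma finite_gap:
  fixes X :: "real set"
  assumes "finite X"
  obtains d where "0 < d" "\<And>a b. a \<in> X \<Longrightarrow> b \<in> X \<Longrightarrow> a < b \<Longrightarrow> a + d \<le> b"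
proof -
  define D where "D = insert 1 ((\<lambda>(a, b). b - a) ` {(a, b) \<in> X \<times> X. a < b})"
  have "finite D" unfolding D_def using assms by (auto intro: finite_subset[of _ "X \<times> X"])
  have "\<forall>t\<in>D. 0 < t" by (auto simp: D_def)
  then have "0 < Min D" using \<open>finite D\<close> by (subst Min_gr_iff) (auto simp: D_def)
  moreover have "a + Min D \<le> b" if "a \<in> X" "b \<in> X" "a < b" for a b
  proof -
    have "b - a \<in> D" using that by (auto simp: D_def)
    then show ?thesis using Min_le[OF \<open>finite D\<close>] by fastforce
  qed
  ultimately show ?thesis using that by blast
qed

lemma in_Lshape:
  "(p, q) \<in> Lshape (c1, c2) a b \<longleftrightarrow> q = c2 \<and> c1 \<le> p \<and> p \<le> c1 + a \<or> p = c1 \<and> c2 \<le> q \<and> q \<le> c2 + b"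
proof -
  have *: "(\<exists>t. p = c + t \<and> 0 \<le> t \<and> t \<le> a) \<longleftrightarrow> c \<le> p \<and> p \<le> c + a" for p c a :: real
    by (metis add_le_cancel_left diff_add_cancel diff_ge_0_iff_ge add.commute)
  show ?thesis using *[of p c1 a] *[of q c2 b] by (auto simp: Lshape_def)
qed

text \<open>The widened bar of \<open>v\<close> is the horizontal leg of its L, and the vertical leg
  is too short to reach the next bar. The segment of an edge is cut into \<open>m u v\<close> equal
  vertical legs, each with a short foot to the right; consecutive pieces touch, the first piece
  stands on the lower bar and the last one reaches the upper bar.\<close>

lemma L_graph_of_bar_rep:
  fixes V :: "'a set" and F :: "'b \<Rightarrow> 'b \<Rightarrow> bool"
  assumes G: "graph V E" and sub: "full_subdivision V E W F" and rep: "bar_rep V E y x l r"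
  shows "L_graph W F"
proof -
  have EV: "u \<in> V" "v \<in> V" "u \<noteq> v" "E v u" if "E u v" for u v
    using G that unfolding graph_def by blast+
  have fin: "finite V" using G by (simp add: graph_def)
  have yinj: "inj_on y V" using rep by (simp add: bar_rep_def)
  have lr: "l u \<le> r u" if "u \<in> V" for u using rep that by (simp add: bar_rep_def)
  have ends: "l u \<le> x {u, v} \<and> x {u, v} \<le> r u" if "E u v" for u v
    using rep EV(1,2)[OF that] that by (simp add: bar_rep_def)
  have xinj: "{u, v} = {u', v'}" if "E u v" "E u' v'" "x {u, v} = x {u', v'}" for u v u' v'
    using rep EV(1,2)[OF that(1)] EV(1,2)[OF that(2)] that by (simp add: bar_rep_def)
  have pass: "x {u, v} < l w \<or> r w < x {u, v}" if "E u v" "w \<in> V" "y u < y w" "y w < y v" for u v w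
    using rep EV(1,2)[OF that(1)] that by (simp add: bar_rep_def)
  have ends': "l v \<le> x {u, v} \<and> x {u, v} \<le> r v" if "E u v" for u v
    using ends[of v u] EV(4)[OF that] by (simp add: insert_commute)
  obtain c m where c: "inj_on c W" "c ` W = sub_key V E y m"
    and F: "\<And>w w'. w \<in> W \<Longrightarrow> w' \<in> W \<Longrightarrow> F w w' \<longleftrightarrow> sub_adj m (c w) (c w')"
    using full_subdivision_coordinates[OF G sub yinj] by metis
  let ?K = "sub_key V E y m"
  \<comment> \<open>\<open>Pow V\<close> contains more sets than the edges, but it is finite, which
    is all that the gap argument asks for.\<close>
  define X where "X = l ` V \<union> r ` V \<union> x ` Pow V"
  have "finite X" using fin by (simp add: X_def)
  then obtain d where "0 < d" and d: "\<And>a b. a \<in> X \<Longrightarrow> b \<in> X \<Longrightarrow> a < b \<Longrightarrow> a + d \<le> b"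
    by (rule finite_gap) blast
  \<comment> \<open>Different values in \<open>X\<close> are then at least
    \<open>5 * \<delta>\<close> apart, so widening bars by \<open>\<delta>\<close> and adding feet
    of length \<open>\<delta>\<close> creates no contact.\<close>
  define \<delta> where "\<delta> = d / 5"
  have \<delta>: "0 < \<delta>" "\<And>a b. a \<in> X \<Longrightarrow> b \<in> X \<Longrightarrow> a < b \<Longrightarrow> a + 5 * \<delta> \<le> b"
    using \<open>0 < d\<close> d by (auto simp: \<delta>_def)
  have inX: "l v \<in> X" "r v \<in> X" if "v \<in> V" for v using that by (auto simp: X_def)
  have inX': "x {u, v} \<in> X" if "E u v" for u v using EV[OF that] by (auto simp: X_def)
  obtain d' where "0 < d'" and d': "\<And>a b. a \<in> y ` V \<Longrightarrow> b \<in> y ` V \<Longrightarrow> a < b \<Longrightarrow> a + d' \<le> b"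
    using finite_gap[of "y ` V"] fin by blast
  define h where "h u v = (y v - y u) / m u v" for u v
  define R where "R k = (case k of Inl v \<Rightarrow> Lshape (l v - \<delta>, y v) (r v - l v + 2 * \<delta>) (d' / 2)
    | Inr (u, v, i) \<Rightarrow> Lshape (x {u, v}, y u + real i * h u v) \<delta> (h u v))" for k
  have key: "E u v" "y u < y v" "i < m u v" "u \<in> V" "v \<in> V" "0 < h u v" "y u + real (m u v) * h u v = y v"
    if "Inr (u, v, i) \<in> ?K" for u v i
    using that EV by (auto simp: sub_key_def h_def)
  have hle: "y u + real i * h u v \<le> y u + real j * h u v" if "Inr (u, v, k) \<in> ?K" "i \<le> j" for u v i j k
    using key(6)[OF that(1)] that(2) by simp
  have hless: "y u + real i * h u v < y u + real j * h u v" if "Inr (u, v, k) \<in> ?K" "i < j" for u v i j k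
    using key(6)[OF that(1)] that(2) by simp
  have hSuc: "y u + real i * h u v + h u v = y u + real (Suc i) * h u v" for u v i
    by (simp add: algebra_simps)
  have shape: "is_Lshape_ll (R k)" if "k \<in> ?K" for k
  proof (cases k)
    case (Inl v)
    then have "l v \<le> r v" using that lr by (auto simp: sub_key_def)
    then show ?thesis using Inl \<delta>(1) \<open>0 < d'\<close> unfolding is_Lshape_ll_def R_def
      by (intro exI conjI) auto
  next
    case (Inr t)
    obtain u v i where t: "t = (u, v, i)" by (cases t) auto
    then show ?thesis using Inr \<delta>(1) key(6) that unfolding is_Lshape_ll_def R_def
      by (intro exI conjI) auto
  qed
  have bars: "R (Inl v) \<inter> R (Inl w) = {}" if "v \<in> V" "w \<in> V" "y v < y w" for v w
  proof -
    have "y v + d' \<le> y w" using d' that by blast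
    then have False if "(p, q) \<in> R (Inl v)" "(p, q) \<in> R (Inl w)" for p q
      using that \<open>0 < d'\<close> unfolding R_def sum.case in_Lshape by linarith
    then show ?thesis by fast
  qed
  have inner: "x {u, v} \<le> p" "p \<le> x {u, v} + \<delta>" "y u + real i * h u v \<le> q" "q \<le> y u + real (Suc i) * h u v"
    if "(p, q) \<in> R (Inr (u, v, i))" "Inr (u, v, i) \<in> ?K" for u v i p q
    using that(1) key(6)[OF that(2)] \<delta>(1) unfolding R_def sum.case prod.case in_Lshape hSuc[symmetric]
    by linarith+
  have innerI: "(x {u, v}, q) \<in> R (Inr (u, v, i))"
    if "y u + real i * h u v \<le> q" "q \<le> y u + real (Suc i) * h u v" for u v i q
    using that unfolding R_def sum.case prod.case in_Lshape hSuc[symmetric] by blast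
  have barI: "(x {u, v}, y w) \<in> R (Inl w)" if "E u v" "w = u \<or> w = v" for u v w
    using ends[OF that(1)] ends'[OF that(1)] that(2) \<delta>(1) unfolding R_def sum.case in_Lshape by auto
  have mixed: "R (Inr (u, v, i)) \<inter> R (Inl w) \<noteq> {} \<longleftrightarrow> sub_adj m (Inl w) (Inr (u, v, i))"
    if k: "Inr (u, v, i) \<in> ?K" and "Inl w \<in> ?K" for u v i w
  proof -
    note e = key[OF k]
    have w: "w \<in> V" using \<open>Inl w \<in> ?K\<close> by (auto simp: sub_key_def)
    show ?thesis
    proof
      assume "R (Inr (u, v, i)) \<inter> R (Inl w) \<noteq> {}"
      then obtain p q where pq: "(p, q) \<in> R (Inr (u, v, i))" "(p, q) \<in> R (Inl w)" by fast
      note b = inner[OF pq(1) k]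
      have lo: "y u \<le> q" using b(3) hle[OF k, of 0 i] by simp
      have hi: "q \<le> y v" using b(4) hle[OF k, of "Suc i" "m u v"] e by simp
      have nw: "y w \<le> q" and bar: "p = l w - \<delta> \<or> q = y w \<and> l w - \<delta> \<le> p \<and> p \<le> r w + \<delta>"
        using pq(2) \<open>0 < d'\<close> unfolding R_def sum.case in_Lshape by auto
      \<comment> \<open>The vertical leg of the L of \<open>w\<close> stands at
        \<open>l w - \<delta>\<close>. A segment to the left of \<open>l w\<close> is at least
        \<open>5 * \<delta>\<close> away from \<open>l w\<close>, so even its foot ends before this
        leg.\<close>
      have far: "\<not> (x {u, v} \<le> l w - \<delta> \<and> l w - \<delta> \<le> x {u, v} + \<delta>)"
        using \<delta>(2)[OF inX'[OF e(1)] inX(1)[OF w]] \<delta>(1) by linarith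
      then have qw: "q = y w" and lp: "l w - \<delta> \<le> p" "p \<le> r w + \<delta>" using bar b(1,2) by auto
      show "sub_adj m (Inl w) (Inr (u, v, i))"
      proof (cases "w = u \<or> w = v")
        case True
        have "i = 0" if "w = u" using b(3) qw hless[OF k, of 0 i] that by (cases i) auto
        moreover have "Suc i = m u v" if "w = v"
          using b(4) qw hless[OF k, of "Suc i" "m u v"] e(3,7) that by (cases "Suc i = m u v") auto
        ultimately show ?thesis using True by auto
      next
        case False
        then have "y w \<noteq> y u" "y w \<noteq> y v" using yinj e w by (auto dest: inj_onD)
        then have "x {u, v} < l w \<or> r w < x {u, v}" using pass[OF e(1) w] lo hi qw by auto
        then show ?thesis
          using \<delta>(2)[OF inX'[OF e(1)] inX(1)[OF w]] \<delta>(2)[OF inX(2)[OF w] inX'[OF e(1)]] b lp \<delta>(1) by linarith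
      qed
    next
      assume "sub_adj m (Inl w) (Inr (u, v, i))"
      then consider "w = u" "i = 0" | "w = v" "Suc i = m u v" by auto
      then have "(x {u, v}, y w) \<in> R (Inr (u, v, i))"
      proof cases
        case 1
        then show ?thesis using e by (intro innerI) auto
      next
        case 2
        then show ?thesis using e(6,7) hle[OF k, of i "Suc i"] by (intro innerI) auto
      qed
      moreover have "w = u \<or> w = v" using \<open>sub_adj m (Inl w) (Inr (u, v, i))\<close> by auto
      ultimately show "R (Inr (u, v, i)) \<inter> R (Inl w) \<noteq> {}" using barI[OF e(1)] by blast
    qed
  qed
  have chain: "R (Inr (u, v, i)) \<inter> R (Inr (u', v', j)) \<noteq> {} \<longleftrightarrow> sub_adj m (Inr (u, v, i)) (Inr (u', v', j))"
    if k: "Inr (u, v, i) \<in> ?K" "Inr (u', v', j) \<in> ?K" "(u, v, i) \<noteq> (u', v', j)" for u v i u' v' j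
  proof (cases "u = u' \<and> v = v'")
    case False
    then have "{u, v} \<noteq> {u', v'}" using key(2)[OF k(1)] key(2)[OF k(2)] by (auto simp: doubleton_eq_iff)
    then have "x {u, v} \<noteq> x {u', v'}" using xinj key(1)[OF k(1)] key(1)[OF k(2)] by blast
    then have far: "x {u, v} + 5 * \<delta> \<le> x {u', v'} \<or> x {u', v'} + 5 * \<delta> \<le> x {u, v}"
      using \<delta>(2) inX' key(1)[OF k(1)] key(1)[OF k(2)] by (meson linorder_neqE_linordered_idom)
    have False if "(p, q) \<in> R (Inr (u, v, i))" "(p, q) \<in> R (Inr (u', v', j))" for p q
      using inner(1,2)[OF that(1) k(1)] inner(1,2)[OF that(2) k(2)] far \<delta>(1) by linarith
    then have "R (Inr (u, v, i)) \<inter> R (Inr (u', v', j)) = {}" by fast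
    then show ?thesis using False by auto
  next
    case True
    have main: "R (Inr (u, v, i)) \<inter> R (Inr (u, v, j)) \<noteq> {} \<longleftrightarrow> Suc i = j"
      if k: "Inr (u, v, i) \<in> ?K" "Inr (u, v, j) \<in> ?K" "i < j" for i j
    proof
      assume "R (Inr (u, v, i)) \<inter> R (Inr (u, v, j)) \<noteq> {}"
      then obtain p q where "(p, q) \<in> R (Inr (u, v, i))" "(p, q) \<in> R (Inr (u, v, j))" by fast
      then have "y u + real j * h u v \<le> y u + real (Suc i) * h u v"
        using inner(4)[OF _ k(1)] inner(3)[OF _ k(2)] by fastforce
      then show "Suc i = j" using hless[OF k(1), of "Suc i" j] k(3) by (cases "Suc i = j") auto
    next
      assume "Suc i = j"
      then have "(x {u, v}, y u + real j * h u v) \<in> R (Inr (u, v, i)) \<inter> R (Inr (u, v, j))"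
        using hle[OF k(1), of i j] hle[OF k(1), of j "Suc j"] by (auto intro!: innerI)
      then show "R (Inr (u, v, i)) \<inter> R (Inr (u, v, j)) \<noteq> {}" by blast
    qed
    have "i < j \<or> j < i" using True k(3) by auto
    then show ?thesis using main[of i j] main[of j i] k True by (auto simp: Int_commute)
  qed
  have "R k \<inter> R k' \<noteq> {} \<longleftrightarrow> sub_adj m k k'" if k: "k \<in> ?K" "k' \<in> ?K" "k \<noteq> k'" for k k'
  proof (cases k)
    case (Inl v)
    show ?thesis
    proof (cases k')
      case i': (Inl v')
      have v: "v \<in> V" "v' \<in> V" "v \<noteq> v'" using k Inl i' by (auto simp: sub_key_def)
      then have "y v < y v' \<or> y v' < y v" using yinj by (meson inj_onD linorder_neqE_linordered_idom)
      then have "R (Inl v) \<inter> R (Inl v') = {}" using bars v by blast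
      then show ?thesis using Inl i' by simp
    next
      case (Inr t)
      then show ?thesis using mixed[of _ _ _ v] k Inl by (cases t) (auto simp: Int_commute)
    qed
  next
    case (Inr t)
    obtain u v i where t: "t = (u, v, i)" by (cases t) auto
    show ?thesis
    proof (cases k')
      case (Inl w)
      then show ?thesis using mixed[of u v i w] k Inr t by simp
    next
      case i': (Inr t')
      obtain u' v' j where t': "t' = (u', v', j)" by (cases t') auto
      show ?thesis using chain[of u v i u' v' j] k Inr i' t t' by blast
    qed
  qed
  then have "F w w' \<longleftrightarrow> R (c w) \<inter> R (c w') \<noteq> {}" if "w \<in> W" "w' \<in> W" "w \<noteq> w'" for w w'
    using that c F by (metis image_eqI inj_onD)
  moreover have "is_Lshape_ll (R (c w))" if "w \<in> W" for w using shape c(2) that by blast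
  ultimately show ?thesis unfolding L_graph_def by (intro exI[of _ "R \<circ> c"]) simp
qed

section \<open>Gluing bar representations\<close>

text \<open>An increasing affine map sends a bounded interval around \<open>Z\<close> into the gap
  between \<open>a\<close> and the next larger element of \<open>X\<close>. It serves to insert a
  finite configuration just above a given value while keeping its internal order and its position
  relative to all old values.\<close>

lemma squeeze_below:
  fixes Z X :: "real set"
  assumes "finite Z" "finite X"
  obtains f :: "real \<Rightarrow> real" where "strict_mono f" "\<And>z. z \<in> Z \<Longrightarrow> a < f z"
    "\<And>z b. z \<in> Z \<Longrightarrow> b \<in> X \<Longrightarrow> a < b \<Longrightarrow> f z < b"
proof -
  obtain d where d: "0 < d" "\<And>p q. p \<in> insert a X \<Longrightarrow> q \<in> insert a X \<Longrightarrow> p < q \<Longrightarrow> p + d \<le> q"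
    using finite_gap[of "insert a X"] assms(2) by blast
  obtain M where "\<forall>z\<in>Z. norm z < M" using assms(1) finite_imp_bounded bounded_pos_less by metis
  then have M: "\<And>z. z \<in> Z \<Longrightarrow> \<bar>z\<bar> < max M 1" by fastforce
  define f where "f t = a + d * ((t + max M 1) / (2 * max M 1))" for t
  have "strict_mono f" unfolding f_def using d(1)
    by (intro strict_monoI add_strict_left_mono mult_strict_left_mono divide_strict_right_mono) auto
  moreover have "a < f z \<and> f z < a + d" if "z \<in> Z" for z
  proof -
    define q where "q = (z + max M 1) / (2 * max M 1)"
    have "0 < q" "q < 1"
      using M[OF that] by (auto simp: q_def field_simps abs_less_iff)
    then show ?thesis using d(1) by (simp add: f_def flip: q_def)
  qed
  ultimately show ?thesis using that d(2)[of a] by fastforce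
qed

text \<open>The second representation, with \<open>c\<close> at its bottom, is shrunk into a small
  box just above the height of the bar of \<open>c\<close> and just to the right of its right end.
  No bar of the first representation lies at these heights, and no segment of it runs at the
  positions of the box.\<close>

lemma bar_rep_merge:
  fixes E :: "'a \<Rightarrow> 'a \<Rightarrow> bool"
  assumes sym: "\<And>u v. E u v \<Longrightarrow> E v u"
    and fin: "finite S1" "finite S2" and c: "S1 \<inter> S2 = {c}"
    and no: "\<And>u v. u \<in> S1 - {c} \<Longrightarrow> v \<in> S2 - {c} \<Longrightarrow> \<not> E u v"
    and R1: "bar_rep S1 E y1 x1 l1 r1" and R2: "bar_rep S2 E y2 x2 l2 r2"
    and low: "\<And>v. v \<in> S2 \<Longrightarrow> y2 c \<le> y2 v"
  obtains y x l r where "bar_rep (S1 \<union> S2) E y x l r" "\<And>v. v \<in> S1 \<Longrightarrow> y v = y1 v"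
    "\<And>v. v \<in> S2 - {c} \<Longrightarrow> y1 c < y v"
proof -
  have yinj1: "inj_on y1 S1" and yinj2: "inj_on y2 S2" using R1 R2 by (simp_all add: bar_rep_def)
  have lr1: "l1 u \<le> r1 u" if "u \<in> S1" for u using R1 that by (simp add: bar_rep_def)
  have lr2: "l2 u \<le> r2 u" if "u \<in> S2" for u using R2 that by (simp add: bar_rep_def)
  have ends1: "l1 u \<le> x1 {u, v}" "x1 {u, v} \<le> r1 u" if "u \<in> S1" "v \<in> S1" "E u v" for u v
    using R1 that by (simp_all add: bar_rep_def)
  have ends2: "l2 u \<le> x2 {u, v}" "x2 {u, v} \<le> r2 u" if "u \<in> S2" "v \<in> S2" "E u v" for u v
    using R2 that by (simp_all add: bar_rep_def)
  have xinj1: "{u, v} = {u', v'}" if "u \<in> S1" "v \<in> S1" "E u v" "u' \<in> S1" "v' \<in> S1" "E u' v'" "x1 {u, v} = x1 {u', v'}" for u v u' v'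
    using R1 that by (simp add: bar_rep_def)
  have xinj2: "{u, v} = {u', v'}" if "u \<in> S2" "v \<in> S2" "E u v" "u' \<in> S2" "v' \<in> S2" "E u' v'" "x2 {u, v} = x2 {u', v'}" for u v u' v'
    using R2 that by (simp add: bar_rep_def)
  have pass1: "x1 {u, v} < l1 w \<or> r1 w < x1 {u, v}" if "u \<in> S1" "v \<in> S1" "E u v" "w \<in> S1" "y1 u < y1 w" "y1 w < y1 v" for u v w
    using R1 that by (simp add: bar_rep_def)
  have pass2: "x2 {u, v} < l2 w \<or> r2 w < x2 {u, v}" if "u \<in> S2" "v \<in> S2" "E u v" "w \<in> S2" "y2 u < y2 w" "y2 w < y2 v" for u v w
    using R2 that by (simp add: bar_rep_def)
  obtain fy where fy: "strict_mono fy" "\<And>z. z \<in> y2 ` S2 \<Longrightarrow> y1 c < fy z"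
    "\<And>z b. z \<in> y2 ` S2 \<Longrightarrow> b \<in> y1 ` S1 \<Longrightarrow> y1 c < b \<Longrightarrow> fy z < b"
    using squeeze_below[of "y2 ` S2" "y1 ` S1" "y1 c"] fin by blast
  obtain fx where fx: "strict_mono fx" "\<And>z. z \<in> x2 ` Pow S2 \<union> l2 ` S2 \<union> r2 ` S2 \<Longrightarrow> r1 c < fx z"
    "\<And>z b. z \<in> x2 ` Pow S2 \<union> l2 ` S2 \<union> r2 ` S2 \<Longrightarrow> b \<in> x1 ` Pow S1 \<Longrightarrow> r1 c < b \<Longrightarrow> fx z < b"
    using squeeze_below[of "x2 ` Pow S2 \<union> l2 ` S2 \<union> r2 ` S2" "x1 ` Pow S1" "r1 c"] fin by blast
  have cS: "c \<in> S1" "c \<in> S2" using c by auto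
  have fy1: "y1 c < fy (y2 v)" if "v \<in> S2" for v using fy(2) that by blast
  have fy2: "fy (y2 v) < y1 w" if "v \<in> S2" "w \<in> S1" "y1 c < y1 w" for v w using fy(3) that by blast
  have fxl: "r1 c < fx (x2 {u, v})" "r1 c < fx (l2 u)" "r1 c < fx (r2 u)" if "u \<in> S2" "v \<in> S2" for u v
    using fx(2) that by auto
  have fxr: "fx (x2 {u, v}) < x1 {u', v'}" "fx (l2 u) < x1 {u', v'}" "fx (r2 u) < x1 {u', v'}"
    if "u \<in> S2" "v \<in> S2" "u' \<in> S1" "v' \<in> S1" "r1 c < x1 {u', v'}" for u v u' v'
    using fx(3) that by auto
  note fxm = strict_mono_less[OF fx(1)] strict_mono_less_eq[OF fx(1)] strict_mono_eq[OF fx(1)]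
  define y where "y v = (if v \<in> S1 then y1 v else fy (y2 v))" for v
  define x where "x e = (if e \<subseteq> S1 then x1 e else fx (x2 e))" for e
  define l where "l v = (if v \<in> S1 then l1 v else fx (l2 v))" for v
  \<comment> \<open>The bar of \<open>c\<close> is prolonged to the right underneath the box, up to
    the right end it has in the second representation.\<close>
  define r where "r v = (if v = c then fx (r2 c) else if v \<in> S1 then r1 v else fx (r2 v))" for v
  have S2: "v \<notin> S1 \<longleftrightarrow> v \<noteq> c" if "v \<in> S2" for v using c that by blast
  have edge: "u \<in> S1 \<and> v \<in> S1 \<and> x {u, v} = x1 {u, v} \<or> u \<in> S2 \<and> v \<in> S2 \<and> x {u, v} = fx (x2 {u, v})"
    if "u \<in> S1 \<union> S2" "v \<in> S1 \<union> S2" "E u v" for u v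
  proof (cases "u \<in> S1 \<and> v \<in> S1")
    case True
    then show ?thesis by (simp add: x_def)
  next
    case False
    then have "u \<in> S2" "v \<in> S2" using that no[of u v] no[of v u] sym[of u v] cS by blast+
    then show ?thesis using False by (simp add: x_def)
  qed
  have y2: "y v = fy (y2 v)" if "v \<in> S2" "v \<noteq> c" for v using that S2 by (simp add: y_def)
  have y2up: "y v < y1 w" if "v \<in> S2" "w \<in> S1" "y1 c < y1 w" for v w
    using fy2[OF that] that S2[OF that(1)] by (auto simp: y_def)
  have y2low: "y1 c \<le> y v" if "v \<in> S2" for v
    using fy1[OF that] S2[OF that] by (cases "v = c") (auto simp: y_def)
  have "bar_rep (S1 \<union> S2) E y x l r" unfolding bar_rep_def
  proof (intro conjI ballI impI)
    show "inj_on y (S1 \<union> S2)"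
    proof (rule inj_onI)
      fix u v assume uv: "u \<in> S1 \<union> S2" "v \<in> S1 \<union> S2" "y u = y v"
      have mix: False if "u \<in> S1" "v \<in> S2" "v \<noteq> c" "y u = y v" for u v
        using y2up[OF that(2,1)] fy1[OF that(2)] y2[OF that(2,3)] that by (fastforce simp: y_def)
      show "u = v"
      proof (cases "u \<in> S1"; cases "v \<in> S1")
        assume "u \<in> S1" "v \<in> S1"
        then show ?thesis using uv yinj1 by (auto simp: y_def dest: inj_onD)
      next
        assume "u \<in> S1" "v \<notin> S1" then show ?thesis using mix[of u v] uv cS by blast
      next
        assume "u \<notin> S1" "v \<in> S1" then show ?thesis using mix[of v u] uv cS by force
      next
        assume "u \<notin> S1" "v \<notin> S1"
        then show ?thesis using uv yinj2 strict_mono_eq[OF fy(1)] by (auto simp: y_def dest: inj_onD)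
      qed
    qed
  next
    fix u assume "u \<in> S1 \<union> S2"
    then show "l u \<le> r u" using lr1[of u] lr2[of u] fxl(3)[OF cS(2,2)] lr1[OF cS(1)] cS
      by (auto simp: l_def r_def fxm)
  next
    fix u v assume uv: "u \<in> S1 \<union> S2" "v \<in> S1 \<union> S2" "E u v"
    have "l u \<le> x {u, v} \<and> x {u, v} \<le> r u"
      using edge[OF uv]
    proof (elim disjE conjE)
      assume *: "u \<in> S1" "v \<in> S1" "x {u, v} = x1 {u, v}"
      then show ?thesis using ends1[OF *(1,2) uv(3)] fxl(3)[OF cS(2,2)] by (auto simp: l_def r_def)
    next
      assume *: "u \<in> S2" "v \<in> S2" "x {u, v} = fx (x2 {u, v})"
      then show ?thesis
        using ends2[OF *(1,2) uv(3)] fxl(1)[OF *(1,2)] lr1[OF cS(1)] S2[OF *(1)]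
        by (cases "u = c") (auto simp: l_def r_def fxm cS)
    qed
    then show "l u \<le> x {u, v}" "x {u, v} \<le> r u" by auto
  next
    fix u v u' v' assume uv: "u \<in> S1 \<union> S2" "v \<in> S1 \<union> S2" "u' \<in> S1 \<union> S2" "v' \<in> S1 \<union> S2" "E u v" "E u' v'"
      and eq: "x {u, v} = x {u', v'}"
    have mix: False if "u \<in> S1" "v \<in> S1" "u' \<in> S2" "v' \<in> S2" "x1 {u, v} = fx (x2 {u', v'})" for u v u' v'
      using fxl(1)[OF that(3,4)] fxr(1)[OF that(3,4,1,2)] that(5) by linarith
    show "{u, v} = {u', v'}"
      using edge[OF uv(1,2,5)] edge[OF uv(3,4,6)]
    proof (elim disjE conjE)
      assume "u \<in> S1" "v \<in> S1" "x {u, v} = x1 {u, v}" "u' \<in> S1" "v' \<in> S1" "x {u', v'} = x1 {u', v'}"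
      then show ?thesis using xinj1 uv eq by simp
    next
      assume "u \<in> S2" "v \<in> S2" "x {u, v} = fx (x2 {u, v})" "u' \<in> S2" "v' \<in> S2" "x {u', v'} = fx (x2 {u', v'})"
      then show ?thesis using xinj2 uv eq by (simp add: fxm)
    qed (use mix eq in \<open>metis\<close>)+
  next
    fix u v w assume uv: "u \<in> S1 \<union> S2" "v \<in> S1 \<union> S2" "w \<in> S1 \<union> S2" "E u v" "y u < y w" "y w < y v"
    show "x {u, v} < l w \<or> r w < x {u, v}"
      using edge[OF uv(1,2,4)]
    proof (elim disjE conjE)
      assume e: "u \<in> S1" "v \<in> S1" "x {u, v} = x1 {u, v}"
      show ?thesis
      proof (cases "w \<in> S1")
        case True
        then have "x1 {u, v} < l1 w \<or> r1 w < x1 {u, v}" using pass1[OF e(1,2) uv(4)] uv e by (simp add: y_def)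
        then show ?thesis using True e fxr(3)[OF cS(2,2) e(1,2)] by (auto simp: l_def r_def)
      next
        case False
        then have w: "w \<in> S2" "w \<noteq> c" using uv cS by auto
        have "y1 u \<le> y1 c" using y2up[OF w(1) e(1)] uv(5) e by (fastforce simp: y_def)
        moreover have "y1 c < y1 v" using y2low[OF w(1)] uv(6) e by (simp add: y_def)
        ultimately consider "u = c" | "y1 u < y1 c" "y1 c < y1 v"
          using yinj1 e(1) cS by (metis inj_onD order_le_less)
        \<comment> \<open>A segment of the first representation is either at most at
          \<open>r1 c\<close>, hence left of the box, or beyond \<open>r1 c\<close>, and the box was
          squeezed in front of all such segments.\<close>
        then have "x1 {u, v} \<le> r1 c \<or> r1 c < x1 {u, v}" by linarith
        then show ?thesis
        proof
          assume "x1 {u, v} \<le> r1 c"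
          then show ?thesis using e fxl(2)[OF w(1,1)] False by (simp add: l_def)
        next
          assume "r1 c < x1 {u, v}"
          then show ?thesis using e fxr(3)[OF w(1,1) e(1,2)] False w by (simp add: r_def)
        qed
      qed
    next
      assume e: "u \<in> S2" "v \<in> S2" "x {u, v} = fx (x2 {u, v})"
      show ?thesis
      proof (cases "w \<in> S1")
        case True
        then have "y1 c < y1 w" using y2low[OF e(1)] uv(5) by (simp add: y_def)
        then show ?thesis using y2up[OF e(2) True] uv(6) True by (simp add: y_def)
      next
        case False
        then have w: "w \<in> S2" "w \<noteq> c" using uv cS by auto
        have "v \<noteq> c" using y2low[OF w(1)] uv(6) cS by (auto simp: y_def)
        then have "y2 w < y2 v" using uv(6) y2 w e strict_mono_less[OF fy(1)] by simp
        moreover have "y2 u < y2 w"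
        proof (cases "u = c")
          case True
          then show ?thesis using low[OF w(1)] yinj2 w cS by (metis inj_onD order_le_less)
        next
          case False
          then show ?thesis using uv(5) y2 w e strict_mono_less[OF fy(1)] by simp
        qed
        ultimately show ?thesis using pass2[OF e(1,2) uv(4) w(1)] False w e by (simp add: l_def r_def fxm)
      qed
    qed
  qed
  moreover have "y v = y1 v" if "v \<in> S1" for v using that by (simp add: y_def)
  moreover have "y1 c < y v" if "v \<in> S2 - {c}" for v using that y2 fy1 by auto
  ultimately show ?thesis using that by blast
qed

lemma bar_rep_insert_isolated:
  assumes "finite S" "s \<notin> S" and iso: "\<And>v. v \<in> insert s S \<Longrightarrow> \<not> E s v \<and> \<not> E v s" and R: "bar_rep S E y x l r"
  obtains y' where "bar_rep (insert s S) E y' x (l(s := 0)) (r(s := 0))" "\<And>v. v \<in> S \<Longrightarrow> y' s < y' v"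
proof -
  obtain M where M: "\<forall>z\<in>y ` S. norm z < M" using assms(1) finite_imp_bounded bounded_pos_less finite_imageI by metis
  define y' where "y' = y(s := - M)"
  have less: "y' s < y' v" if "v \<in> S" for v using M that assms(2) by (auto simp: y'_def abs_less_iff)
  have same: "y' v = y v" if "v \<in> S" for v using that assms(2) by (auto simp: y'_def)
  have A: "inj_on y' (insert s S)"
  proof -
    have "inj_on y' S" using R same unfolding bar_rep_def by (simp cong: inj_on_cong)
    then show ?thesis using less assms(2) by (fastforce simp: inj_on_insert)
  qed
  have P: "x {u, v} < (l(s := 0)) w \<or> (r(s := 0)) w < x {u, v}"
    if "u \<in> insert s S" "v \<in> insert s S" "w \<in> insert s S" "E u v" "y' u < y' w" "y' w < y' v" for u v w
  proof -
    have "u \<in> S" "v \<in> S" using iso that by auto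
    moreover have "w \<noteq> s" using less[OF \<open>u \<in> S\<close>] that by auto
    ultimately show ?thesis using R that same unfolding bar_rep_def by auto
  qed
  have C: "(l(s := 0)) u \<le> x {u, v}" "x {u, v} \<le> (r(s := 0)) u"
    if "u \<in> insert s S" "v \<in> insert s S" "E u v" for u v
    using R that iso unfolding bar_rep_def by auto
  have D: "{u, v} = {u', v'}" if "u \<in> insert s S" "v \<in> insert s S" "u' \<in> insert s S" "v' \<in> insert s S"
    "E u v" "E u' v'" "x {u, v} = x {u', v'}" for u v u' v'
  proof -
    have "u \<in> S" "v \<in> S" "u' \<in> S" "v' \<in> S" using iso that by auto
    then show ?thesis using R that unfolding bar_rep_def by simp
  qed
  have B: "(l(s := 0)) u \<le> (r(s := 0)) u" if "u \<in> insert s S" for u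
    using R that unfolding bar_rep_def by auto
  have "bar_rep (insert s S) E y' x (l(s := 0)) (r(s := 0))" unfolding bar_rep_def
    by (intro conjI ballI impI; (rule A B C D P; assumption)?)
  then show ?thesis using that less by blast
qed

section \<open>st-orders\<close>

text \<open>Connectedness by cuts instead of paths: its use supplies an edge leaving a given set,
  and its failure supplies a separated vertex set, which is what the gluing needs. The empty set and
  singletons count as connected.\<close>

definition connected_on :: "('a \<Rightarrow> 'a \<Rightarrow> bool) \<Rightarrow> 'a set \<Rightarrow> bool" where
  "connected_on E S \<longleftrightarrow> (\<forall>X. X \<subseteq> S \<longrightarrow> X \<noteq> {} \<longrightarrow> X \<noteq> S \<longrightarrow> (\<exists>a\<in>X. \<exists>b\<in>S - X. E a b))"

text \<open>An st-numbering: \<open>s\<close> is the only possible local minimum and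
  \<open>t\<close> the only possible local maximum. The values are real so that new vertices fit
  between any two old ones.\<close>

definition st_order :: "('a \<Rightarrow> 'a \<Rightarrow> bool) \<Rightarrow> 'a set \<Rightarrow> 'a \<Rightarrow> 'a \<Rightarrow> ('a \<Rightarrow> real) \<Rightarrow> bool" where
  "st_order E S s t y \<longleftrightarrow> s \<in> S \<and> t \<in> S \<and> inj_on y S \<and>
    (\<forall>v\<in>S - {s}. \<exists>u\<in>S. E u v \<and> y u < y v) \<and> (\<forall>v\<in>S - {t}. \<exists>u\<in>S. E v u \<and> y v < y u)"

text \<open>Leave \<open>H\<close> by an edge from \<open>a\<close> to \<open>v\<close> and let
  \<open>X\<close> be everything reachable from \<open>v\<close> by paths outside \<open>H\<close>.
  Since \<open>S - {a}\<close> is still connected, some edge leaves \<open>X\<close> without going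
  to \<open>a\<close>, and it can only end in \<open>H\<close>, because otherwise the path could be
  continued.\<close>

lemma exists_ear:
  assumes con: "connected_on E S" and con2: "\<And>c. c \<in> S \<Longrightarrow> connected_on E (S - {c})"
    and H: "H \<subseteq> S" "H \<noteq> S" "s \<in> H" "t \<in> H" "s \<noteq> t"
  obtains a b xs where "a \<in> H" "b \<in> H" "a \<noteq> b" "xs \<noteq> []" "distinct xs" "set xs \<subseteq> S - H"
    "successively E xs" "E a (hd xs)" "E (last xs) b"
proof -
  obtain a v where a: "a \<in> H" "v \<in> S - H" "E a v"
    using con H unfolding connected_on_def by (metis empty_iff)
  define X where "X = {last xs | xs. xs \<noteq> [] \<and> hd xs = v \<and> distinct xs \<and> set xs \<subseteq> S - H \<and> successively E xs}"
  have "v \<in> X" unfolding X_def using a by (intro CollectI exI[of _ "[v]"]) auto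
  have XS: "X \<subseteq> S - H" unfolding X_def by (auto dest: last_in_set)
  then have "X \<subseteq> S - {a}" "X \<noteq> {}" using a \<open>v \<in> X\<close> by auto
  moreover have "X \<noteq> S - {a}" using XS H by blast
  moreover have "connected_on E (S - {a})" using con2 a H by blast
  ultimately obtain p q where pq: "p \<in> X" "q \<in> S - {a} - X" "E p q"
    unfolding connected_on_def by blast
  obtain xs where xs: "xs \<noteq> []" "hd xs = v" "distinct xs" "set xs \<subseteq> S - H" "successively E xs" "last xs = p"
    using pq(1) unfolding X_def by blast
  have "q \<in> H"
  proof (rule ccontr)
    assume "q \<notin> H"
    show False
    proof (cases "q \<in> set xs")
      case True
      then obtain ys zs where ys: "xs = ys @ q # zs" by (meson split_list)
      have "q = last (ys @ [q])" "hd (ys @ [q]) = v" "distinct (ys @ [q])" "set (ys @ [q]) \<subseteq> S - H" "successively E (ys @ [q])"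
        using xs unfolding ys by (auto simp: successively_append_iff hd_append)
      then have "q \<in> X" unfolding X_def by blast
      then show False using pq by blast
    next
      case False
      have "q = last (xs @ [q])" "hd (xs @ [q]) = v" "distinct (xs @ [q])" "set (xs @ [q]) \<subseteq> S - H" "successively E (xs @ [q])"
        using xs False pq \<open>q \<notin> H\<close> by (auto simp: successively_append_iff)
      then have "q \<in> X" unfolding X_def by blast
      then show False using pq by blast
    qed
  qed
  then show ?thesis using that[of a q xs] a xs pq by auto
qed

text \<open>The inner vertices of the ear receive increasing values directly above
  \<open>y a\<close>, all of them below \<open>y b\<close>. Thus each has its predecessor on the ear
  below and its successor above, and the old vertices keep their witnesses.\<close>

lemma st_order_add_ear:
  assumes "finite H" and st: "st_order E H s t y"
    and ear: "a \<in> H" "b \<in> H" "y a < y b" "xs \<noteq> []" "distinct xs" "set xs \<inter> H = {}"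
    "successively E xs" "E a (hd xs)" "E (last xs) b"
  obtains y' where "st_order E (H \<union> set xs) s t y'"
proof -
  obtain f :: "real \<Rightarrow> real" where f: "strict_mono f" "\<And>z. z \<in> real ` {..<length xs} \<Longrightarrow> y a < f z"
    "\<And>z p. z \<in> real ` {..<length xs} \<Longrightarrow> p \<in> y ` H \<Longrightarrow> y a < p \<Longrightarrow> f z < p"
    using squeeze_below[of "real ` {..<length xs}" "y ` H" "y a"] \<open>finite H\<close> by blast
  define g where "g = inv_into {..<length xs} ((!) xs)"
  have inj: "inj_on ((!) xs) {..<length xs}" using ear(5) by (simp add: inj_on_nth)
  have g: "g (xs ! i) = i" if "i < length xs" for i using that inj by (simp add: g_def)
  define y' where "y' v = (if v \<in> H then y v else f (real (g v)))" for v
  have yH: "y' v = y v" if "v \<in> H" for v using that by (simp add: y'_def)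
  have yx: "y' (xs ! i) = f (real i)" if "i < length xs" for i
    using that g ear(6) nth_mem by (fastforce simp: y'_def)
  have fa: "y a < f (real i)" "\<And>w. w \<in> H \<Longrightarrow> y a < y w \<Longrightarrow> f (real i) < y w" if "i < length xs" for i
    using f(2,3) that by auto
  have "inj_on y' (H \<union> set xs)"
  proof (rule inj_onI)
    have mix: False if "u \<in> H" "i < length xs" "y' u = y' (xs ! i)" for u i
      using fa[OF that(2)] that(1,3) yH[OF that(1)] yx[OF that(2)] by (cases "y a < y u") fastforce+
    fix u v assume uv: "u \<in> H \<union> set xs" "v \<in> H \<union> set xs" "y' u = y' v"
    then consider "u \<in> H" "v \<in> H" | i where "u \<in> H" "i < length xs" "v = xs ! i"
      | i where "v \<in> H" "i < length xs" "u = xs ! i"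
      | i j where "i < length xs" "j < length xs" "u = xs ! i" "v = xs ! j"
      by (auto simp: in_set_conv_nth)
    then show "u = v"
    proof cases
      case 1
      then show ?thesis using st uv(3) by (auto simp: st_order_def yH dest: inj_onD)
    next
      case 2 then show ?thesis using mix uv(3) by metis
    next
      case 3 then show ?thesis using mix uv(3) by metis
    next
      case 4
      then show ?thesis using uv(3) yx strict_mono_eq[OF f(1)] by auto
    qed
  qed
  moreover have "\<exists>u\<in>H \<union> set xs. E u v \<and> y' u < y' v" if v: "v \<in> H \<union> set xs - {s}" for v
  proof (cases "v \<in> H")
    case True
    then obtain u where "u \<in> H" "E u v" "y u < y v" using v st unfolding st_order_def by blast
    then show ?thesis using True yH by auto
  next
    case False
    then obtain i where i: "i < length xs" "v = xs ! i" using v by (auto simp: in_set_conv_nth)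
    show ?thesis
    proof (cases i)
      case 0
      then have "E a v \<and> y' a < y' v" using ear i yH yx fa(1)[OF i(1)] by (simp add: hd_conv_nth)
      then show ?thesis using ear(1) by blast
    next
      case (Suc j)
      then have "E (xs ! j) v" using ear(7) i by (simp add: successively_conv_nth)
      moreover have "y' (xs ! j) < y' v" using i Suc yx strict_mono_less[OF f(1)] by simp
      ultimately show ?thesis using i Suc by (intro bexI[of _ "xs ! j"]) auto
    qed
  qed
  moreover have "\<exists>u\<in>H \<union> set xs. E v u \<and> y' v < y' u" if v: "v \<in> H \<union> set xs - {t}" for v
  proof (cases "v \<in> H")
    case True
    then obtain u where "u \<in> H" "E v u" "y v < y u" using v st unfolding st_order_def by blast
    then show ?thesis using True yH by auto
  next
    case False
    then obtain i where i: "i < length xs" "v = xs ! i" using v by (auto simp: in_set_conv_nth)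
    show ?thesis
    proof (cases "Suc i < length xs")
      case False
      then have "i = length xs - 1" using i by linarith
      then have "v = last xs" using i ear(4) by (simp add: last_conv_nth)
      then have "E v b" using ear(9) by simp
      moreover have "y' v < y' b" using fa(2)[OF i(1) ear(2,3)] yx[OF i(1)] yH[OF ear(2)] i(2) by simp
      ultimately show ?thesis using ear(2) by blast
    next
      case True
      then have "E v (xs ! Suc i)" using ear(7) i by (simp add: successively_conv_nth)
      moreover have "y' v < y' (xs ! Suc i)" using i True yx strict_mono_less[OF f(1)] by simp
      ultimately show ?thesis using True by (intro bexI[of _ "xs ! Suc i"]) auto
    qed
  qed
  moreover have "s \<in> H \<union> set xs" "t \<in> H \<union> set xs" using st by (auto simp: st_order_def)
  ultimately have "st_order E (H \<union> set xs) s t y'" unfolding st_order_def by blast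
  then show ?thesis by (rule that)
qed

text \<open>A largest vertex set with an st-order, found among the supersets of the case of the
  single edge from \<open>s\<close> to \<open>t\<close> in size, must be everything: otherwise it
  has an ear, which is read from its lower to its upper end and added.\<close>

lemma st_order_exists:
  assumes sym: "\<And>u v. E u v \<Longrightarrow> E v u" and fin: "finite S"
    and con: "connected_on E S" and con2: "\<And>c. c \<in> S \<Longrightarrow> connected_on E (S - {c})"
    and st: "s \<in> S" "t \<in> S" "s \<noteq> t" "E s t"
  obtains y where "st_order E S s t y"
proof -
  define P where "P H \<longleftrightarrow> H \<subseteq> S \<and> (\<exists>y. st_order E H s t y)" for H
  have "st_order E {s, t} s t (\<lambda>v. if v = s then 0 else 1)"
    using st sym by (auto simp: st_order_def inj_on_def)
  then have "P {s, t}" unfolding P_def using st by blast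
  moreover have "\<forall>H. P H \<longrightarrow> card H < Suc (card S)" by (simp add: P_def card_mono fin less_Suc_eq_le)
  ultimately have "\<exists>H. P H \<and> (\<forall>H'. P H' \<longrightarrow> card H' \<le> card H)"
    by (rule ex_has_greatest_nat)
  then obtain H where H: "P H" "\<forall>H'. P H' \<longrightarrow> card H' \<le> card H" by (elim exE conjE)
  then obtain y where y: "st_order E H s t y" and HS: "H \<subseteq> S" by (auto simp: P_def)
  have finH: "finite H" using HS fin finite_subset by blast
  have "H = S"
  proof (rule ccontr)
    assume "H \<noteq> S"
    have "s \<in> H" "t \<in> H" using y by (auto simp: st_order_def)
    then obtain a b xs where e: "a \<in> H" "b \<in> H" "a \<noteq> b" "xs \<noteq> []" "distinct xs" "set xs \<subseteq> S - H"
      "successively E xs" "E a (hd xs)" "E (last xs) b"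
      using exists_ear[OF con con2 HS \<open>H \<noteq> S\<close> _ _ st(3)] by metis
    have dis: "set xs \<inter> H = {}" using e(6) by blast
    have "y a \<noteq> y b" using y e(1-3) unfolding st_order_def by (meson inj_onD)
    then consider "y a < y b" | "y b < y a" by linarith
    then have "\<exists>y'. st_order E (H \<union> set xs) s t y'"
    proof cases
      case 1
      show ?thesis by (rule st_order_add_ear[OF finH y e(1,2) 1 e(4,5) dis e(7,8,9)]) blast+
    next
      case 2
      have r: "rev xs \<noteq> []" "distinct (rev xs)" "set (rev xs) \<inter> H = {}" "successively E (rev xs)"
        "E b (hd (rev xs))" "E (last (rev xs)) a"
        using e dis sym by (auto simp: hd_rev last_rev elim: successively_mono)
      show ?thesis using st_order_add_ear[OF finH y e(2,1) 2 r] by (metis set_rev)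
    qed
    then have "P (H \<union> set xs)" using HS e(6) by (auto simp: P_def)
    then have "card (H \<union> set xs) \<le> card H" using H by blast
    moreover have "H \<subset> H \<union> set xs" using dis e(4) by (cases xs) auto
    ultimately show False using finH by (meson List.finite_set finite_UnI leD psubset_card_mono)
  qed
  then show ?thesis using y that by blast
qed

section \<open>Bar representations from compatible level orders\<close>

text \<open>The vertices are swept upwards. An edge passing \<open>v\<close> lies on one side of all
  edges entering \<open>v\<close>, so the edges leaving \<open>v\<close> can be placed next to the
  rightmost entering one and end up on the same side of every passing edge. Positions assigned
  earlier never change.\<close>

lemma level_orders_realizable:
  fixes y :: "'a \<Rightarrow> real" and D :: "('a \<times> 'a) set" and lt :: "'a \<times> 'a \<Rightarrow> 'a \<times> 'a \<Rightarrow> bool"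
  defines "cross \<equiv> \<lambda>h. {e \<in> D. y (fst e) \<le> h \<and> h < y (snd e)}"
  assumes fin: "finite S" and yinj: "inj_on y S"
    and D: "\<And>e. e \<in> D \<Longrightarrow> fst e \<in> S \<and> snd e \<in> S \<and> y (fst e) < y (snd e)"
    and irr: "\<And>e. \<not> lt e e"
    and tr: "\<And>h a b c. a \<in> cross h \<Longrightarrow> b \<in> cross h \<Longrightarrow> c \<in> cross h \<Longrightarrow> lt a b \<Longrightarrow> lt b c \<Longrightarrow> lt a c"
    and tot: "\<And>h a b. a \<in> cross h \<Longrightarrow> b \<in> cross h \<Longrightarrow> a \<noteq> b \<Longrightarrow> lt a b \<or> lt b a"
    and side: "\<And>v c. v \<in> S \<Longrightarrow> c \<in> D \<Longrightarrow> y (fst c) < y v \<Longrightarrow> y v < y (snd c) \<Longrightarrow>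
      (\<forall>a\<in>D. fst a = v \<or> snd a = v \<longrightarrow> lt c a) \<or> (\<forall>a\<in>D. fst a = v \<or> snd a = v \<longrightarrow> lt a c)"
    and inc: "\<And>v w. v \<in> S \<Longrightarrow> w \<in> S \<Longrightarrow> y w < y v \<Longrightarrow> \<exists>u. (u, v) \<in> D"
  obtains x :: "'a \<times> 'a \<Rightarrow> real" where "inj_on x D"
    "\<And>v c. v \<in> S \<Longrightarrow> c \<in> D \<Longrightarrow> y (fst c) < y v \<Longrightarrow> y v < y (snd c) \<Longrightarrow>
      (\<forall>a\<in>D. fst a = v \<or> snd a = v \<longrightarrow> x c < x a) \<or> (\<forall>a\<in>D. fst a = v \<or> snd a = v \<longrightarrow> x a < x c)"
proof -
  have finD: "finite D" using D fin by (intro finite_subset[of D "S \<times> S"]) (auto simp: mem_Times_iff)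
  have asym: "\<not> lt b a" if "a \<in> cross h" "b \<in> cross h" "lt a b" for a b h
    using tr[OF that(1,2,1) that(3)] irr by blast
  \<comment> \<open>The last clause carries the sweep: the edges that leave the processed set
    \<open>L\<close> are positioned as \<open>lt\<close> prescribes. For edges that already ended in
    \<open>L\<close> nothing about \<open>lt\<close> has to be remembered.\<close>
  define good where "good L x \<longleftrightarrow> inj_on x {e \<in> D. fst e \<in> L} \<and>
      (\<forall>v\<in>L. \<forall>c\<in>D. y (fst c) < y v \<longrightarrow> y v < y (snd c) \<longrightarrow>
        (\<forall>a\<in>D. fst a = v \<or> snd a = v \<longrightarrow> x c < x a) \<or> (\<forall>a\<in>D. fst a = v \<or> snd a = v \<longrightarrow> x a < x c)) \<and>
      (\<forall>a\<in>D. \<forall>b\<in>D. fst a \<in> L \<longrightarrow> snd a \<notin> L \<longrightarrow> fst b \<in> L \<longrightarrow> snd b \<notin> L \<longrightarrow> lt a b \<longrightarrow> x a < x b)"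
    for L and x :: "'a \<times> 'a \<Rightarrow> real"
  have step: "\<exists>x'. good (insert v L) x'"
    if vS: "v \<in> S" "v \<notin> L" and LS: "L \<subseteq> S" and max: "\<And>w. w \<in> L \<Longrightarrow> y w < y v"
      and down: "\<And>u w. w \<in> insert v L \<Longrightarrow> u \<in> S \<Longrightarrow> y u < y w \<Longrightarrow> u \<in> insert v L"
      and x: "good L x" for v L x
  proof -
    define I where "I = {a \<in> D. snd a = v}"
    define Out where "Out = {a \<in> D. fst a = v}"
    have finI: "finite I" and finOut: "finite Out" using finD by (auto simp: I_def Out_def)
    have Lv: "w \<in> L \<longleftrightarrow> y w < y v" if "w \<in> S" for w using down[of v w] max that by auto
    \<comment> \<open>The new edges are placed immediately to the right of the rightmost edge ending in \<open>v\<close>.\<close>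
    define M where "M = (if I = {} then 0 else Max (x ` I))"
    have MI: "x a \<le> M" if "a \<in> I" for a using that finI by (auto simp: M_def)
    have Mmem: "M \<in> x ` I" if "I \<noteq> {}"
      using finI that unfolding M_def by (metis Max_in finite_imageI image_is_empty)
    \<comment> \<open>All edges leaving \<open>v\<close> cross the level \<open>y v\<close>, where
      \<open>lt\<close> is a linear order; counting predecessors turns it into numbers.\<close>
    define rank where "rank a = real (card {b \<in> Out. lt b a})" for a
    have Out_cross: "Out \<subseteq> cross (y v)" using D by (auto simp: Out_def cross_def)
    have rank: "rank a < rank b" if "a \<in> Out" "b \<in> Out" "lt a b" for a b
    proof -
      have "{c \<in> Out. lt c a} \<subset> {c \<in> Out. lt c b}"
        using that Out_cross tr[of _ "y v" a b] irr by blast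
      then show ?thesis unfolding rank_def using finOut by (simp add: psubset_card_mono)
    qed
    obtain f :: "real \<Rightarrow> real" where f: "strict_mono f" "\<And>z. z \<in> rank ` Out \<Longrightarrow> M < f z"
      "\<And>z b. z \<in> rank ` Out \<Longrightarrow> b \<in> x ` D \<Longrightarrow> M < b \<Longrightarrow> f z < b"
      using squeeze_below[of "rank ` Out" "x ` D" M] finOut finD by blast
    define x' where "x' e = (if fst e = v then f (rank e) else x e)" for e
    have old: "x' e = x e" if "fst e \<noteq> v" for e using that by (simp add: x'_def)
    have new: "M < x' e" "\<And>c. c \<in> D \<Longrightarrow> M < x c \<Longrightarrow> x' e < x c" if "e \<in> Out" for e
      using f(2,3) that by (auto simp: x'_def Out_def)
    have newless: "x' a < x' b" if "a \<in> Out" "b \<in> Out" "lt a b" for a b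
      using rank[OF that] that strict_mono_less[OF f(1)] by (simp add: x'_def Out_def)
    have fstI: "fst a \<noteq> v \<and> fst a \<in> L \<and> snd a \<notin> L" if "a \<in> I" for a
      using D[of a] that Lv[of "fst a"] vS by (auto simp: I_def)
    have passer: "fst c \<in> L \<and> snd c \<notin> L \<and> snd c \<noteq> v \<and> fst c \<noteq> v" if "c \<in> D" "y (fst c) < y v" "y v < y (snd c)" for c
      using D[OF that(1)] that Lv[of "fst c"] Lv[of "snd c"] by auto
    have Ine: "I \<noteq> {}" if "c \<in> D" "y (fst c) < y v" for c
      using inc[OF vS(1), of "fst c"] D[OF that(1)] that by (auto simp: I_def)
    have cmp1: "x c < x' a" if c: "c \<in> D" "y (fst c) < y v" "y v < y (snd c)"
      and lt: "\<forall>a\<in>D. fst a = v \<or> snd a = v \<longrightarrow> lt c a" and a: "a \<in> D" "fst a = v \<or> snd a = v" for c a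
    proof -
      have ltI: "x c < x i" if "i \<in> I" for i
        using x passer[OF c] fstI[OF that] lt that c(1) unfolding good_def I_def by blast
      then have "x c < M" using Mmem[OF Ine[OF c(1,2)]] by auto
      then show ?thesis using a new(1)[of a] ltI[of a] fstI[of a] old[of a]
        by (cases "fst a = v") (auto simp: Out_def I_def)
    qed
    have cmp2: "x' a < x c" if c: "c \<in> D" "y (fst c) < y v" "y v < y (snd c)"
      and lt: "\<forall>a\<in>D. fst a = v \<or> snd a = v \<longrightarrow> lt a c" and a: "a \<in> D" "fst a = v \<or> snd a = v" for c a
    proof -
      have ltI: "x i < x c" if "i \<in> I" for i
        using x passer[OF c] fstI[OF that] lt that c(1) unfolding good_def I_def by blast
      then have "M < x c" using Mmem[OF Ine[OF c(1,2)]] by auto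
      then show ?thesis using a new(2)[of a c] ltI[of a] fstI[of a] old[of a] c
        by (cases "fst a = v") (auto simp: Out_def I_def)
    qed
    have "good (insert v L) x'" unfolding good_def
    proof (intro conjI ballI impI)
      show "inj_on x' {e \<in> D. fst e \<in> insert v L}"
      proof (rule inj_onI)
        have mix: False if "a \<in> Out" "b \<in> D" "fst b \<noteq> v" "fst b \<in> L" "x' a = x' b" for a b
        proof -
          have "I \<noteq> {}" using Ine[of b] that max by auto
          then show False using new[OF that(1)] old[OF that(3)] that(2,5) by (metis linorder_neqE_linordered_idom order_less_irrefl that(1))
        qed
        fix a b assume ab: "a \<in> {e \<in> D. fst e \<in> insert v L}" "b \<in> {e \<in> D. fst e \<in> insert v L}" "x' a = x' b"
        consider "a \<in> Out" "b \<in> Out" | "a \<in> Out" "b \<notin> Out" | "a \<notin> Out" "b \<in> Out" | "a \<notin> Out" "b \<notin> Out" by blast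
        then show "a = b"
        proof cases
          case 1
          then show ?thesis using tot[of a "y v" b] Out_cross newless[of a b] newless[of b a] ab(3) by fastforce
        next
          case 2
          then show ?thesis using mix[of a b] ab by (auto simp: Out_def)
        next
          case 3
          then show ?thesis using mix[of b a] ab by (auto simp: Out_def)
        next
          case 4
          then have "fst a \<noteq> v" "fst b \<noteq> v" using ab by (auto simp: Out_def)
          then show ?thesis using x ab old unfolding good_def by (auto dest: inj_onD)
        qed
      qed
    next
      fix w c assume w: "w \<in> insert v L" and c: "c \<in> D" "y (fst c) < y w" "y w < y (snd c)"
      show "(\<forall>a\<in>D. fst a = w \<or> snd a = w \<longrightarrow> x' c < x' a) \<or> (\<forall>a\<in>D. fst a = w \<or> snd a = w \<longrightarrow> x' a < x' c)"
      proof (cases "w = v")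
        case True
        then have "x' c = x c" using passer c old by blast
        then show ?thesis using side[OF vS(1) c[unfolded True]] cmp1[OF c[unfolded True]] cmp2[OF c[unfolded True]] True by metis
      next
        case False
        then have wL: "w \<in> L" using w by blast
        have nv: "fst a \<noteq> v" if "a \<in> D" "y (fst a) \<le> y w" for a using that max[OF wL] by auto
        have "y (fst a) \<le> y w" if "a \<in> D" "fst a = w \<or> snd a = w" for a using D[OF that(1)] that(2) by auto
        then have "x' a = x a" if "a \<in> D" "fst a = w \<or> snd a = w" for a using that nv old by blast
        moreover have "x' c = x c" using nv[OF c(1)] c(2) old by simp
        moreover have "(\<forall>a\<in>D. fst a = w \<or> snd a = w \<longrightarrow> x c < x a) \<or> (\<forall>a\<in>D. fst a = w \<or> snd a = w \<longrightarrow> x a < x c)"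
          using x wL c unfolding good_def by blast
        ultimately show ?thesis by auto
      qed
    next
      fix a b assume ab: "a \<in> D" "b \<in> D" "fst a \<in> insert v L" "snd a \<notin> insert v L"
        "fst b \<in> insert v L" "snd b \<notin> insert v L" "lt a b"
      have up: "y v < y (snd e)" if "e \<in> D" "snd e \<notin> insert v L" for e
      proof -
        have "y (snd e) \<noteq> y v" using D[OF that(1)] that(2) vS yinj by (auto dest: inj_onD)
        moreover have "\<not> y (snd e) < y v" using Lv[of "snd e"] D[OF that(1)] that(2) by auto
        ultimately show ?thesis by linarith
      qed
      \<comment> \<open>The edges that are open after \<open>v\<close> has been processed all cross
        the level \<open>y v\<close>, so \<open>lt\<close> is asymmetric on them.\<close>
      have cr: "e \<in> cross (y v)" if "e \<in> D" "fst e \<in> insert v L" "snd e \<notin> insert v L" for e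
        using that(1,2) up[OF that(1,3)] max[of "fst e"] by (auto simp: cross_def)
      consider "a \<in> Out" "b \<in> Out" | "a \<in> Out" "fst b \<noteq> v" | "fst a \<noteq> v" "b \<in> Out" | "fst a \<noteq> v" "fst b \<noteq> v"
        using ab by (auto simp: Out_def)
      then show "x' a < x' b"
      proof cases
        case 1
        then show ?thesis using newless ab by blast
      next
        case 2
        have b: "y (fst b) < y v" "y v < y (snd b)" using ab 2 max up by auto
        have "\<not> lt b a" using asym cr ab by blast
        then have "\<forall>a\<in>D. fst a = v \<or> snd a = v \<longrightarrow> lt a b" using side[OF vS(1) ab(2) b] 2 by (auto simp: Out_def)
        then show ?thesis using cmp2[OF ab(2) b] 2 old[of b] by (auto simp: Out_def)
      next
        case 3
        have a: "y (fst a) < y v" "y v < y (snd a)" using ab 3 max up by auto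
        have "\<not> lt b a" using asym cr ab by blast
        then have "\<forall>b\<in>D. fst b = v \<or> snd b = v \<longrightarrow> lt a b" using side[OF vS(1) ab(1) a] 3 by (auto simp: Out_def)
        then show ?thesis using cmp1[OF ab(1) a] 3 old[of a] by (auto simp: Out_def)
      next
        case 4
        then show ?thesis using x ab old unfolding good_def by simp
      qed
    qed
    then show ?thesis by blast
  qed
  have "L \<subseteq> S \<Longrightarrow> (\<And>u w. w \<in> L \<Longrightarrow> u \<in> S \<Longrightarrow> y u < y w \<Longrightarrow> u \<in> L) \<Longrightarrow> \<exists>x. good L x" if "finite L" for L
    using that
  proof (induction L rule: finite_ranking_induct[where f=y])
    case empty
    show ?case unfolding good_def by auto
  next
    case (insert v L)
    show ?case
    proof (cases "v \<in> L")
      case True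
      then show ?thesis using insert by (simp add: insert_absorb)
    next
      case False
      have less: "y w < y v" if "w \<in> L" for w
      proof -
        have "y w \<noteq> y v" using yinj insert.prems(1) that False by (auto dest: inj_onD)
        then show ?thesis using insert.hyps(2)[OF that] by simp
      qed
      have "u \<in> L" if "w \<in> L" "u \<in> S" "y u < y w" for u w
        using insert.prems(2)[of w u] that less[OF that(1)] by auto
      then obtain x where x: "good L x" using insert.IH insert.prems(1) by blast
      show ?thesis
        by (rule step[OF _ False _ less _ x]) (use insert.prems in auto)
    qed
  qed
  from this[OF fin] obtain x where "good S x" by blast
  moreover have "{e \<in> D. fst e \<in> S} = D" using D by auto
  ultimately show ?thesis using that[of x] unfolding good_def by auto
qed

text \<open>The bar of a vertex spans the positions of its incident edges. A passing segment lies on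
  one side of all of these, hence misses the bar; \<open>s \<noteq> t\<close> guarantees that every
  vertex has an incident edge.\<close>

lemma bar_rep_of_level_orders:
  fixes S :: "'a set" and E :: "'a \<Rightarrow> 'a \<Rightarrow> bool" and y :: "'a \<Rightarrow> real" and lt :: "'a \<times> 'a \<Rightarrow> 'a \<times> 'a \<Rightarrow> bool"
  defines "D \<equiv> {(u, v). u \<in> S \<and> v \<in> S \<and> E u v \<and> y u < y v}"
  defines "cross \<equiv> \<lambda>h. {e \<in> D. y (fst e) \<le> h \<and> h < y (snd e)}"
  assumes sym: "\<And>u v. E u v \<Longrightarrow> E v u" and irrE: "\<And>u. \<not> E u u"
    and fin: "finite S" and st: "st_order E S s t y" and "s \<noteq> t"
    and irr: "\<And>e. \<not> lt e e"
    and tr: "\<And>h a b c. a \<in> cross h \<Longrightarrow> b \<in> cross h \<Longrightarrow> c \<in> cross h \<Longrightarrow> lt a b \<Longrightarrow> lt b c \<Longrightarrow> lt a c"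
    and tot: "\<And>h a b. a \<in> cross h \<Longrightarrow> b \<in> cross h \<Longrightarrow> a \<noteq> b \<Longrightarrow> lt a b \<or> lt b a"
    and side: "\<And>v c. v \<in> S \<Longrightarrow> c \<in> D \<Longrightarrow> y (fst c) < y v \<Longrightarrow> y v < y (snd c) \<Longrightarrow>
      (\<forall>a\<in>D. fst a = v \<or> snd a = v \<longrightarrow> lt c a) \<or> (\<forall>a\<in>D. fst a = v \<or> snd a = v \<longrightarrow> lt a c)"
  obtains x l r where "bar_rep S E y x l r"
proof -
  have yinj: "inj_on y S" and sS: "s \<in> S"
    and lower: "\<And>v. v \<in> S \<Longrightarrow> v \<noteq> s \<Longrightarrow> \<exists>u\<in>S. E u v \<and> y u < y v"
    and upper: "\<And>v. v \<in> S \<Longrightarrow> v \<noteq> t \<Longrightarrow> \<exists>u\<in>S. E v u \<and> y v < y u"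
    using st unfolding st_order_def by blast+
  have smin: "y s \<le> y v" if "v \<in> S" for v
  proof -
    obtain w where w: "w \<in> S" "\<And>u. u \<in> S \<Longrightarrow> y w \<le> y u"
      using arg_min_if_finite(1)[of S y] arg_min_least[of S _ y] fin sS by blast
    then have "w = s" using lower[of w] by fastforce
    then show ?thesis using w that by blast
  qed
  have D: "fst e \<in> S \<and> snd e \<in> S \<and> y (fst e) < y (snd e)" if "e \<in> D" for e
    using that by (auto simp: D_def)
  have inc: "\<exists>u. (u, v) \<in> D" if "v \<in> S" "w \<in> S" "y w < y v" for v w
  proof -
    have "v \<noteq> s" using smin[OF that(2)] that(3) by auto
    then show ?thesis using lower[OF that(1)] that(1) by (auto simp: D_def)
  qed
  obtain x :: "'a \<times> 'a \<Rightarrow> real" where xinj: "inj_on x D"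
    and x: "\<And>v c. v \<in> S \<Longrightarrow> c \<in> D \<Longrightarrow> y (fst c) < y v \<Longrightarrow> y v < y (snd c) \<Longrightarrow>
      (\<forall>a\<in>D. fst a = v \<or> snd a = v \<longrightarrow> x c < x a) \<or> (\<forall>a\<in>D. fst a = v \<or> snd a = v \<longrightarrow> x a < x c)"
    by (rule level_orders_realizable[OF fin yinj D irr tr[unfolded cross_def] tot[unfolded cross_def] side inc]) blast+
  \<comment> \<open>Recovers the upward orientation from the unordered pair by which
    \<open>bar_rep\<close> addresses an edge.\<close>
  define o' where "o' e = (SOME p. p \<in> D \<and> {fst p, snd p} = e)" for e
  have o': "o' {u, v} = (if y u < y v then (u, v) else (v, u)) \<and> o' {u, v} \<in> D"
    if "u \<in> S" "v \<in> S" "E u v" for u v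
  proof -
    have "y u \<noteq> y v" using that irrE yinj by (auto dest: inj_onD)
    define q where "q = (if y u < y v then (u, v) else (v, u))"
    have q: "q \<in> D" "{fst q, snd q} = {u, v}" using that sym \<open>y u \<noteq> y v\<close> by (auto simp: q_def D_def)
    then have "\<exists>p. p \<in> D \<and> {fst p, snd p} = {u, v}" by blast
    then have p: "o' {u, v} \<in> D \<and> {fst (o' {u, v}), snd (o' {u, v})} = {u, v}"
      unfolding o'_def by (rule someI_ex)
    have "a = b" if "a \<in> D" "b \<in> D" "{fst a, snd a} = {fst b, snd b}" for a b
      using that by (auto simp: D_def doubleton_eq_iff)
    then have "o' {u, v} \<in> D" "o' {u, v} = q" using p q by simp_all
    then show ?thesis by (simp add: q_def)
  qed
  define I where "I v = {a \<in> D. fst a = v \<or> snd a = v}" for v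
  have finD: "finite D" using D fin by (intro finite_subset[of D "S \<times> S"]) (auto simp: mem_Times_iff)
  have finI: "finite (I v)" for v using finD by (simp add: I_def)
  have Ine: "I v \<noteq> {}" if v: "v \<in> S" for v
  proof (cases "v = s")
    case False
    then show ?thesis using lower[OF v] v by (force simp: I_def D_def)
  next
    case True
    then show ?thesis using upper[OF v] v \<open>s \<noteq> t\<close> by (force simp: I_def D_def)
  qed
  define l where "l v = Min (x ` I v)" for v
  define r where "r v = Max (x ` I v)" for v
  have lI: "l v \<in> x ` I v" "r v \<in> x ` I v" if "v \<in> S" for v
    using Ine[OF that] finI unfolding l_def r_def by (auto intro!: Min_in Max_in simp del: image_iff)
  have bnd: "l v \<le> x a" "x a \<le> r v" if "a \<in> I v" for a v
    using that finI by (auto simp: l_def r_def)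
  have "bar_rep S E y (x \<circ> o') l r" unfolding bar_rep_def
  proof (intro conjI ballI impI)
    show "inj_on y S" by fact
    show "l u \<le> r u" if "u \<in> S" for u using Ine[OF that] bnd by (meson ex_in_conv order_trans)
    fix u v assume uv: "u \<in> S" "v \<in> S" "E u v"
    have "o' {u, v} \<in> I u" using o'[OF uv] by (auto simp: I_def)
    then show "l u \<le> (x \<circ> o') {u, v}" "(x \<circ> o') {u, v} \<le> r u" using bnd by auto
    {
      fix u' v' assume uv': "u' \<in> S" "v' \<in> S" "E u' v'" and "(x \<circ> o') {u, v} = (x \<circ> o') {u', v'}"
      then have "o' {u, v} = o' {u', v'}" using o'[OF uv] o'[OF uv'] xinj by (auto dest: inj_onD)
      then show "{u, v} = {u', v'}" using o'[OF uv] o'[OF uv'] by (auto split: if_splits)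
    }
    fix w assume w: "w \<in> S" "y u < y w" "y w < y v"
    then have q: "o' {u, v} = (u, v)" "(u, v) \<in> D" using o'[OF uv] by auto
    then have "(\<forall>a\<in>I w. x (u, v) < x a) \<or> (\<forall>a\<in>I w. x a < x (u, v))"
      using x[OF w(1) q(2)] w by (auto simp: I_def)
    then show "(x \<circ> o') {u, v} < l w \<or> r w < (x \<circ> o') {u, v}" using lI[OF w(1)] q by auto
  qed
  then show ?thesis by (rule that)
qed

section \<open>Winding numbers on theta graphs\<close>

lemma winding_number_loop:
  assumes "path P" "path Q" "pathfinish P = pathfinish Q" "z \<notin> path_image P" "z \<notin> path_image Q"
  shows "winding_number (P +++ reversepath Q) z = winding_number P z - winding_number Q z"
  using assms by (simp add: winding_number_join winding_number_reversepath)

text \<open>The winding number of an open path varies with the point, but the difference for two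
  paths with common ends belongs to a loop, and is therefore constant on connected sets that avoid
  the loop. All later comparisons of signs are instances of this.\<close>

lemma winding_diff_connected:
  assumes "path P" "path Q" "pathstart P = pathstart Q" "pathfinish P = pathfinish Q"
    and "connected T" "T \<inter> path_image P = {}" "T \<inter> path_image Q = {}" "w \<in> T" "z \<in> T"
  shows "winding_number P w - winding_number Q w = winding_number P z - winding_number Q z"
proof -
  have "winding_number (P +++ reversepath Q) w = winding_number (P +++ reversepath Q) z"
    using assms by (intro winding_number_eq[where S=T]) (auto simp: path_image_join)
  moreover have "w \<notin> path_image P" "w \<notin> path_image Q" "z \<notin> path_image P" "z \<notin> path_image Q"
    using assms by auto
  ultimately show ?thesis using assms by (simp add: winding_number_loop)
qed

lemma arc_pair_loop:
  assumes "arc P" "arc Q" "pathstart P = a" "pathstart Q = a" "pathfinish P = b" "pathfinish Q = b"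
    and "path_image P \<inter> path_image Q = {a, b}"
  shows "simple_path (P +++ reversepath Q)"
    and "path_image (P +++ reversepath Q) = path_image P \<union> path_image Q"
    and "pathfinish (P +++ reversepath Q) = pathstart (P +++ reversepath Q)"
  using assms by (auto intro!: simple_path_join_loop arc_reversepath simp: path_image_join)

lemma arc_pair_winding:
  assumes "arc P" "arc Q" "pathstart P = a" "pathstart Q = a" "pathfinish P = b" "pathfinish Q = b"
    and "path_image P \<inter> path_image Q = {a, b}"
  shows "z \<in> inside (path_image P \<union> path_image Q) \<Longrightarrow> winding_number P z - winding_number Q z \<in> {1, -1}"
    and "z \<in> outside (path_image P \<union> path_image Q) \<Longrightarrow> winding_number P z - winding_number Q z = 0"
proof -
  note L = arc_pair_loop[OF assms]
  have w: "winding_number (P +++ reversepath Q) z = winding_number P z - winding_number Q z"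
    if "z \<notin> path_image P \<union> path_image Q"
    using assms that by (intro winding_number_loop) (auto dest: arc_imp_path)
  show "winding_number P z - winding_number Q z \<in> {1, -1}" if z: "z \<in> inside (path_image P \<union> path_image Q)"
  proof -
    have "z \<notin> path_image P \<union> path_image Q" using z by (simp add: inside_def)
    then show ?thesis
      using simple_closed_path_winding_number_inside[OF L(1)] z w unfolding L(2) by (metis insertCI)
  qed
  show "winding_number P z - winding_number Q z = 0" if z: "z \<in> outside (path_image P \<union> path_image Q)"
  proof -
    have "z \<notin> path_image P \<union> path_image Q" using z by (simp add: outside_def)
    then show ?thesis
      using winding_number_zero_in_outside[OF simple_path_imp_path[OF L(1)] L(3)] z w unfolding L(2) by metis
  qed
qed

text \<open>An arc \<open>C\<close> running inside the loop of \<open>A\<close> and \<open>B\<close>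
  splits its inner domain into those of the two other loops. So \<open>A\<close> and
  \<open>B\<close> do not enter these domains, and the two remaining contributions vanish.\<close>

lemma theta_winding_inside:
  assumes arcs: "arc A" "arc B" "arc C" and st: "pathstart A = a" "pathstart B = a" "pathstart C = a"
    and fi: "pathfinish A = b" "pathfinish B = b" "pathfinish C = b"
    and I: "path_image A \<inter> path_image B = {a, b}" "path_image B \<inter> path_image C = {a, b}" "path_image C \<inter> path_image A = {a, b}"
    and z: "zA \<in> path_image A - {a, b}" "zB \<in> path_image B - {a, b}" "zC \<in> path_image C - {a, b}"
    and ins: "zC \<in> inside (path_image A \<union> path_image B)"
  shows "winding_number B zA - winding_number C zA = 0" "winding_number C zB - winding_number A zB = 0"
proof -
  have "a \<noteq> b" using arcs(1) st(1) fi(1) arc_distinct_ends by blast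
  obtain *: "inside (path_image A \<union> path_image C) \<inter> inside (path_image B \<union> path_image C) = {}"
    "inside (path_image A \<union> path_image C) \<union> inside (path_image B \<union> path_image C) \<union> (path_image C - {a, b})
      = inside (path_image A \<union> path_image B)"
    by (rule split_inside_simple_closed_curve[of A a b B C])
      (use arcs st fi I z ins \<open>a \<noteq> b\<close> in \<open>auto simp: arc_imp_simple_path Int_commute\<close>)
  have io: "S \<union> T \<union> inside (S \<union> T) \<union> outside (S \<union> T) = UNIV" for S T :: "complex set"
    using inside_Un_outside[of "S \<union> T"] by blast
  have "zA \<notin> inside (path_image A \<union> path_image B)" "zB \<notin> inside (path_image A \<union> path_image B)"
    using z by (auto simp: inside_def)
  then have "zA \<notin> inside (path_image B \<union> path_image C)" "zB \<notin> inside (path_image C \<union> path_image A)"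
    using *(2) by (auto simp: Un_commute)
  moreover have "zA \<notin> path_image B \<union> path_image C" "zB \<notin> path_image C \<union> path_image A"
    using z I by blast+
  ultimately have "zA \<in> outside (path_image B \<union> path_image C)" "zB \<in> outside (path_image C \<union> path_image A)"
    using io[of "path_image B" "path_image C"] io[of "path_image C" "path_image A"] by blast+
  then show "winding_number B zA - winding_number C zA = 0" "winding_number C zB - winding_number A zB = 0"
    using arc_pair_winding(2)[of B C a b zA] arc_pair_winding(2)[of C A a b zB] arcs st fi I by blast+
qed

text \<open>Some arc of a theta graph runs inside the loop of the other two. It contributes 1 or -1,
  by the Jordan curve theorem, and the other two contributions are then 0.\<close>

lemma theta_winding:
  assumes arcs: "arc A" "arc B" "arc C" and st: "pathstart A = a" "pathstart B = a" "pathstart C = a"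
    and fi: "pathfinish A = b" "pathfinish B = b" "pathfinish C = b"
    and I: "path_image A \<inter> path_image B = {a, b}" "path_image B \<inter> path_image C = {a, b}" "path_image C \<inter> path_image A = {a, b}"
    and z: "zA \<in> path_image A - {a, b}" "zB \<in> path_image B - {a, b}" "zC \<in> path_image C - {a, b}"
  shows "(winding_number A zC - winding_number B zC) + (winding_number B zA - winding_number C zA)
    + (winding_number C zB - winding_number A zB) \<in> {1, -1}"
proof -
  note AB = arc_pair_winding[OF arcs(1,2) st(1,2) fi(1,2) I(1)]
  note BC = arc_pair_winding[OF arcs(2,3) st(2,3) fi(2,3) I(2)]
  note CA = arc_pair_winding[OF arcs(3,1) st(3,1) fi(3,1) I(3)]
  have out: "z \<in> outside (S \<union> T)" if "z \<notin> S \<union> T" "z \<notin> inside (S \<union> T)" for z and S T :: "complex set"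
    using inside_Un_outside[of "S \<union> T"] that by blast
  consider "zC \<in> inside (path_image A \<union> path_image B)" | "zA \<in> inside (path_image B \<union> path_image C)"
    | "zB \<in> inside (path_image C \<union> path_image A)"
    | "zC \<in> outside (path_image A \<union> path_image B)" "zA \<in> outside (path_image B \<union> path_image C)"
      "zB \<in> outside (path_image C \<union> path_image A)"
  proof -
    have "zC \<notin> path_image A \<union> path_image B" "zA \<notin> path_image B \<union> path_image C" "zB \<notin> path_image C \<union> path_image A"
      using z I by blast+
    then show ?thesis using that out by metis
  qed
  then show ?thesis
  proof cases
    case 1
    then show ?thesis using AB(1)[OF 1] theta_winding_inside[OF arcs st fi I z 1] by simp
  next
    case 2
    then show ?thesis
      using BC(1)[OF 2] theta_winding_inside[OF arcs(2,3,1) st(2,3,1) fi(2,3,1) I(2,3,1) z(2,3,1) 2] by simp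
  next
    case 3
    then show ?thesis
      using CA(1)[OF 3] theta_winding_inside[OF arcs(3,1,2) st(3,1,2) fi(3,1,2) I(3,1,2) z(3,1,2) 3] by simp
  next
    case 4
    \<comment> \<open>Impossible: the inner domain of the loop through \<open>C\<close> and \<open>A\<close> would miss all three arcs, so by
      continuity at \<open>zC\<close> and \<open>zA\<close> two of the three loops would have winding number 0 about it.\<close>
    define N where "N = inside (path_image C \<union> path_image A)"
    note L = arc_pair_loop[OF arcs(3,1) st(3,1) fi(3,1) I(3)]
    note J = Jordan_inside_outside[OF L(1,3), unfolded L(2), folded N_def]
    have NCA: "N \<inter> (path_image C \<union> path_image A) = {}" using inside_no_overlap[of "path_image C \<union> path_image A"] by (auto simp: N_def)
    have cB: "connected (path_image B - {a, b})"
      using connected_simple_path_endless[OF arc_imp_simple_path[OF arcs(2)]] st fi by simp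
    have "N \<inter> (path_image B - {a, b}) = {}"
    proof (rule ccontr)
      assume "N \<inter> (path_image B - {a, b}) \<noteq> {}"
      moreover have "outside (path_image C \<union> path_image A) \<inter> (path_image B - {a, b}) \<noteq> {}" using 4(3) z(2) by blast
      moreover have "path_image B - {a, b} \<subseteq> N \<union> outside (path_image C \<union> path_image A)"
      proof -
        have "- (path_image C \<union> path_image A) = N \<union> outside (path_image C \<union> path_image A)" using J by blast
        then show ?thesis using I by blast
      qed
      moreover have "open N" "open (outside (path_image C \<union> path_image A))"
        "N \<inter> outside (path_image C \<union> path_image A) \<inter> (path_image B - {a, b}) = {}"
        using J by blast+
      ultimately show False using connectedD[OF cB] by blast
    qed
    moreover have "{a, b} \<subseteq> path_image A" using st fi by auto
    ultimately have NB: "N \<inter> path_image B = {}" using NCA by blast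
    obtain q where q: "q \<in> N" using J by blast
    have cN: "connected N" and frN: "path_image C \<union> path_image A \<subseteq> closure N"
      using J by (auto simp: frontier_def)
    have qAB: "winding_number A q - winding_number B q = winding_number A zC - winding_number B zC"
    proof (rule winding_diff_connected[where T="insert zC N"])
      show "connected (insert zC N)" using frN z(3) by (intro connected_intermediate_closure[OF cN]) (auto intro: closure_subset[THEN subsetD])
    qed (use arcs st fi q NB NCA z I in \<open>auto dest: arc_imp_path\<close>)
    have qBC: "winding_number B q - winding_number C q = winding_number B zA - winding_number C zA"
    proof (rule winding_diff_connected[where T="insert zA N"])
      show "connected (insert zA N)" using frN z(1) by (intro connected_intermediate_closure[OF cN]) (auto intro: closure_subset[THEN subsetD])
    qed (use arcs st fi q NB NCA z I in \<open>auto dest: arc_imp_path\<close>)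
    have "winding_number C q - winding_number A q = 0"
      using qAB qBC AB(2)[OF 4(1)] BC(2)[OF 4(2)] by (simp add: algebra_simps)
    then show ?thesis using CA(1)[of q] q by (simp add: N_def)
  qed
qed

section \<open>Joining three arcs inside a connected set\<close>

lemma connected_arc_minus_start:
  fixes h :: "real \<Rightarrow> 'a :: t2_space"
  assumes "arc h" shows "connected (path_image h - {pathstart h})"
proof -
  have inj: "inj_on h {0..1}" and cont: "continuous_on {0..1} h" using assms by (auto simp: arc_def path_def)
  have "path_image h - {pathstart h} = h ` {0<..1}"
  proof -
    have "h t \<noteq> h 0" if "0 < t" "t \<le> 1" for t using inj_onD[OF inj, of t 0] that by auto
    then show ?thesis unfolding path_image_def pathstart_def
      by (auto simp: image_iff) (metis atLeastAtMost_iff order_le_less greaterThanAtMost_iff)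
  qed
  moreover have "connected (h ` {0<..1})"
    by (intro connected_continuous_image continuous_on_subset[OF cont]) auto
  ultimately show ?thesis by simp
qed

text \<open>Half of a theta graph: \<open>K\<close> is the lower or upper piece of the drawing, the
  three arcs are half-edges attached to it. Two of them are joined through \<open>K\<close>, and the
  third is led through \<open>K\<close> to the first contact with this connection, which becomes the
  branch point.\<close>

lemma tripod:
  fixes K :: "'a :: {complete_space, real_normed_vector} set"
  assumes K: "path_connected K"
    and arcs: "arc h1" "arc h2" "arc h3"
    and base: "path_image h1 \<inter> K = {pathstart h1}" "path_image h2 \<inter> K = {pathstart h2}" "path_image h3 \<inter> K = {pathstart h3}"
    and meet: "path_image h1 \<inter> path_image h2 \<subseteq> K" "path_image h2 \<inter> path_image h3 \<subseteq> K" "path_image h3 \<inter> path_image h1 \<subseteq> K"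
  obtains p g1 g2 g3 where "p \<in> K" "arc g1" "arc g2" "arc g3"
    "pathstart g1 = p" "pathstart g2 = p" "pathstart g3 = p"
    "pathfinish g1 = pathfinish h1" "pathfinish g2 = pathfinish h2" "pathfinish g3 = pathfinish h3"
    "path_image g1 \<subseteq> K \<union> path_image h1" "path_image g2 \<subseteq> K \<union> path_image h2" "path_image g3 \<subseteq> K \<union> path_image h3"
    "path_image g1 \<inter> path_image g2 = {p}" "path_image g2 \<inter> path_image g3 = {p}" "path_image g3 \<inter> path_image g1 = {p}"
proof -
  define u1 where "u1 = pathstart h1"
  define u2 where "u2 = pathstart h2"
  define u3 where "u3 = pathstart h3"
  have b: "path_image h1 \<inter> K = {u1}" "path_image h2 \<inter> K = {u2}" "path_image h3 \<inter> K = {u3}"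
    using base by (auto simp: u1_def u2_def u3_def)
  have uK: "u1 \<in> K" "u2 \<in> K" "u3 \<in> K" "u1 \<in> path_image h1" "u2 \<in> path_image h2" "u3 \<in> path_image h3"
    using b by blast+
  have hK: "x = u1" if "x \<in> path_image h1" "x \<in> K" for x using b(1) that by blast
  have hK2: "x = u2" if "x \<in> path_image h2" "x \<in> K" for x using b(2) that by blast
  have hK3: "x = u3" if "x \<in> path_image h3" "x \<in> K" for x using b(3) that by blast
  have m12: "x \<in> K" if "x \<in> path_image h1" "x \<in> path_image h2" for x using meet(1) that by blast
  have m23: "x \<in> K" if "x \<in> path_image h2" "x \<in> path_image h3" for x using meet(2) that by blast
  have m31: "x \<in> K" if "x \<in> path_image h3" "x \<in> path_image h1" for x using meet(3) that by blast
  have z: "pathfinish h1 \<notin> K" "pathfinish h2 \<notin> K" "pathfinish h3 \<notin> K"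
    using b arcs arc_distinct_ends pathfinish_in_path_image unfolding u1_def u2_def u3_def by blast+
  have arcK: "\<exists>q. arc q \<and> path_image q \<subseteq> K \<and> pathstart q = x \<and> pathfinish q = y" if xy: "x \<in> K" "y \<in> K" "x \<noteq> y" for x y
  proof -
    obtain g where g: "path g" "path_image g \<subseteq> K" "pathstart g = x" "pathfinish g = y"
      using K[unfolded path_connected_def, rule_format, OF xy(1,2)] by (elim exE conjE)
    show ?thesis by (rule path_contains_arc[OF g(1,3,4) xy(3)]) (use g(2) in blast)
  qed
  \<comment> \<open>An arc joining the far ends of \<open>h1\<close> and \<open>h2\<close>;
    \<open>Z\<close> is the part used inside \<open>K\<close>, a single point if both arcs have the
    same foot.\<close>
  obtain \<eta> Z where \<eta>: "arc \<eta>" "pathstart \<eta> = pathfinish h1" "pathfinish \<eta> = pathfinish h2"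
    "path_image \<eta> = path_image h1 \<union> Z \<union> path_image h2" "closed Z" "Z \<subseteq> K" "u1 \<in> Z" "u2 \<in> Z"
  proof (cases "u1 = u2")
    case True
    have "arc (reversepath h1 +++ h2)"
      using arcs meet(1) b True by (intro arc_join) (auto simp: arc_reversepath u1_def u2_def)
    moreover have "u1 \<in> path_image h1" "u2 \<in> path_image h2" using b by blast+
    ultimately show ?thesis using True b
      by (intro that[of "reversepath h1 +++ h2" "{u1}"]) (auto simp: path_image_join u1_def u2_def)
  next
    case False
    obtain q where q: "arc q" "path_image q \<subseteq> K" "pathstart q = u1" "pathfinish q = u2"
      using arcK[of u1 u2] False b by blast
    have 1: "arc (q +++ h2)" using q arcs b by (intro arc_join) (auto simp: u2_def)
    have "path_image h1 \<inter> path_image h2 = {}" using m12 hK hK2 False by blast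
    then have "arc (reversepath h1 +++ (q +++ h2))" using q arcs b 1
      by (intro arc_join) (auto simp: arc_reversepath u1_def u2_def path_image_join)
    moreover have "closed (path_image q)" using q(1) by (simp add: arc_imp_path closed_path_image)
    moreover have "u1 \<in> path_image q" "u2 \<in> path_image q" using q by auto
    ultimately show ?thesis using q
      by (intro that[of "reversepath h1 +++ (q +++ h2)" "path_image q"])
        (auto simp: path_image_join u1_def u2_def Un_assoc)
  qed
  \<comment> \<open>A path in \<open>K\<close> from the foot of \<open>h3\<close> is stopped where
    it first reaches \<open>Z\<close>. If the foot lies in \<open>Z\<close> already,
    \<open>h3\<close> itself is used.\<close>
  obtain p \<theta> where p: "p \<in> Z" and \<theta>: "arc \<theta>" "pathstart \<theta> = p" "pathfinish \<theta> = pathfinish h3"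
    "path_image \<theta> \<subseteq> K \<union> path_image h3" "path_image \<theta> \<inter> path_image \<eta> = {p}"
  proof (cases "u3 \<in> Z")
    case True
    have "path_image h3 \<inter> path_image \<eta> = {u3}" 
    proof -
      have "x = u3" if "x \<in> path_image h3" "x \<in> path_image \<eta>" for x
        using that hK3[OF that(1)] \<eta>(4,6) m23[of x] m31[of x] by blast
      then show ?thesis using uK(6) True \<eta>(4) by blast
    qed
    then show ?thesis using True arcs(3) by (intro that[of u3 h3]) (auto simp: u3_def)
  next
    case False
    obtain g where g: "path g" "path_image g \<subseteq> K" "pathstart g = u3" "pathfinish g = u1"
      using K[unfolded path_connected_def, rule_format, OF uK(3,1)] by (elim exE conjE)
    obtain h where h: "path h" "pathstart h = u3" "path_image h \<subseteq> K"
      "path_image h - {pathfinish h} \<subseteq> interior (- Z)" "pathfinish h \<in> frontier (- Z)"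
      using exists_path_subpath_to_frontier[of g "- Z"] g False \<eta>(7)
      by (metis ComplI ComplD closure_subset subsetD subset_trans)
    define o' where "o' = pathfinish h"
    have oZ: "o' \<in> Z" 
    proof -
      have "interior (- Z) = - Z" using \<eta>(5) by (simp add: interior_open open_Compl)
      then show ?thesis using h(5) unfolding o'_def frontier_def by blast
    qed
    then have "u3 \<noteq> o'" using False by blast
    then obtain q where q: "arc q" "path_image q \<subseteq> path_image h" "pathstart q = u3" "pathfinish q = o'"
      using path_contains_arc[of h u3 o'] h by (auto simp: o'_def)
    have qZ: "path_image q \<inter> Z = {o'}"
    proof -
      have "path_image q \<inter> Z \<subseteq> {o'}" using q(2) h(4) interior_subset[of "- Z"] by (auto simp: o'_def)
      moreover have "o' \<in> path_image q" using q by (metis pathfinish_in_path_image)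
      ultimately show ?thesis using oZ by blast
    qed
    have qK: "path_image q \<subseteq> K" using q h by blast
    have a: "arc (reversepath q +++ h3)" using q arcs b qK by (intro arc_join) (auto simp: arc_reversepath u3_def)
    have "x \<notin> path_image \<eta>" if x3: "x \<in> path_image h3" for x
    proof
      assume x: "x \<in> path_image \<eta>"
      then have "x \<in> K" using x3 \<eta>(4,6) m23[of x] m31[of x] by blast
      then have "x = u3" "x \<in> path_image h1 \<Longrightarrow> x = u1" "x \<in> path_image h2 \<Longrightarrow> x = u2" using hK hK2 hK3 x3 by blast+
      then show False using x \<eta>(4,7,8) False by blast
    qed
    then have "path_image h3 \<inter> path_image \<eta> = {}" by blast
    moreover have "path_image q \<inter> path_image \<eta> = {o'}"
    proof -
      have "x \<in> Z" if "x \<in> path_image q" "x \<in> path_image \<eta>" for x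
        using that qK hK[of x] hK2[of x] \<eta>(4,7,8) by blast
      then show ?thesis using qZ \<eta>(4) by blast
    qed
    ultimately have "path_image (reversepath q +++ h3) \<inter> path_image \<eta> = {o'}"
      using q by (auto simp: path_image_join u3_def)
    then show ?thesis using oZ a q qK
      by (intro that[of o' "reversepath q +++ h3"]) (auto simp: path_image_join u3_def)
  qed
  have pK: "p \<in> K" using p \<eta>(6) by blast
  have "p \<in> path_image \<eta>" using p \<eta>(4) by blast
  then obtain \<tau> where \<tau>: "\<tau> \<in> {0..1}" "\<eta> \<tau> = p" by (auto simp: path_image_def)
  have "\<tau> \<noteq> 0" "\<tau> \<noteq> 1" using \<tau> \<eta>(2,3) z(1,2) pK by (auto simp: pathstart_def pathfinish_def)
  define g1 where "g1 = subpath \<tau> 0 \<eta>"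
  define g2 where "g2 = subpath \<tau> 1 \<eta>"
  have g: "arc g1" "arc g2" unfolding g1_def g2_def using \<eta>(1) \<tau> \<open>\<tau> \<noteq> 0\<close> \<open>\<tau> \<noteq> 1\<close>
    by (auto intro!: arc_subpath_arc)
  have gs: "pathstart g1 = p" "pathstart g2 = p" "pathfinish g1 = pathfinish h1" "pathfinish g2 = pathfinish h2"
    using \<tau> \<eta>(2,3) by (auto simp: g1_def g2_def pathstart_def pathfinish_def subpath_def)
  have im: "path_image g1 = \<eta> ` {0..\<tau>}" "path_image g2 = \<eta> ` {\<tau>..1}"
    using \<tau> \<open>\<tau> \<noteq> 0\<close> by (auto simp: g1_def g2_def path_image_subpath)
  have inj: "inj_on \<eta> {0..1}" using \<eta>(1) by (simp add: arc_def)
  have g12: "path_image g1 \<inter> path_image g2 = {p}"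
  proof -
    have "path_image g1 \<inter> path_image g2 = \<eta> ` ({0..\<tau>} \<inter> {\<tau>..1})"
      unfolding im using \<tau>(1) by (intro inj_on_image_Int[OF inj, symmetric]) auto
    also have "{0..\<tau>} \<inter> {\<tau>..1} = {\<tau>}" using \<tau>(1) by auto
    finally show ?thesis using \<tau> by simp
  qed
  have sub: "path_image g1 \<subseteq> path_image \<eta>" "path_image g2 \<subseteq> path_image \<eta>"
    unfolding im using \<tau>(1) by (auto simp: path_image_def)
  have un: "path_image \<eta> \<subseteq> path_image g1 \<union> path_image g2"
  proof -
    have "path_image \<eta> = \<eta> ` ({0..\<tau>} \<union> {\<tau>..1})"
      unfolding path_image_def using \<tau>(1) by (intro arg_cong[where f="image \<eta>"]) auto
    then show ?thesis unfolding im by blast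
  qed
  have conn: "connected (path_image h - {pathstart h})" if "arc h" for h :: "real \<Rightarrow> 'a"
    by (rule connected_arc_minus_start[OF that])
  \<comment> \<open>\<open>h1\<close> without its foot is connected, avoids \<open>p\<close> and
    contains the far end of \<open>g1\<close>. As \<open>g1\<close> and \<open>g2\<close> meet only
    in \<open>p\<close>, it cannot enter \<open>g2\<close>; so the split of \<open>\<eta>\<close> at
    \<open>p\<close> does not tear \<open>h1\<close>.\<close>
  have h1g: "path_image g2 \<inter> (path_image h1 - {u1}) = {}"
  proof (rule ccontr)
    assume ne: "path_image g2 \<inter> (path_image h1 - {u1}) \<noteq> {}"
    have "pathfinish h1 \<in> path_image g1 \<inter> (path_image h1 - {u1})"
      using gs(3) z(1) b(1) by (metis DiffI IntI Int_iff insertI1 pathfinish_in_path_image singletonD)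
    moreover have "path_image h1 - {u1} \<subseteq> path_image g1 \<union> path_image g2" using \<eta>(4) un by blast
    moreover have "path_image g1 \<inter> path_image g2 \<inter> (path_image h1 - {u1}) = {}" using g12 hK[OF _ pK] by auto
    moreover have "closed (path_image g1)" "closed (path_image g2)" using g by (simp_all add: arc_imp_path closed_path_image)
    ultimately show False using conn[OF arcs(1)] ne unfolding connected_closed u1_def by blast
  qed
  have h2g: "path_image g1 \<inter> (path_image h2 - {u2}) = {}"
  proof (rule ccontr)
    assume ne: "path_image g1 \<inter> (path_image h2 - {u2}) \<noteq> {}"
    have "pathfinish h2 \<in> path_image g2 \<inter> (path_image h2 - {u2})"
      using gs(4) z(2) b(2) by (metis DiffI IntI Int_iff insertI1 pathfinish_in_path_image singletonD)
    moreover have "path_image h2 - {u2} \<subseteq> path_image g1 \<union> path_image g2" using \<eta>(4) un by blast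
    moreover have "path_image g1 \<inter> path_image g2 \<inter> (path_image h2 - {u2}) = {}" using g12 hK2[OF _ pK] by auto
    moreover have "closed (path_image g1)" "closed (path_image g2)" using g by (simp_all add: arc_imp_path closed_path_image)
    ultimately show False using conn[OF arcs(2)] ne unfolding connected_closed u2_def by blast
  qed
  have "path_image g1 \<subseteq> K \<union> path_image h1" using sub(1) \<eta>(4,6,8) h2g by blast
  moreover have "path_image g2 \<subseteq> K \<union> path_image h2" using sub(2) \<eta>(4,6,7) h1g by blast
  moreover have "p \<in> path_image \<theta>" "p \<in> path_image g1" "p \<in> path_image g2"
    using \<theta>(2) gs(1,2) by (metis pathstart_in_path_image)+
  then have "path_image g2 \<inter> path_image \<theta> = {p}" "path_image \<theta> \<inter> path_image g1 = {p}"
    using \<theta>(5) sub by blast+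
  ultimately show thesis using that[of p g1 g2 \<theta>] pK g \<theta> gs g12 by blast
qed

section \<open>The cyclic order of the edges crossing a level\<close>

text \<open>Independence of the reference paths. Grouped by paths, the left side contains the change
  of the winding number of \<open>P1\<close> between \<open>z2\<close> and \<open>z3\<close>. Since
  \<open>T1\<close> joins these points off the loop, \<open>P1\<close> can be replaced there by
  \<open>R\<close> followed by \<open>Q1\<close>. After the three replacements the contributions of
  \<open>R\<close> cancel cyclically.\<close>

lemma winding_system:
  assumes P: "path P1" "path P2" "path P3" "pathstart P1 = a" "pathstart P2 = a" "pathstart P3 = a"
    and Q: "path Q1" "path Q2" "path Q3" "pathstart Q1 = b" "pathstart Q2 = b" "pathstart Q3 = b"
    and f: "pathfinish P1 = pathfinish Q1" "pathfinish P2 = pathfinish Q2" "pathfinish P3 = pathfinish Q3"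
    and R: "path R" "pathstart R = a" "pathfinish R = b"
    and T: "connected T1" "connected T2" "connected T3"
      "T1 \<inter> (path_image P1 \<union> path_image Q1 \<union> path_image R) = {}"
      "T2 \<inter> (path_image P2 \<union> path_image Q2 \<union> path_image R) = {}"
      "T3 \<inter> (path_image P3 \<union> path_image Q3 \<union> path_image R) = {}"
    and z: "z2 \<in> T1" "z3 \<in> T1" "z3 \<in> T2" "z1 \<in> T2" "z1 \<in> T3" "z2 \<in> T3"
  shows "(winding_number P1 z3 - winding_number P2 z3) + (winding_number P2 z1 - winding_number P3 z1)
      + (winding_number P3 z2 - winding_number P1 z2) =
    (winding_number Q1 z3 - winding_number Q2 z3) + (winding_number Q2 z1 - winding_number Q3 z1)
      + (winding_number Q3 z2 - winding_number Q1 z2)"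
proof -
  have *: "winding_number P w - winding_number R w - winding_number Q w = winding_number P z - winding_number R z - winding_number Q z"
    if "path P" "path Q" "pathstart P = a" "pathstart Q = b" "pathfinish P = pathfinish Q" "connected T"
      "T \<inter> (path_image P \<union> path_image Q \<union> path_image R) = {}" "w \<in> T" "z \<in> T" for P Q T w z
  proof -
    have "winding_number P w - winding_number (R +++ Q) w = winding_number P z - winding_number (R +++ Q) z"
      using that R by (intro winding_diff_connected[where T=T]) (auto simp: path_image_join)
    moreover have "winding_number (R +++ Q) x = winding_number R x + winding_number Q x" if "x \<in> T" for x
      using \<open>T \<inter> _ = {}\<close> that \<open>path Q\<close> \<open>pathstart Q = b\<close> R by (intro winding_number_join) auto
    ultimately show ?thesis using that by (simp add: algebra_simps)
  qed
  show ?thesis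
    using *[OF P(1) Q(1) P(4) Q(4) f(1) T(1,4) z(1,2)] *[OF P(2) Q(2) P(5) Q(5) f(2) T(2,5) z(3,4)]
      *[OF P(3) Q(3) P(6) Q(6) f(3) T(3,6) z(5,6)] by algebra
qed

text \<open>Every clause is restricted to vertices of \<open>S\<close>, so \<open>p\<close>,
  \<open>g\<close> and even \<open>E\<close> can stay the same when the induction passes to a subset
  of the vertices. The points are complex because winding numbers are taken about them.\<close>

locale plane_drawing =
  fixes S :: "'a set" and E :: "'a \<Rightarrow> 'a \<Rightarrow> bool" and p :: "'a \<Rightarrow> complex"
    and g :: "'a \<Rightarrow> 'a \<Rightarrow> real \<Rightarrow> complex"
  assumes fin: "finite S" and sym: "E u v \<Longrightarrow> E v u" and irr: "\<not> E u u"
    and pinj: "inj_on p S"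
    and arcg: "u \<in> S \<Longrightarrow> v \<in> S \<Longrightarrow> E u v \<Longrightarrow> arc (g u v) \<and> pathstart (g u v) = p u \<and> pathfinish (g u v) = p v"
    and vert: "u \<in> S \<Longrightarrow> v \<in> S \<Longrightarrow> E u v \<Longrightarrow> w \<in> S \<Longrightarrow> p w \<in> path_image (g u v) \<Longrightarrow> w = u \<or> w = v"
    and crossing: "u \<in> S \<Longrightarrow> v \<in> S \<Longrightarrow> E u v \<Longrightarrow> u' \<in> S \<Longrightarrow> v' \<in> S \<Longrightarrow> E u' v' \<Longrightarrow> {u, v} \<noteq> {u', v'} \<Longrightarrow>
      path_image (g u v) \<inter> path_image (g u' v') \<subseteq> p ` ({u, v} \<inter> {u', v'})"

locale st_drawing = plane_drawing S E p g
  for S :: "'a set" and E :: "'a \<Rightarrow> 'a \<Rightarrow> bool" and p :: "'a \<Rightarrow> complex"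
    and g :: "'a \<Rightarrow> 'a \<Rightarrow> real \<Rightarrow> complex" +
  fixes s t :: 'a and y :: "'a \<Rightarrow> real"
  assumes st: "st_order E S s t y" and est: "E s t"
begin

definition D :: "('a \<times> 'a) set" where "D = {(u, v). u \<in> S \<and> v \<in> S \<and> E u v \<and> y u < y v}"

definition edge_im :: "'a \<times> 'a \<Rightarrow> complex set" where "edge_im e = path_image (g (fst e) (snd e))"

definition K :: "'a set \<Rightarrow> complex set" where
  "K X = p ` X \<union> (\<Union>e\<in>{e \<in> D. fst e \<in> X \<and> snd e \<in> X}. edge_im e)"

text \<open>Pairs \<open>(v, v)\<close> stand for the vertex \<open>v\<close>, so that vertices and edges can be compared with one another.\<close>

definition mid :: "'a \<times> 'a \<Rightarrow> complex" where
  "mid e = (if fst e = snd e then p (fst e) else g (fst e) (snd e) (1/2))"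

text \<open>Both halves start at a vertex and end in the midpoint: the upper one runs backwards
  along the edge.\<close>

definition low :: "'a \<times> 'a \<Rightarrow> real \<Rightarrow> complex" where "low e = subpath 0 (1/2) (g (fst e) (snd e))"

definition high :: "'a \<times> 'a \<Rightarrow> real \<Rightarrow> complex" where "high e = subpath 1 (1/2) (g (fst e) (snd e))"

lemma D_edge: "e \<in> D \<Longrightarrow> fst e \<in> S" "e \<in> D \<Longrightarrow> snd e \<in> S" "e \<in> D \<Longrightarrow> E (fst e) (snd e)"
  "e \<in> D \<Longrightarrow> y (fst e) < y (snd e)" "e \<in> D \<Longrightarrow> fst e \<noteq> snd e"
  using irr by (auto simp: D_def)

section \<open>Edges and their halves\<close>

lemma arc_edge:
  assumes "e \<in> D"
  shows "arc (g (fst e) (snd e))" "g (fst e) (snd e) 0 = p (fst e)" "g (fst e) (snd e) 1 = p (snd e)"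
  using arcg[of "fst e" "snd e"] D_edge[OF assms] by (auto simp: pathstart_def pathfinish_def)

lemma halves:
  assumes "e \<in> D"
  shows "arc (low e)" "arc (high e)" "pathstart (low e) = p (fst e)" "pathstart (high e) = p (snd e)"
    "pathfinish (low e) = mid e" "pathfinish (high e) = mid e"
    "path_image (low e) \<union> path_image (high e) = edge_im e" "path_image (low e) \<inter> path_image (high e) = {mid e}"
    "p (snd e) \<notin> path_image (low e)" "p (fst e) \<notin> path_image (high e)"
proof -
  let ?g = "g (fst e) (snd e)"
  note a = arc_edge[OF assms]
  show "arc (low e)" "arc (high e)" unfolding low_def high_def using a(1) by (auto intro!: arc_subpath_arc)
  show "pathstart (low e) = p (fst e)" "pathstart (high e) = p (snd e)" "pathfinish (low e) = mid e" "pathfinish (high e) = mid e"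
    using a D_edge[OF assms] by (auto simp: low_def high_def mid_def)
  have i: "path_image (low e) = ?g ` {0..1/2}" "path_image (high e) = ?g ` {1/2..1}"
    by (auto simp: low_def high_def path_image_subpath)
  have inj: "inj_on ?g {0..1}" using a(1) by (simp add: arc_def)
  have "{0..1} = {0..1/2} \<union> {1/2..1::real}" by auto
  then have "edge_im e = ?g ` ({0..1/2} \<union> {1/2..1})" unfolding edge_im_def path_image_def by (simp only:)
  then show "path_image (low e) \<union> path_image (high e) = edge_im e" unfolding i image_Un ..
  have "?g ` {0..1/2} \<inter> ?g ` {1/2..1} = ?g ` ({0..1/2} \<inter> {1/2..1})"
    by (intro inj_on_image_Int[OF inj, symmetric]) auto
  also have "{0..1/2} \<inter> {1/2..1::real} = {1/2}" by auto
  finally show "path_image (low e) \<inter> path_image (high e) = {mid e}" unfolding i using D_edge[OF assms] by (simp add: mid_def)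
  have "1 \<in> {0..1/2::real}" if "?g 1 \<in> ?g ` {0..1/2}"
    using that inj_on_image_mem_iff[OF inj, of 1 "{0..1/2}"] by auto
  then show "p (snd e) \<notin> path_image (low e)" unfolding i using a(3) by auto
  have "0 \<in> {1/2..1::real}" if "?g 0 \<in> ?g ` {1/2..1}"
    using that inj_on_image_mem_iff[OF inj, of 0 "{1/2..1}"] by auto
  then show "p (fst e) \<notin> path_image (high e)" unfolding i using a(2) by auto
qed

lemma half_subset: "e \<in> D \<Longrightarrow> path_image (low e) \<subseteq> edge_im e" "e \<in> D \<Longrightarrow> path_image (high e) \<subseteq> edge_im e"
  using halves(7) by blast+

lemma ends_in_halves: "e \<in> D \<Longrightarrow> p (fst e) \<in> path_image (low e)" "e \<in> D \<Longrightarrow> p (snd e) \<in> path_image (high e)"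
  "e \<in> D \<Longrightarrow> mid e \<in> path_image (low e)" "e \<in> D \<Longrightarrow> mid e \<in> path_image (high e)"
  by (metis halves(3) pathstart_in_path_image, metis halves(4) pathstart_in_path_image,
      metis halves(5) pathfinish_in_path_image, metis halves(6) pathfinish_in_path_image)

lemma edge_im_meet:
  assumes "e \<in> D" "e' \<in> D" "e \<noteq> e'" "q \<in> edge_im e" "q \<in> edge_im e'"
  obtains w where "q = p w" "w = fst e \<or> w = snd e" "w = fst e' \<or> w = snd e'"
proof -
  have "{fst e, snd e} \<noteq> {fst e', snd e'}"
    using assms(3) D_edge(4)[OF assms(1)] D_edge(4)[OF assms(2)] by (auto simp: doubleton_eq_iff prod_eq_iff)
  then have "q \<in> p ` ({fst e, snd e} \<inter> {fst e', snd e'})"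
    using crossing[of "fst e" "snd e" "fst e'" "snd e'"] D_edge[OF assms(1)] D_edge[OF assms(2)] assms(4,5)
    unfolding edge_im_def by blast
  then show ?thesis using that by auto
qed

lemma low_vertex: "e \<in> D \<Longrightarrow> w \<in> S \<Longrightarrow> p w \<in> path_image (low e) \<Longrightarrow> w = fst e"
  using vert[of "fst e" "snd e" w] D_edge[of e] half_subset(1)[of e] halves(9)[of e] unfolding edge_im_def by blast

lemma high_vertex: "e \<in> D \<Longrightarrow> w \<in> S \<Longrightarrow> p w \<in> path_image (high e) \<Longrightarrow> w = snd e"
  using vert[of "fst e" "snd e" w] D_edge[of e] half_subset(2)[of e] halves(10)[of e] unfolding edge_im_def by blast

lemma half_meet:
  assumes "e \<in> D" "e' \<in> D" "e \<noteq> e'"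
  shows "q \<in> path_image (low e) \<Longrightarrow> q \<in> path_image (low e') \<Longrightarrow> fst e = fst e' \<and> q = p (fst e)"
    and "q \<in> path_image (low e) \<Longrightarrow> q \<in> path_image (high e') \<Longrightarrow> fst e = snd e' \<and> q = p (fst e)"
    and "q \<in> path_image (high e) \<Longrightarrow> q \<in> path_image (high e') \<Longrightarrow> snd e = snd e' \<and> q = p (snd e)"
proof -
  have w: "\<exists>w\<in>S. q = p w" if "q \<in> edge_im e" "q \<in> edge_im e'"
    using edge_im_meet[OF assms that] D_edge[OF assms(1)] by metis
  show "fst e = fst e' \<and> q = p (fst e)" if "q \<in> path_image (low e)" "q \<in> path_image (low e')"
    using that w half_subset(1)[OF assms(1)] half_subset(1)[OF assms(2)] low_vertex[OF assms(1)] low_vertex[OF assms(2)] by blast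
  show "fst e = snd e' \<and> q = p (fst e)" if "q \<in> path_image (low e)" "q \<in> path_image (high e')"
    using that w half_subset(1)[OF assms(1)] half_subset(2)[OF assms(2)] low_vertex[OF assms(1)] high_vertex[OF assms(2)] by blast
  show "snd e = snd e' \<and> q = p (snd e)" if "q \<in> path_image (high e)" "q \<in> path_image (high e')"
    using that w half_subset(2)[OF assms(1)] half_subset(2)[OF assms(2)] high_vertex[OF assms(1)] high_vertex[OF assms(2)] by blast
qed

section \<open>The pieces of the drawing spanned by vertex sets\<close>

lemma K_mono: "X \<subseteq> Y \<Longrightarrow> K X \<subseteq> K Y" unfolding K_def by blast

lemma edge_im_K:
  assumes "e \<in> D" "X \<subseteq> S" "\<not> (fst e \<in> X \<and> snd e \<in> X)" "q \<in> edge_im e" "q \<in> K X"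
  obtains w where "q = p w" "w \<in> X" "w = fst e \<or> w = snd e"
proof -
  from assms(5) consider w where "w \<in> X" "q = p w" | e' where "e' \<in> D" "fst e' \<in> X" "snd e' \<in> X" "q \<in> edge_im e'"
    unfolding K_def by blast
  then show ?thesis
  proof cases
    case 1
    then show ?thesis using that vert[of "fst e" "snd e" w] D_edge[OF assms(1)] assms(2,4) unfolding edge_im_def by blast
  next
    case 2
    then have "e \<noteq> e'" using assms(3) by blast
    then obtain w where "q = p w" "w = fst e \<or> w = snd e" "w = fst e' \<or> w = snd e'"
      by (rule edge_im_meet[OF assms(1) 2(1) _ assms(4) 2(4)])
    moreover from this have "w \<in> X" using 2 by metis
    ultimately show ?thesis using that[of w] by blast
  qed
qed

lemma low_K:
  assumes "e \<in> D" "X \<subseteq> S" "\<not> (fst e \<in> X \<and> snd e \<in> X)" "q \<in> path_image (low e)" "q \<in> K X"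
  shows "fst e \<in> X \<and> q = p (fst e)"
proof -
  have "q \<in> edge_im e" using assms(4) half_subset(1)[OF assms(1)] by blast
  then obtain w where "q = p w" "w \<in> X" by (rule edge_im_K[OF assms(1-3) _ assms(5)])
  then show ?thesis using low_vertex[OF assms(1)] assms(2,4) by blast
qed

lemma high_K:
  assumes "e \<in> D" "X \<subseteq> S" "\<not> (fst e \<in> X \<and> snd e \<in> X)" "q \<in> path_image (high e)" "q \<in> K X"
  shows "snd e \<in> X \<and> q = p (snd e)"
proof -
  have "q \<in> edge_im e" using assms(4) half_subset(2)[OF assms(1)] by blast
  then obtain w where "q = p w" "w \<in> X" by (rule edge_im_K[OF assms(1-3) _ assms(5)])
  then show ?thesis using high_vertex[OF assms(1)] assms(2,4) by blast
qed

lemma mid_notin_K: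
  assumes "e \<in> D" "X \<subseteq> S" "\<not> (fst e \<in> X \<and> snd e \<in> X)" shows "mid e \<notin> K X"
proof
  assume "mid e \<in> K X"
  then have "p (fst e) = p (snd e)"
    using low_K[OF assms ends_in_halves(3)[OF assms(1)]] high_K[OF assms ends_in_halves(4)[OF assms(1)]] by metis
  then show False using pinj D_edge[OF assms(1)] by (auto dest: inj_onD)
qed

lemma K_disjoint: "X \<subseteq> S \<Longrightarrow> Y \<subseteq> S \<Longrightarrow> X \<inter> Y = {} \<Longrightarrow> K X \<inter> K Y = {}"
proof -
  assume X: "X \<subseteq> S" "Y \<subseteq> S" "X \<inter> Y = {}"
  have False if "q \<in> K X" "q \<in> K Y" for q
  proof -
    have "\<exists>w\<in>Y. q = p w"
    proof -
      from that(2) consider w where "w \<in> Y" "q = p w" | e where "e \<in> D" "fst e \<in> Y" "snd e \<in> Y" "q \<in> edge_im e"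
        unfolding K_def by blast
      then show ?thesis
      proof cases
        case 2
        then have "\<not> (fst e \<in> X \<and> snd e \<in> X)" using X by blast
        then show ?thesis using edge_im_K[OF 2(1) X(1) _ 2(4) that(1)] 2 by metis
      qed blast
    qed
    then obtain w where w: "w \<in> Y" "q = p w" by blast
    from that(1) consider w' where "w' \<in> X" "q = p w'" | e where "e \<in> D" "fst e \<in> X" "snd e \<in> X" "q \<in> edge_im e"
      unfolding K_def by blast
    then show False
    proof cases
      case 1
      then have "w = w'" using w X inj_onD[OF pinj, of w w'] by auto
      then show False using 1 w X by blast
    next
      case 2
      then have "w = fst e \<or> w = snd e" using vert[of "fst e" "snd e" w] D_edge[OF 2(1)] w X unfolding edge_im_def by blast
      then show False using 2 w X by blast
    qed
  qed
  then show ?thesis by blast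
qed

text \<open>From every vertex one descends along edges with decreasing \<open>f\<close> until
  \<open>r\<close> is reached. Taking \<open>y\<close> and \<open>-y\<close> for \<open>f\<close>
  covers lower and upper sets, and this is where the two conditions of an st-order enter.\<close>

lemma path_connected_K:
  fixes f :: "'a \<Rightarrow> real"
  assumes X: "X \<subseteq> S" "r \<in> X" and step: "\<And>v. v \<in> X \<Longrightarrow> v \<noteq> r \<Longrightarrow> \<exists>u\<in>X. E u v \<and> f u < f v"
  shows "path_connected (K X)"
proof -
  have finX: "finite X" using X fin finite_subset by blast
  have edge: "path_component (K X) q q'" if "e \<in> D" "fst e \<in> X" "snd e \<in> X" "q \<in> edge_im e" "q' \<in> edge_im e" for e q q'
  proof -
    have "path_connected (edge_im e)" unfolding edge_im_def using arc_edge(1)[OF that(1)]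
      by (intro path_connected_path_image) (rule arc_imp_path)
    then have "path_component (edge_im e) q q'" using that by (simp add: path_connected_component)
    moreover have "edge_im e \<subseteq> K X" using that unfolding K_def by blast
    ultimately show ?thesis by (meson path_component_of_subset)
  qed
  have pin: "p (fst e) \<in> edge_im e" "p (snd e) \<in> edge_im e" if "e \<in> D" for e
    using ends_in_halves(1,2)[OF that] half_subset[OF that] by blast+
  have reach: "path_component (K X) (p v) (p r)" if "v \<in> X" for v
    using that
  proof (induction "card {w \<in> X. f w < f v}" arbitrary: v rule: less_induct)
    case less
    show ?case
    proof (cases "v = r")
      case True
      then show ?thesis using X(2) unfolding K_def by (auto intro: path_component_refl)
    next
      case False
      then obtain u where u: "u \<in> X" "E u v" "f u < f v" using step less.prems by blast
      have "{w \<in> X. f w < f u} \<subset> {w \<in> X. f w < f v}" using u by auto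
      then have "card {w \<in> X. f w < f u} < card {w \<in> X. f w < f v}" using finX by (simp add: psubset_card_mono)
      then have "path_component (K X) (p u) (p r)" using less.hyps u(1) by blast
      moreover have "path_component (K X) (p v) (p u)"
      proof -
        have "y u \<noteq> y v" using st u X less.prems irr inj_onD[of y S u v] unfolding st_order_def by auto
        then have "(u, v) \<in> D \<or> (v, u) \<in> D" using u less.prems X sym by (auto simp: D_def)
        then show ?thesis using edge[of "(u, v)"] edge[of "(v, u)"] pin[of "(u, v)"] pin[of "(v, u)"] u less.prems by auto
      qed
      ultimately show ?thesis by (meson path_component_trans)
    qed
  qed
  have "path_component (K X) q (p r)" if "q \<in> K X" for q
  proof -
    from that consider w where "w \<in> X" "q = p w" | e where "e \<in> D" "fst e \<in> X" "snd e \<in> X" "q \<in> edge_im e"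
      unfolding K_def by blast
    then show ?thesis
    proof cases
      case 1
      then show ?thesis using reach by blast
    next
      case 2
      then show ?thesis using edge[OF 2 pin(1)] reach by (meson path_component_trans)
    qed
  qed
  then show ?thesis unfolding path_connected_component by (meson path_component_sym path_component_trans)
qed

section \<open>Lower and upper sets and the reference paths in them\<close>

lemma yinj: "inj_on y S" and sS: "s \<in> S" and tS: "t \<in> S"
  and lower: "v \<in> S \<Longrightarrow> v \<noteq> s \<Longrightarrow> \<exists>u\<in>S. E u v \<and> y u < y v"
  and upper: "v \<in> S \<Longrightarrow> v \<noteq> t \<Longrightarrow> \<exists>u\<in>S. E v u \<and> y v < y u"
  using st unfolding st_order_def by blast+

lemma s_min: "v \<in> S \<Longrightarrow> y s \<le> y v"
proof -
  obtain w where w: "w \<in> S" "\<And>u. u \<in> S \<Longrightarrow> y w \<le> y u"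
    using arg_min_if_finite(1)[of S y] arg_min_least[of S _ y] fin sS by blast
  then have "w = s" using lower[of w] by fastforce
  then show "v \<in> S \<Longrightarrow> y s \<le> y v" using w by blast
qed

lemma t_max: "v \<in> S \<Longrightarrow> y v \<le> y t"
proof -
  obtain w where w: "w \<in> S" "\<And>u. u \<in> S \<Longrightarrow> - y w \<le> - y u"
    using arg_min_if_finite(1)[of S "\<lambda>v. - y v"] arg_min_least[of S _ "\<lambda>v. - y v"] fin sS by blast
  then have "w = t" using upper[of w] by fastforce
  then show "v \<in> S \<Longrightarrow> y v \<le> y t" using w by fastforce
qed

text \<open>The closed version contains the vertex at height \<open>h\<close>, the open one omits
  it; the comparison of an edge with its end \<open>v\<close> needs \<open>v\<close> on one side
  only.\<close>

lemma path_connected_lower: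
  assumes "L = {v \<in> S. y v \<le> h} \<or> L = {v \<in> S. y v < h}" "L \<noteq> {}"
  shows "path_connected (K L)"
proof (rule path_connected_K[of L s y])
  obtain v where "v \<in> L" using assms(2) by blast
  then show "s \<in> L" using s_min[of v] assms(1) sS by auto
  show "\<exists>u\<in>L. E u v \<and> y u < y v" if v: "v \<in> L" "v \<noteq> s" for v
  proof -
    have vS: "v \<in> S" using v assms(1) by auto
    obtain u where "u \<in> S" "E u v" "y u < y v" using lower[OF vS v(2)] by blast
    then show ?thesis using v assms(1) by auto
  qed
qed (use assms(1) in auto)

lemma path_connected_upper:
  assumes "U = {v \<in> S. h \<le> y v} \<or> U = {v \<in> S. h < y v}" "U \<noteq> {}"
  shows "path_connected (K U)"
proof (rule path_connected_K[of U t "\<lambda>v. - y v"])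
  obtain v where "v \<in> U" using assms(2) by blast
  then show "t \<in> U" using t_max[of v] assms(1) tS by auto
  show "\<exists>u\<in>U. E u v \<and> - y u < - y v" if v: "v \<in> U" "v \<noteq> t" for v
  proof -
    have vS: "v \<in> S" using v assms(1) by auto
    obtain u where "u \<in> S" "E v u" "y v < y u" using upper[OF vS v(2)] by blast
    moreover have "u \<in> U" using calculation v assms(1) by auto
    ultimately show ?thesis using sym[of v u] by auto
  qed
qed (use assms(1) in auto)

lemma vertex_in_K: "w \<in> X \<Longrightarrow> p w \<in> K X" unfolding K_def by blast

lemma ex_down:
  assumes "v \<in> S"
  shows "\<exists>P. path P \<and> pathstart P = p s \<and> pathfinish P = p v \<and> path_image P \<subseteq> K {w \<in> S. y w \<le> y v}"
proof -
  have "path_connected (K {w \<in> S. y w \<le> y v})" using assms by (intro path_connected_lower) auto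
  moreover have "p s \<in> K {w \<in> S. y w \<le> y v}" "p v \<in> K {w \<in> S. y w \<le> y v}"
    using assms s_min sS by (auto intro!: vertex_in_K)
  ultimately show ?thesis unfolding path_connected_def by blast
qed

lemma ex_up:
  assumes "v \<in> S"
  shows "\<exists>P. path P \<and> pathstart P = p t \<and> pathfinish P = p v \<and> path_image P \<subseteq> K {w \<in> S. y v \<le> y w}"
proof -
  have "path_connected (K {w \<in> S. y v \<le> y w})" using assms by (intro path_connected_upper) auto
  moreover have "p t \<in> K {w \<in> S. y v \<le> y w}" "p v \<in> K {w \<in> S. y v \<le> y w}"
    using assms t_max tS by (auto intro!: vertex_in_K)
  ultimately show ?thesis unfolding path_connected_def by blast
qed

text \<open>An arbitrary choice: only the ends and the confinement to the lower set matter. These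
  paths need not be arcs and may run through each other.\<close>

definition down :: "'a \<Rightarrow> real \<Rightarrow> complex" where
  "down v = (SOME P. path P \<and> pathstart P = p s \<and> pathfinish P = p v \<and> path_image P \<subseteq> K {w \<in> S. y w \<le> y v})"

definition up :: "'a \<Rightarrow> real \<Rightarrow> complex" where
  "up v = (SOME P. path P \<and> pathstart P = p t \<and> pathfinish P = p v \<and> path_image P \<subseteq> K {w \<in> S. y v \<le> y w})"

lemma down: "v \<in> S \<Longrightarrow> path (down v)" "v \<in> S \<Longrightarrow> pathstart (down v) = p s" "v \<in> S \<Longrightarrow> pathfinish (down v) = p v"
  "v \<in> S \<Longrightarrow> path_image (down v) \<subseteq> K {w \<in> S. y w \<le> y v}"
  using someI_ex[OF ex_down] unfolding down_def by blast+

lemma up: "v \<in> S \<Longrightarrow> path (up v)" "v \<in> S \<Longrightarrow> pathstart (up v) = p t" "v \<in> S \<Longrightarrow> pathfinish (up v) = p v"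
  "v \<in> S \<Longrightarrow> path_image (up v) \<subseteq> K {w \<in> S. y v \<le> y w}"
  using someI_ex[OF ex_up] unfolding up_def by blast+

definition low_path :: "'a \<times> 'a \<Rightarrow> real \<Rightarrow> complex" where
  "low_path e = (if fst e = snd e then down (fst e) else down (fst e) +++ low e)"

definition high_path :: "'a \<times> 'a \<Rightarrow> real \<Rightarrow> complex" where
  "high_path e = (if fst e = snd e then up (fst e) else up (snd e) +++ high e)"

text \<open>For \<open>z\<close> off the walk from \<open>s\<close> through \<open>e\<close> to
  \<open>t\<close> this is its winding number; splitting it at \<open>mid e\<close> allows its lower
  and its upper part to be replaced separately.\<close>

definition wind :: "'a \<times> 'a \<Rightarrow> complex \<Rightarrow> complex" where
  "wind e z = winding_number (low_path e) z - winding_number (high_path e) z"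

text \<open>Grouped by pairs, this is the coboundary of the antisymmetric function
  \<open>wind a (mid b) - wind b (mid a)\<close>. Hence rotation, change of sign and the cocycle
  identity hold for arbitrary arguments, without any geometry.\<close>

definition chi :: "'a \<times> 'a \<Rightarrow> 'a \<times> 'a \<Rightarrow> 'a \<times> 'a \<Rightarrow> complex" where
  "chi a b c = (wind a (mid c) - wind b (mid c)) + (wind b (mid a) - wind c (mid a)) + (wind c (mid b) - wind a (mid b))"

lemma chi_rotate: "chi a b c = chi b c a" and chi_swap: "chi a b c = - chi b a c"
  unfolding chi_def by algebra+

lemma chi_cocycle: "chi b c d - chi a c d + chi a b d - chi a b c = 0"
  unfolding chi_def by algebra

lemma low_path_edge:
  assumes "e \<in> D"
  shows "path (low_path e)" "pathstart (low_path e) = p s" "pathfinish (low_path e) = mid e"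
    "path_image (low_path e) \<subseteq> K {w \<in> S. y w \<le> y (fst e)} \<union> path_image (low e)"
proof -
  have b: "low_path e = down (fst e) +++ low e" using D_edge(5)[OF assms] by (simp add: low_path_def)
  note d = down[OF D_edge(1)[OF assms]]
  note h = halves[OF assms]
  show "path (low_path e)" unfolding b using d h by (intro path_join_imp) (auto dest: arc_imp_path)
  show "pathstart (low_path e) = p s" "pathfinish (low_path e) = mid e" unfolding b using d h by auto
  show "path_image (low_path e) \<subseteq> K {w \<in> S. y w \<le> y (fst e)} \<union> path_image (low e)"
    unfolding b using d h by (subst path_image_join) auto
qed

lemma high_path_edge:
  assumes "e \<in> D"
  shows "path (high_path e)" "pathstart (high_path e) = p t" "pathfinish (high_path e) = mid e"
    "path_image (high_path e) \<subseteq> K {w \<in> S. y (snd e) \<le> y w} \<union> path_image (high e)"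
proof -
  have b: "high_path e = up (snd e) +++ high e" using D_edge(5)[OF assms] by (simp add: high_path_def)
  note d = up[OF D_edge(2)[OF assms]]
  note h = halves[OF assms]
  show "path (high_path e)" unfolding b using d h by (intro path_join_imp) (auto dest: arc_imp_path)
  show "pathstart (high_path e) = p t" "pathfinish (high_path e) = mid e" unfolding b using d h by auto
  show "path_image (high_path e) \<subseteq> K {w \<in> S. y (snd e) \<le> y w} \<union> path_image (high e)"
    unfolding b using d h by (subst path_image_join) auto
qed

lemma high_avoids_K: "e \<in> D \<Longrightarrow> X \<subseteq> S \<Longrightarrow> snd e \<notin> X \<Longrightarrow> path_image (high e) \<inter> K X = {}"
  using high_K[of e X] by blast

lemma low_avoids_K: "e \<in> D \<Longrightarrow> X \<subseteq> S \<Longrightarrow> fst e \<notin> X \<Longrightarrow> path_image (low e) \<inter> K X = {}"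
  using low_K[of e X] by blast

lemma high_high: "e \<in> D \<Longrightarrow> e' \<in> D \<Longrightarrow> e \<noteq> e' \<Longrightarrow> snd e \<noteq> snd e' \<Longrightarrow> path_image (high e) \<inter> path_image (high e') = {}"
  using half_meet(3)[of e e'] by blast

lemma low_low: "e \<in> D \<Longrightarrow> e' \<in> D \<Longrightarrow> e \<noteq> e' \<Longrightarrow> fst e \<noteq> fst e' \<Longrightarrow> path_image (low e) \<inter> path_image (low e') = {}"
  using half_meet(1)[of e e'] by blast

lemma low_high: "e \<in> D \<Longrightarrow> e' \<in> D \<Longrightarrow> e \<noteq> e' \<Longrightarrow> fst e \<noteq> snd e' \<Longrightarrow> path_image (low e) \<inter> path_image (high e') = {}"
  using half_meet(2)[of e e'] by blast

text \<open>Supplies the connected sets along which winding numbers are transported: it joins two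
  midpoints on the upper side, away from the lower reference paths of other edges.\<close>

lemma connected_upper_fork:
  assumes "e \<in> D" "e' \<in> D" "snd e \<in> U" "snd e' \<in> U" "path_connected (K U)"
  shows "connected (path_image (high e) \<union> K U \<union> path_image (high e'))"
proof -
  have c: "connected (path_image (high e))" "connected (path_image (high e'))" "connected (K U)"
    using assms(5) halves(2)[OF assms(1)] halves(2)[OF assms(2)]
    by (simp_all add: connected_path_image arc_imp_path path_connected_imp_connected)
  have "path_image (high e) \<inter> K U \<noteq> {}" using assms ends_in_halves(2)[OF assms(1)] vertex_in_K[OF assms(3)] by blast
  then have "connected (path_image (high e) \<union> K U)" by (rule connected_Un[OF c(1,3)])
  moreover have "(path_image (high e) \<union> K U) \<inter> path_image (high e') \<noteq> {}"
    using assms ends_in_halves(2)[OF assms(2)] vertex_in_K[OF assms(4)] by blast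
  ultimately show ?thesis by (rule connected_Un[OF _ c(2)])
qed

lemma connected_lower_fork:
  assumes "e \<in> D" "e' \<in> D" "fst e \<in> L" "fst e' \<in> L" "path_connected (K L)"
  shows "connected (path_image (low e) \<union> K L \<union> path_image (low e'))"
proof -
  have c: "connected (path_image (low e))" "connected (path_image (low e'))" "connected (K L)"
    using assms(5) halves(1)[OF assms(1)] halves(1)[OF assms(2)]
    by (simp_all add: connected_path_image arc_imp_path path_connected_imp_connected)
  have "path_image (low e) \<inter> K L \<noteq> {}" using assms ends_in_halves(1)[OF assms(1)] vertex_in_K[OF assms(3)] by blast
  then have "connected (path_image (low e) \<union> K L)" by (rule connected_Un[OF c(1,3)])
  moreover have "(path_image (low e) \<union> K L) \<inter> path_image (low e') \<noteq> {}"
    using assms ends_in_halves(1)[OF assms(2)] vertex_in_K[OF assms(4)] by blast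
  ultimately show ?thesis by (rule connected_Un[OF _ c(2)])
qed

text \<open>If \<open>a\<close> ends in \<open>v\<close>, the upper reference path of
  \<open>a\<close> begins with that of \<open>v\<close>, which cancels. What remains are two paths
  from \<open>s\<close> to \<open>p v\<close> in the part up to height \<open>y v\<close>, while the
  midpoints of \<open>c\<close> and \<open>d\<close> are joined through the part above. If
  \<open>a\<close> starts in \<open>v\<close>, the argument is mirrored.\<close>

lemma wind_incident:
  assumes v: "v \<in> S" and a: "a \<in> D" "fst a = v \<or> snd a = v"
    and c: "c \<in> D" "y (fst c) < y v" "y v < y (snd c)" and d: "d \<in> D" "y (fst d) < y v" "y v < y (snd d)"
  shows "wind a (mid c) - wind (v, v) (mid c) = wind a (mid d) - wind (v, v) (mid d)"
  using a(2)
proof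
  assume av: "snd a = v"
  define X where "X = {w \<in> S. y w \<le> y v}"
  define U where "U = {w \<in> S. y v < y w}"
  have U: "snd c \<in> U" "snd d \<in> U" "U \<subseteq> S" "X \<subseteq> S" "X \<inter> U = {}" "snd c \<notin> X" "snd d \<notin> X" "fst a \<in> X" "snd a \<in> X"
    using c d v av D_edge[OF c(1)] D_edge[OF d(1)] D_edge[OF a(1)] by (auto simp: U_def X_def)
  have pcU: "path_connected (K U)" using U by (intro path_connected_upper) (auto simp: U_def)
  define T where "T = path_image (high c) \<union> K U \<union> path_image (high d)"
  have TX: "T \<inter> K X = {}"
    using high_avoids_K[OF c(1) U(4,6)] high_avoids_K[OF d(1) U(4,7)] K_disjoint[OF U(4,3,5)] unfolding T_def by blast
  have imX: "edge_im a \<subseteq> K X" using a U unfolding K_def by blast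
  have botX: "path_image (low_path a) \<subseteq> K X"
    using low_path_edge(4)[OF a(1)] half_subset(1)[OF a(1)] imX K_mono[of "{w \<in> S. y w \<le> y (fst a)}" X] U(8) unfolding X_def by fastforce
  have hiX: "path_image (high a) \<subseteq> K X" using half_subset(2)[OF a(1)] imX by blast
  have downX: "path_image (down v) \<subseteq> K X" using down(4)[OF v] by (simp add: X_def)
  let ?P = "low_path a +++ reversepath (high a)"
  note h = halves[OF a(1)]
  have P: "path ?P" "pathstart ?P = p s" "pathfinish ?P = p v" "path_image ?P \<subseteq> K X"
    using low_path_edge[OF a(1)] h botX hiX av by (auto simp: path_image_join arc_imp_path)
  \<comment> \<open>Here \<open>up v\<close> drops out: it is the whole upper path of
    \<open>(v, v)\<close> and the first part of that of \<open>a\<close>.\<close>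
  have eq: "wind a z - wind (v, v) z = winding_number ?P z - winding_number (down v) z"
    if z: "z \<in> T" "z \<notin> K {w \<in> S. y v \<le> y w}" for z
  proof -
    have n: "z \<notin> K X" using z TX by blast
    then have n': "z \<notin> path_image (low_path a)" "z \<notin> path_image (high a)" "z \<notin> path_image (up v)"
      using botX hiX up(4)[OF v] z by blast+
    have "high_path a = up v +++ high a" using D_edge(5)[OF a(1)] av by (simp add: high_path_def)
    then have "winding_number (high_path a) z = winding_number (up v) z + winding_number (high a) z"
      using n' up[OF v] h av by (simp add: winding_number_join arc_imp_path)
    moreover have "winding_number ?P z = winding_number (low_path a) z - winding_number (high a) z"
      using n' h low_path_edge[OF a(1)] by (simp add: winding_number_loop arc_imp_path)
    ultimately show ?thesis by (simp add: wind_def low_path_def[of "(v, v)"] high_path_def[of "(v, v)"])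
  qed
  have m: "mid c \<in> T" "mid d \<in> T" using ends_in_halves(4) c d by (auto simp: T_def)
  have "winding_number ?P (mid c) - winding_number (down v) (mid c) = winding_number ?P (mid d) - winding_number (down v) (mid d)"
    using P down[OF v] downX TX m connected_upper_fork[OF c(1) d(1) U(1,2) pcU]
    by (intro winding_diff_connected[where T=T]) (auto simp: T_def)
  moreover have "mid c \<notin> K {w \<in> S. y v \<le> y w}" "mid d \<notin> K {w \<in> S. y v \<le> y w}"
    using mid_notin_K[OF c(1), of "{w \<in> S. y v \<le> y w}"] mid_notin_K[OF d(1), of "{w \<in> S. y v \<le> y w}"] c(2) d(2) by auto
  ultimately show ?thesis using eq m by simp
next
  assume av: "fst a = v"
  define X where "X = {w \<in> S. y v \<le> y w}"
  define L where "L = {w \<in> S. y w < y v}"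
  have U: "fst c \<in> L" "fst d \<in> L" "L \<subseteq> S" "X \<subseteq> S" "X \<inter> L = {}" "fst c \<notin> X" "fst d \<notin> X" "fst a \<in> X" "snd a \<in> X"
    using c d v av D_edge[OF c(1)] D_edge[OF d(1)] D_edge[OF a(1)] by (auto simp: L_def X_def)
  have pcL: "path_connected (K L)" using U by (intro path_connected_lower) (auto simp: L_def)
  define T where "T = path_image (low c) \<union> K L \<union> path_image (low d)"
  have TX: "T \<inter> K X = {}"
    using low_avoids_K[OF c(1) U(4,6)] low_avoids_K[OF d(1) U(4,7)] K_disjoint[OF U(4,3,5)] unfolding T_def by blast
  have imX: "edge_im a \<subseteq> K X" using a U unfolding K_def by blast
  have topX: "path_image (high_path a) \<subseteq> K X"
    using high_path_edge(4)[OF a(1)] half_subset(2)[OF a(1)] imX K_mono[of "{w \<in> S. y (snd a) \<le> y w}" X] U(9) unfolding X_def by fastforce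
  have loX: "path_image (low a) \<subseteq> K X" using half_subset(1)[OF a(1)] imX by blast
  have upX: "path_image (up v) \<subseteq> K X" using up(4)[OF v] by (simp add: X_def)
  let ?P = "high_path a +++ reversepath (low a)"
  note h = halves[OF a(1)]
  have P: "path ?P" "pathstart ?P = p t" "pathfinish ?P = p v" "path_image ?P \<subseteq> K X"
    using high_path_edge[OF a(1)] h topX loX av by (auto simp: path_image_join arc_imp_path)
  have eq: "wind a z - wind (v, v) z = winding_number (up v) z - winding_number ?P z"
    if z: "z \<in> T" "z \<notin> K {w \<in> S. y w \<le> y v}" for z
  proof -
    have n: "z \<notin> K X" using z TX by blast
    then have n': "z \<notin> path_image (high_path a)" "z \<notin> path_image (low a)" "z \<notin> path_image (down v)"
      using topX loX down(4)[OF v] z by blast+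
    have "low_path a = down v +++ low a" using D_edge(5)[OF a(1)] av by (simp add: low_path_def)
    then have "winding_number (low_path a) z = winding_number (down v) z + winding_number (low a) z"
      using n' down[OF v] h av by (simp add: winding_number_join arc_imp_path)
    moreover have "winding_number ?P z = winding_number (high_path a) z - winding_number (low a) z"
      using n' h high_path_edge[OF a(1)] by (simp add: winding_number_loop arc_imp_path)
    ultimately show ?thesis by (simp add: wind_def low_path_def[of "(v, v)"] high_path_def[of "(v, v)"])
  qed
  have m: "mid c \<in> T" "mid d \<in> T" using ends_in_halves(3) c d by (auto simp: T_def)
  have "winding_number (up v) (mid c) - winding_number ?P (mid c) = winding_number (up v) (mid d) - winding_number ?P (mid d)"
    using P up[OF v] upX TX m connected_lower_fork[OF c(1) d(1) U(1,2) pcL]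
    by (intro winding_diff_connected[where T=T]) (auto simp: T_def)
  moreover have "mid c \<notin> K {w \<in> S. y w \<le> y v}" "mid d \<notin> K {w \<in> S. y w \<le> y v}"
    using mid_notin_K[OF c(1), of "{w \<in> S. y w \<le> y v}"] mid_notin_K[OF d(1), of "{w \<in> S. y w \<le> y v}"] c(3) d(3) by auto
  ultimately show ?thesis using eq m by simp
qed

text \<open>The point of evaluation slides from the midpoint of \<open>a\<close> to \<open>v\<close>
  along a half of \<open>a\<close>, which meets neither of the two walks from \<open>s\<close> to
  \<open>t\<close>.\<close>

lemma wind_passing:
  assumes v: "v \<in> S" and a: "a \<in> D" "fst a = v \<or> snd a = v"
    and c: "c \<in> D" "y (fst c) < y v" "y v < y (snd c)" and d: "d \<in> D" "y (fst d) < y v" "y v < y (snd d)"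
  shows "wind c (mid a) - wind d (mid a) = wind c (p v) - wind d (p v)"
proof -
  define H where "H = (if fst a = v then path_image (low a) else path_image (high a))"
  have H: "connected H" "mid a \<in> H" "p v \<in> H"
    using halves(1,2)[OF a(1)] ends_in_halves[OF a(1)] a(2) unfolding H_def
    by (auto intro: connected_path_image arc_imp_path)
  have avoid: "H \<inter> (path_image (low_path c) \<union> path_image (high_path c)) = {}"
    if c: "c \<in> D" "y (fst c) < y v" "y v < y (snd c)" for c
  proof -
    have ac: "a \<noteq> c" using a(2) c by auto
    define X where "X = {w \<in> S. y w \<le> y (fst c)}"
    define Y where "Y = {w \<in> S. y (snd c) \<le> y w}"
    have XY: "X \<subseteq> S" "Y \<subseteq> S" "v \<notin> X" "v \<notin> Y" using c by (auto simp: X_def Y_def)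
    have "H \<inter> K X = {}" "H \<inter> K Y = {}"
      using low_avoids_K[OF a(1) XY(1)] low_avoids_K[OF a(1) XY(2)] high_avoids_K[OF a(1) XY(1)] high_avoids_K[OF a(1) XY(2)]
        a(2) XY by (auto simp: H_def)
    moreover have "fst c \<noteq> v" "snd c \<noteq> v" using c(2,3) by auto
    then have "H \<inter> path_image (low c) = {}" "H \<inter> path_image (high c) = {}"
      using low_low[OF a(1) c(1) ac] low_high[OF a(1) c(1) ac] low_high[OF c(1) a(1) ac[symmetric]] high_high[OF a(1) c(1) ac] a(2)
      unfolding H_def by (cases "fst a = v"; simp add: Int_commute)+
    ultimately show ?thesis using low_path_edge(4)[OF c(1)] high_path_edge(4)[OF c(1)] unfolding X_def Y_def by blast
  qed
  let ?P = "\<lambda>c. low_path c +++ reversepath (high_path c)"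
  have P: "path (?P c)" "pathstart (?P c) = p s" "pathfinish (?P c) = p t"
    "path_image (?P c) = path_image (low_path c) \<union> path_image (high_path c)" if "c \<in> D" for c
    using low_path_edge[OF that] high_path_edge[OF that] by (auto simp: path_image_join)
  have wind: "wind c z = winding_number (?P c) z" if "z \<in> H" "c \<in> D" "H \<inter> (path_image (low_path c) \<union> path_image (high_path c)) = {}" for c z
    using that low_path_edge[OF that(2)] high_path_edge[OF that(2)] unfolding wind_def by (subst winding_number_loop) auto
  have "winding_number (?P c) (mid a) - winding_number (?P d) (mid a) = winding_number (?P c) (p v) - winding_number (?P d) (p v)"
    using P[OF c(1)] P[OF d(1)] H avoid[OF c] avoid[OF d] by (intro winding_diff_connected[where T=H]) auto
  then show ?thesis using wind H c d avoid[OF c] avoid[OF d] by simp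
qed

text \<open>One lemma moves the walk of \<open>a\<close> to \<open>v\<close>, the other moves the
  point \<open>mid a\<close>. Consequently all edges at \<open>v\<close> have the same sign relative
  to two edges passing \<open>v\<close>.\<close>

lemma chi_incident:
  assumes v: "v \<in> S" and a: "a \<in> D" "fst a = v \<or> snd a = v"
    and c: "c \<in> D" "y (fst c) < y v" "y v < y (snd c)" and d: "d \<in> D" "y (fst d) < y v" "y v < y (snd d)"
  shows "chi a c d = chi (v, v) c d"
  using wind_incident[OF assms] wind_passing[OF assms] unfolding chi_def by (simp add: mid_def[of "(v, v)"]) algebra

text \<open>A tripod in the lower piece and one in the upper piece, glued at the three midpoints,
  form a theta graph, whose sign is 1 or -1. Replacing the arcs of the tripods by the chosen
  reference paths does not change the sum, below and above separately.\<close>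

lemma chi_sign:
  assumes a: "a \<in> D" "y (fst a) \<le> h" "h < y (snd a)" and b: "b \<in> D" "y (fst b) \<le> h" "h < y (snd b)"
    and c: "c \<in> D" "y (fst c) \<le> h" "h < y (snd c)" and ne: "a \<noteq> b" "b \<noteq> c" "c \<noteq> a"
  shows "chi a b c \<in> {1, -1}"
proof -
  let ?w = winding_number
  define L where "L = {w \<in> S. y w \<le> h}"
  define U where "U = {w \<in> S. h < y w}"
  have LU: "L \<subseteq> S" "U \<subseteq> S" "L \<inter> U = {}" by (auto simp: L_def U_def)
  have cr: "fst e \<in> L \<and> snd e \<in> U \<and> fst e \<notin> U \<and> snd e \<notin> L" if "e \<in> {a, b, c}" for e
    using that a b c D_edge[of e] by (auto simp: L_def U_def)
  have inD: "e \<in> D" if "e \<in> {a, b, c}" for e using that a b c by auto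
  have pcL: "path_connected (K L)" using cr[of a] by (intro path_connected_lower) (auto simp: L_def)
  have pcU: "path_connected (K U)" using cr[of a] by (intro path_connected_upper) (auto simp: U_def)
  have KLU: "K L \<inter> K U = {}" by (rule K_disjoint[OF LU])
  have loL: "path_image (low e) \<inter> K L = {pathstart (low e)}" if e: "e \<in> {a, b, c}" for e
  proof -
    have "p (fst e) \<in> path_image (low e) \<inter> K L" using ends_in_halves(1)[OF inD[OF e]] vertex_in_K[of "fst e" L] cr[OF e] by blast
    moreover have "q = p (fst e)" if "q \<in> path_image (low e)" "q \<in> K L" for q
      using low_K[OF inD[OF e] LU(1) _ that] cr[OF e] by blast
    ultimately show ?thesis unfolding halves(3)[OF inD[OF e]] by blast
  qed
  have hiU: "path_image (high e) \<inter> K U = {pathstart (high e)}" if e: "e \<in> {a, b, c}" for e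
  proof -
    have "p (snd e) \<in> path_image (high e) \<inter> K U" using ends_in_halves(2)[OF inD[OF e]] vertex_in_K[of "snd e" U] cr[OF e] by blast
    moreover have "q = p (snd e)" if "q \<in> path_image (high e)" "q \<in> K U" for q
      using high_K[OF inD[OF e] LU(2) _ that] cr[OF e] by blast
    ultimately show ?thesis unfolding halves(4)[OF inD[OF e]] by blast
  qed
  have loU: "path_image (low e) \<inter> K U = {}" if e: "e \<in> {a, b, c}" for e
    using low_avoids_K[OF inD[OF e] LU(2)] cr[OF e] by blast
  have hiL: "path_image (high e) \<inter> K L = {}" if e: "e \<in> {a, b, c}" for e
    using high_avoids_K[OF inD[OF e] LU(1)] cr[OF e] by blast
  have ll: "path_image (low e) \<inter> path_image (low e') \<subseteq> K L" if e: "e \<in> {a, b, c}" "e' \<in> {a, b, c}" "e \<noteq> e'" for e e'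
    using half_meet(1)[OF inD[OF e(1)] inD[OF e(2)] e(3)] vertex_in_K[of "fst e" L] cr[OF e(1)] by blast
  have hh: "path_image (high e) \<inter> path_image (high e') \<subseteq> K U" if e: "e \<in> {a, b, c}" "e' \<in> {a, b, c}" "e \<noteq> e'" for e e'
    using half_meet(3)[OF inD[OF e(1)] inD[OF e(2)] e(3)] vertex_in_K[of "snd e" U] cr[OF e(1)] by blast
  have lh: "path_image (low e) \<inter> path_image (high e') = {}" if e: "e \<in> {a, b, c}" "e' \<in> {a, b, c}" "e \<noteq> e'" for e e'
    using low_high[OF inD[OF e(1)] inD[OF e(2)] e(3)] cr[OF e(1)] cr[OF e(2)] by metis
  have abc: "a \<in> {a, b, c}" "b \<in> {a, b, c}" "c \<in> {a, b, c}" by auto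
  note ha = halves[OF a(1)] and hb = halves[OF b(1)] and hc = halves[OF c(1)]
  obtain q A B C where q: "q \<in> K L" and ABC: "arc A" "arc B" "arc C"
    "pathstart A = q" "pathstart B = q" "pathstart C = q"
    "pathfinish A = mid a" "pathfinish B = mid b" "pathfinish C = mid c"
    "path_image A \<subseteq> K L \<union> path_image (low a)" "path_image B \<subseteq> K L \<union> path_image (low b)" "path_image C \<subseteq> K L \<union> path_image (low c)"
    "path_image A \<inter> path_image B = {q}" "path_image B \<inter> path_image C = {q}" "path_image C \<inter> path_image A = {q}"
    using tripod[OF pcL ha(1) hb(1) hc(1) loL[OF abc(1)] loL[OF abc(2)] loL[OF abc(3)]
      ll[OF abc(1,2) ne(1)] ll[OF abc(2,3) ne(2)] ll[OF abc(3,1) ne(3)]] unfolding ha(5) hb(5) hc(5) by metis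
  obtain q' A' B' C' where q': "q' \<in> K U" and ABC': "arc A'" "arc B'" "arc C'"
    "pathstart A' = q'" "pathstart B' = q'" "pathstart C' = q'"
    "pathfinish A' = mid a" "pathfinish B' = mid b" "pathfinish C' = mid c"
    "path_image A' \<subseteq> K U \<union> path_image (high a)" "path_image B' \<subseteq> K U \<union> path_image (high b)" "path_image C' \<subseteq> K U \<union> path_image (high c)"
    "path_image A' \<inter> path_image B' = {q'}" "path_image B' \<inter> path_image C' = {q'}" "path_image C' \<inter> path_image A' = {q'}"
    using tripod[OF pcU ha(2) hb(2) hc(2) hiU[OF abc(1)] hiU[OF abc(2)] hiU[OF abc(3)]
      hh[OF abc(1,2) ne(1)] hh[OF abc(2,3) ne(2)] hh[OF abc(3,1) ne(3)]] unfolding ha(6) hb(6) hc(6) by metis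
  have midL: "mid e \<notin> K L" "mid e \<notin> K U" if e: "e \<in> {a, b, c}" for e
    using mid_notin_K[OF inD[OF e] LU(1)] mid_notin_K[OF inD[OF e] LU(2)] cr[OF e] by blast+
  have join: "arc (P +++ reversepath P')" "path_image (P +++ reversepath P') = path_image P \<union> path_image P'"
    "path_image P \<inter> path_image P' = {mid e}"
    if e: "e \<in> {a, b, c}" and P: "arc P" "pathfinish P = mid e" "path_image P \<subseteq> K L \<union> path_image (low e)"
      "arc P'" "pathfinish P' = mid e" "path_image P' \<subseteq> K U \<union> path_image (high e)" for e P P'
  proof -
    have "path_image P \<inter> path_image P' \<subseteq> {mid e}"
      using P(3,6) KLU loU[OF e] hiL[OF e] halves(8)[OF inD[OF e]] by blast
    moreover have "mid e \<in> path_image P" "mid e \<in> path_image P'" using P by (metis pathfinish_in_path_image)+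
    ultimately show "path_image P \<inter> path_image P' = {mid e}" by blast
    then show "arc (P +++ reversepath P')" "path_image (P +++ reversepath P') = path_image P \<union> path_image P'"
      using P by (auto intro!: arc_join simp: arc_reversepath path_image_join)
  qed
  note jA = join[OF abc(1) ABC(1,7,10) ABC'(1,7,10)]
  note jB = join[OF abc(2) ABC(2,8,11) ABC'(2,8,11)]
  note jC = join[OF abc(3) ABC(3,9,12) ABC'(3,9,12)]
  have cross: "path_image P \<inter> path_image P' = {}"
    if e: "e \<in> {a, b, c}" "e' \<in> {a, b, c}" "e \<noteq> e'" and P: "path_image P \<subseteq> K L \<union> path_image (low e)"
      "path_image P' \<subseteq> K U \<union> path_image (high e')" for e e' and P P' :: "real \<Rightarrow> complex"
    using P KLU loU[OF e(1)] hiL[OF e(2)] lh[OF e] by blast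
  let ?A = "A +++ reversepath A'" and ?B = "B +++ reversepath B'" and ?C = "C +++ reversepath C'"
  have IAB: "path_image ?A \<inter> path_image ?B = {q, q'}"
    unfolding jA(2) jB(2) using cross[OF abc(1,2) ne(1) ABC(10) ABC'(11)] cross[OF abc(2,1) ne(1)[symmetric] ABC(11) ABC'(10)]
      ABC(13) ABC'(13) by blast
  have IBC: "path_image ?B \<inter> path_image ?C = {q, q'}"
    unfolding jB(2) jC(2) using cross[OF abc(2,3) ne(2) ABC(11) ABC'(12)] cross[OF abc(3,2) ne(2)[symmetric] ABC(12) ABC'(11)]
      ABC(14) ABC'(14) by blast
  have ICA: "path_image ?C \<inter> path_image ?A = {q, q'}"
    unfolding jC(2) jA(2) using cross[OF abc(3,1) ne(3) ABC(12) ABC'(10)] cross[OF abc(1,3) ne(3)[symmetric] ABC(10) ABC'(12)]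
      ABC(15) ABC'(15) by blast
  have nq: "mid e \<noteq> q \<and> mid e \<noteq> q'" if "e \<in> {a, b, c}" for e using midL[OF that] q q' by blast
  have mA: "mid a \<in> path_image ?A - {q, q'}" using jA nq[OF abc(1)] by blast
  have mB: "mid b \<in> path_image ?B - {q, q'}" using jB nq[OF abc(2)] by blast
  have mC: "mid c \<in> path_image ?C - {q, q'}" using jC nq[OF abc(3)] by blast
  have st: "pathstart ?A = q" "pathstart ?B = q" "pathstart ?C = q" "pathfinish ?A = q'" "pathfinish ?B = q'" "pathfinish ?C = q'"
    using ABC ABC' by auto
  have theta: "(?w ?A (mid c) - ?w ?B (mid c)) + (?w ?B (mid a) - ?w ?C (mid a))
    + (?w ?C (mid b) - ?w ?A (mid b)) \<in> {1, -1}"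
    by (rule theta_winding[OF jA(1) jB(1) jC(1) st IAB IBC ICA mA mB mC])
  have split: "?w ?A z = ?w A z - ?w A' z" if "z = mid b \<or> z = mid c" for z
    using that ABC ABC' mB mC IAB ICA jA(2) by (intro winding_number_loop) (auto simp: arc_imp_path)
  have split2: "?w ?B z = ?w B z - ?w B' z" if "z = mid a \<or> z = mid c" for z
    using that ABC ABC' mA mC IAB IBC jB(2) by (intro winding_number_loop) (auto simp: arc_imp_path)
  have split3: "?w ?C z = ?w C z - ?w C' z" if "z = mid a \<or> z = mid b" for z
    using that ABC ABC' mA mB IBC ICA jC(2) by (intro winding_number_loop) (auto simp: arc_imp_path)
  have botL: "path_image (low_path e) \<subseteq> K L \<union> path_image (low e)" if e: "e \<in> {a, b, c}" for e
  proof -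
    have "{w \<in> S. y w \<le> y (fst e)} \<subseteq> L" using cr[OF e] by (auto simp: L_def)
    then show ?thesis using low_path_edge(4)[OF inD[OF e]] K_mono by blast
  qed
  have topU: "path_image (high_path e) \<subseteq> K U \<union> path_image (high e)" if e: "e \<in> {a, b, c}" for e
  proof -
    have "{w \<in> S. y (snd e) \<le> y w} \<subseteq> U" using cr[OF e] by (auto simp: U_def)
    then show ?thesis using high_path_edge(4)[OF inD[OF e]] K_mono by blast
  qed
  \<comment> \<open>\<open>R\<close> and \<open>R'\<close> connect the ends of the chosen reference
    paths with the branch points of the tripods inside the respective pieces.\<close>
  have "s \<in> L" using s_min[of "fst a"] D_edge[OF a(1)] a(2) sS by (auto simp: L_def)
  then obtain R where R: "path R" "path_image R \<subseteq> K L" "pathstart R = p s" "pathfinish R = q"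
    using pcL[unfolded path_connected_def, rule_format, OF vertex_in_K q] by blast
  have "t \<in> U" using t_max[of "snd a"] D_edge[OF a(1)] a(3) tS by (auto simp: U_def)
  then obtain R' where R': "path R'" "path_image R' \<subseteq> K U" "pathstart R' = p t" "pathfinish R' = q'"
    using pcU[unfolded path_connected_def, rule_format, OF vertex_in_K q'] by blast
  \<comment> \<open>When the lower path of one edge is exchanged, the midpoints of the other two are
    joined on the upper side by \<open>TU\<close>; for upper paths the roles are reversed.\<close>
  define TU where "TU e e' = path_image (high e) \<union> K U \<union> path_image (high e')" for e e'
  define TL where "TL e e' = path_image (low e) \<union> K L \<union> path_image (low e')" for e e'
  have TU: "connected (TU e e')" "mid e \<in> TU e e'" "mid e' \<in> TU e e'"
    "TU e e' \<inter> (path_image (low_path f) \<union> path_image P \<union> path_image R) = {}"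
    if e: "e \<in> {a, b, c}" "e' \<in> {a, b, c}" "f \<in> {a, b, c}" "f \<noteq> e" "f \<noteq> e'" and P: "path_image P \<subseteq> K L \<union> path_image (low f)"
    for e e' f P
  proof -
    show "connected (TU e e')" unfolding TU_def using cr e by (intro connected_upper_fork inD pcU) auto
    show "mid e \<in> TU e e'" "mid e' \<in> TU e e'" using ends_in_halves(4) inD e unfolding TU_def by blast+
    have "TU e e' \<inter> (K L \<union> path_image (low f)) = {}"
      using lh[OF e(3,1,4)] lh[OF e(3,2,5)] hiL[OF e(1)] hiL[OF e(2)] loU[OF e(3)] KLU unfolding TU_def by blast
    then show "TU e e' \<inter> (path_image (low_path f) \<union> path_image P \<union> path_image R) = {}"
      using botL[OF e(3)] P R(2) by blast
  qed
  have TL: "connected (TL e e')" "mid e \<in> TL e e'" "mid e' \<in> TL e e'"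
    "TL e e' \<inter> (path_image (high_path f) \<union> path_image P \<union> path_image R') = {}"
    if e: "e \<in> {a, b, c}" "e' \<in> {a, b, c}" "f \<in> {a, b, c}" "f \<noteq> e" "f \<noteq> e'" and P: "path_image P \<subseteq> K U \<union> path_image (high f)"
    for e e' f P
  proof -
    show "connected (TL e e')" unfolding TL_def using cr e by (intro connected_lower_fork inD pcL) auto
    show "mid e \<in> TL e e'" "mid e' \<in> TL e e'" using ends_in_halves(3) inD e unfolding TL_def by blast+
    have "TL e e' \<inter> (K U \<union> path_image (high f)) = {}"
      using lh[OF e(1,3) e(4)[symmetric]] lh[OF e(2,3) e(5)[symmetric]] loU[OF e(1)] loU[OF e(2)] hiL[OF e(3)] KLU unfolding TL_def by blast
    then show "TL e e' \<inter> (path_image (high_path f) \<union> path_image P \<union> path_image R') = {}"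
      using topU[OF e(3)] P R'(2) by blast
  qed
  note ba = low_path_edge[OF a(1)] and bb = low_path_edge[OF b(1)] and bc = low_path_edge[OF c(1)]
  note ta = high_path_edge[OF a(1)] and tb = high_path_edge[OF b(1)] and tc = high_path_edge[OF c(1)]
  note Ua = TU[OF abc(2,3,1) ne(1) ne(3)[symmetric] ABC(10)]
  note Ub = TU[OF abc(3,1,2) ne(2) ne(1)[symmetric] ABC(11)]
  note Uc = TU[OF abc(1,2,3) ne(3) ne(2)[symmetric] ABC(12)]
  note La = TL[OF abc(2,3,1) ne(1) ne(3)[symmetric] ABC'(10)]
  note Lb = TL[OF abc(3,1,2) ne(2) ne(1)[symmetric] ABC'(11)]
  note Lc = TL[OF abc(1,2,3) ne(3) ne(2)[symmetric] ABC'(12)]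
  have sysL: "(?w (low_path a) (mid c) - ?w (low_path b) (mid c)) + (?w (low_path b) (mid a) - ?w (low_path c) (mid a))
      + (?w (low_path c) (mid b) - ?w (low_path a) (mid b)) =
    (?w A (mid c) - ?w B (mid c)) + (?w B (mid a) - ?w C (mid a))
      + (?w C (mid b) - ?w A (mid b))"
    by (rule winding_system[OF ba(1) bb(1) bc(1) ba(2) bb(2) bc(2) ABC(1-3)[THEN arc_imp_path] ABC(4-6) _ _ _ R(1,3,4)
          Ua(1) Ub(1) Uc(1) Ua(4) Ub(4) Uc(4) Ua(2,3) Ub(2,3) Uc(2,3)]) (simp_all add: ba bb bc ABC)
  have sysU: "(?w (high_path a) (mid c) - ?w (high_path b) (mid c)) + (?w (high_path b) (mid a) - ?w (high_path c) (mid a))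
      + (?w (high_path c) (mid b) - ?w (high_path a) (mid b)) =
    (?w A' (mid c) - ?w B' (mid c)) + (?w B' (mid a) - ?w C' (mid a))
      + (?w C' (mid b) - ?w A' (mid b))"
    by (rule winding_system[OF ta(1) tb(1) tc(1) ta(2) tb(2) tc(2) ABC'(1-3)[THEN arc_imp_path] ABC'(4-6) _ _ _ R'(1,3,4)
          La(1) Lb(1) Lc(1) La(4) Lb(4) Lc(4) La(2,3) Lb(2,3) Lc(2,3)]) (simp_all add: ta tb tc ABC')
  have "chi a b c = (?w ?A (mid c) - ?w ?B (mid c)) + (?w ?B (mid a) - ?w ?C (mid a))
    + (?w ?C (mid b) - ?w ?A (mid b))"
    using sysL sysU unfolding chi_def wind_def by (simp add: split split2 split3) algebra
  then show ?thesis using theta by simp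
qed

lemma exists_bar_rep: "\<exists>x l r. bar_rep S E y x l r"
proof -
  have "s \<noteq> t" using est irr by metis
  then have "y s < y t" using s_min[OF tS] inj_onD[OF yinj _ sS tS] by fastforce
  define e0 where "e0 = (s, t)"
  have e0: "e0 \<in> D" using \<open>y s < y t\<close> sS tS est by (simp add: e0_def D_def)
  \<comment> \<open>The cyclic order is cut open at \<open>e0\<close>, which becomes the leftmost
    edge.\<close>
  define lt where "lt a b \<longleftrightarrow> a \<noteq> b \<and> (a = e0 \<or> b \<noteq> e0 \<and> chi e0 a b = 1)" for a b
  have e0_cross: "y (fst e0) \<le> h \<and> h < y (snd e0)" if "a \<in> D" "y (fst a) \<le> h" "h < y (snd a)" for a h
    using s_min[OF D_edge(1)[OF that(1)]] t_max[OF D_edge(2)[OF that(1)]] that by (simp add: e0_def)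
  have sign: "chi e0 a b = 1 \<or> chi e0 a b = -1"
    if "a \<in> D" "y (fst a) \<le> h" "h < y (snd a)" "b \<in> D" "y (fst b) \<le> h" "h < y (snd b)" "a \<noteq> b" "a \<noteq> e0" "b \<noteq> e0" for a b h
    using chi_sign[OF e0 _ _ that(1-6)] e0_cross[OF that(1-3)] that by auto
  have anti: "chi e0 b a = - chi e0 a b" for a b
  proof -
    have "chi e0 b a = chi b a e0" by (rule chi_rotate)
    also have "\<dots> = - chi a b e0" by (rule chi_swap)
    also have "chi a b e0 = chi e0 a b" by (rule chi_rotate[symmetric])
    finally show ?thesis .
  qed
  have tr: "lt a c"
    if a: "a \<in> D" "y (fst a) \<le> h" "h < y (snd a)" and b: "b \<in> D" "y (fst b) \<le> h" "h < y (snd b)"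
      and c: "c \<in> D" "y (fst c) \<le> h" "h < y (snd c)" and l: "lt a b" "lt b c" for a b c h
  proof (cases "a = e0")
    case True
    then show ?thesis using l by (auto simp: lt_def)
  next
    case False
    then have n: "b \<noteq> e0" "c \<noteq> e0" "a \<noteq> b" "b \<noteq> c" "chi e0 a b = 1" "chi e0 b c = 1" using l by (auto simp: lt_def)
    then have "a \<noteq> c" using anti[of a b] by auto
    have "chi a b c \<in> {1, -1}" using chi_sign[OF a b c n(3,4)] \<open>a \<noteq> c\<close> by blast
    moreover have "chi e0 a c = 1 \<or> chi e0 a c = -1" using sign[OF a c \<open>a \<noteq> c\<close> False n(2)] .
    \<comment> \<open>Both summands are 1 or -1, so the cocycle identity forces both to be
      1.\<close>
    moreover have "chi a b c + chi e0 a c = 2" using chi_cocycle[of a b c e0] n(5,6) by (simp add: algebra_simps)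
    ultimately have "chi e0 a c = 1" by auto
    then show ?thesis using \<open>a \<noteq> c\<close> n by (simp add: lt_def)
  qed
  have tot: "lt a b \<or> lt b a"
    if "a \<in> D" "y (fst a) \<le> h" "h < y (snd a)" "b \<in> D" "y (fst b) \<le> h" "h < y (snd b)" "a \<noteq> b" for a b h
    using sign[OF that] anti[of a b] that(7) by (cases "a = e0 \<or> b = e0") (auto simp: lt_def)
  have side: "(\<forall>a\<in>D. fst a = v \<or> snd a = v \<longrightarrow> lt c a) \<or> (\<forall>a\<in>D. fst a = v \<or> snd a = v \<longrightarrow> lt a c)"
    if v: "v \<in> S" and c: "c \<in> D" "y (fst c) < y v" "y v < y (snd c)" for v c
  proof (cases "c = e0")
    case True
    then show ?thesis using c by (auto simp: lt_def)
  next
    case False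
    have pass0: "y (fst e0) < y v" "y v < y (snd e0)"
      using s_min[OF D_edge(1)[OF c(1)]] t_max[OF D_edge(2)[OF c(1)]] c by (auto simp: e0_def)
    have same: "chi e0 a c = chi (v, v) c e0" if "a \<in> D" "fst a = v \<or> snd a = v" for a
      using chi_incident[OF v that c e0 pass0] trans[OF chi_rotate[of e0 a c]] by blast
    have ne: "a \<noteq> e0" "a \<noteq> c" if "fst a = v \<or> snd a = v" for a using that pass0 c by auto
    have sgn: "chi e0 a c = 1 \<or> chi e0 a c = -1" if "a \<in> D" "fst a = v \<or> snd a = v" for a
      using that(2)
    proof
      assume "fst a = v"
      then show ?thesis using sign[of a "y v" c] that c ne[OF that(2)] False D_edge(4)[OF that(1)] by auto
    next
      assume av: "snd a = v"
      \<comment> \<open>An edge ending in \<open>v\<close> no longer crosses the level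
        \<open>y v\<close>; the larger of the two lower ends gives a level below \<open>v\<close>
        that it shares with \<open>c\<close>.\<close>
      define h where "h = max (y (fst a)) (y (fst c))"
      have "y (fst a) \<le> h" "y (fst c) \<le> h" "h < y (snd a)" "h < y (snd c)"
        using av c D_edge(4)[OF that(1)] by (auto simp: h_def)
      then show ?thesis using sign[of a h c] that c ne[OF that(2)] False by auto
    qed
    show ?thesis
    proof (cases "chi (v, v) c e0 = 1")
      case True
      have "lt a c" if "a \<in> D" "fst a = v \<or> snd a = v" for a
        using same[OF that] ne[OF that(2)] True False unfolding lt_def by simp
      then show ?thesis by blast
    next
      case F: False
      have "lt c a" if "a \<in> D" "fst a = v \<or> snd a = v" for a
      proof -
        have "chi e0 a c = - 1" using sgn[OF that] same[OF that] F by simp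
        then have "chi e0 c a = 1" using anti[of a c] by simp
        then show ?thesis using ne[OF that(2)] unfolding lt_def by simp
      qed
      then show ?thesis by blast
    qed
  qed
  obtain x l r where "bar_rep S E y x l r"
  proof (rule bar_rep_of_level_orders[of E S s t y lt, folded D_def])
    show "\<not> lt e e" for e by (simp add: lt_def)
    show "lt a c" if "a \<in> {e \<in> D. y (fst e) \<le> h \<and> h < y (snd e)}" "b \<in> {e \<in> D. y (fst e) \<le> h \<and> h < y (snd e)}"
      "c \<in> {e \<in> D. y (fst e) \<le> h \<and> h < y (snd e)}" "lt a b" "lt b c" for h a b c
      using tr[of a h b c] that by simp
    show "lt a b \<or> lt b a" if "a \<in> {e \<in> D. y (fst e) \<le> h \<and> h < y (snd e)}"
      "b \<in> {e \<in> D. y (fst e) \<le> h \<and> h < y (snd e)}" "a \<noteq> b" for h a b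
      using tot[of a h b] that by simp
  qed (use sym irr fin st \<open>s \<noteq> t\<close> side in blast)+
  then show ?thesis by blast
qed

end

section \<open>Induction over the drawing and the final assembly\<close>

lemma plane_drawing_subset:
  assumes "plane_drawing S E p g" "S' \<subseteq> S"
  shows "plane_drawing S' E p g"
proof -
  interpret plane_drawing S E p g by fact
  have S: "v \<in> S" if "v \<in> S'" for v using that assms(2) by blast
  show ?thesis
  proof
    show "finite S'" using fin assms(2) finite_subset by blast
    show "inj_on p S'" using pinj assms(2) inj_on_subset by blast
    show "E v u" if "E u v" for u v using sym[OF that] .
    show "\<not> E u u" for u by (rule irr)
    show "arc (g u v) \<and> pathstart (g u v) = p u \<and> pathfinish (g u v) = p v" if "u \<in> S'" "v \<in> S'" "E u v" for u v
      using arcg[OF S[OF that(1)] S[OF that(2)] that(3)] .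
    show "w = u \<or> w = v" if "u \<in> S'" "v \<in> S'" "E u v" "w \<in> S'" "p w \<in> path_image (g u v)" for u v w
      using vert[OF S[OF that(1)] S[OF that(2)] that(3) S[OF that(4)] that(5)] .
    show "path_image (g u v) \<inter> path_image (g u' v') \<subseteq> p ` ({u, v} \<inter> {u', v'})"
      if "u \<in> S'" "v \<in> S'" "E u v" "u' \<in> S'" "v' \<in> S'" "E u' v'" "{u, v} \<noteq> {u', v'}" for u v u' v'
      using crossing[OF S[OF that(1)] S[OF that(2)] that(3) S[OF that(4)] S[OF that(5)] that(6,7)] .
  qed
qed

text \<open>The root \<open>r\<close> may be prescribed because at a cut vertex \<open>c\<close> the
  side without \<open>r\<close> has to be glued in with \<open>c\<close> at its bottom. In the last
  case every vertex deletion leaves a connected graph, and \<open>r\<close> with a neighbour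
  \<open>t\<close> gives the ends of an st-order.\<close>

lemma plane_drawing_bar_rep:
  assumes "plane_drawing S E p g" "r \<in> S"
  shows "\<exists>y x l r'. bar_rep S E y x l r' \<and> (\<forall>v\<in>S. y r \<le> y v)"
  using assms
proof (induction "card S" arbitrary: S r rule: less_induct)
  case less
  interpret plane_drawing S E p g by fact
  have IH: "\<exists>y x l r'. bar_rep S' E y x l r' \<and> (\<forall>v\<in>S'. y c \<le> y v)" if "S' \<subset> S" "c \<in> S'" for S' c
    using less.hyps[OF psubset_card_mono[OF fin that(1)] _ that(2)] plane_drawing_subset[OF less.prems(1)] that(1) by blast
  consider (iso) "\<forall>v\<in>S. \<not> E r v" | (cut) c where "c \<in> S" "\<not> connected_on E (S - {c})"
    | (two) t where "t \<in> S" "E r t" "\<And>c. c \<in> S \<Longrightarrow> connected_on E (S - {c})" by blast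
  then show ?case
  proof cases
    case iso
    show ?thesis
    proof (cases "S = {r}")
      case True
      have "bar_rep {r} E (\<lambda>_. 0) (\<lambda>_. 0) (\<lambda>_. 0) (\<lambda>_. 0)" using irr by (simp add: bar_rep_def)
      then show ?thesis unfolding True by fastforce
    next
      case False
      then obtain c where "c \<in> S - {r}" using less.prems(2) by blast
      then obtain y x l r' where R: "bar_rep (S - {r}) E y x l r'" using IH[of "S - {r}" c] less.prems(2) by blast
      obtain y' where "bar_rep (insert r (S - {r})) E y' x (l(r := 0)) (r'(r := 0))" "\<And>v. v \<in> S - {r} \<Longrightarrow> y' r < y' v"
        by (rule bar_rep_insert_isolated[of "S - {r}" r E y x l r']) (use fin R iso sym less.prems(2) in blast)+
      moreover have "insert r (S - {r}) = S" using less.prems(2) by blast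
      ultimately show ?thesis by (metis DiffI order_le_less singletonD)
    qed
  next
    case cut
    then obtain X where X: "X \<subseteq> S - {c}" "X \<noteq> {}" "X \<noteq> S - {c}" "\<And>a b. a \<in> X \<Longrightarrow> b \<in> S - {c} - X \<Longrightarrow> \<not> E a b"
      unfolding connected_on_def by blast
    \<comment> \<open>The side of the separation that contains \<open>r\<close>, if \<open>r\<close>
      is not \<open>c\<close> itself; together with \<open>c\<close> it keeps the root.\<close>
    obtain A where A: "A \<subseteq> S - {c}" "A \<noteq> {}" "A \<noteq> S - {c}" "r \<in> insert c A" "\<And>a b. a \<in> A \<Longrightarrow> b \<in> S - {c} - A \<Longrightarrow> \<not> E a b"
    proof (cases "r \<in> insert c X")
      case True
      then show ?thesis using that X by blast
    next
      case False
      show ?thesis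
        by (rule that[of "S - {c} - X"]) (use False X less.prems(2) sym in blast)+
    qed
    have sub: "insert c A \<subset> S" "S - A \<subset> S" "c \<in> S - A" using A cut(1) by blast+
    obtain y1 x1 l1 r1 where R1: "bar_rep (insert c A) E y1 x1 l1 r1" "\<forall>v\<in>insert c A. y1 r \<le> y1 v"
      using IH[OF sub(1) A(4)] by (elim exE conjE)
    obtain y2 x2 l2 r2 where R2: "bar_rep (S - A) E y2 x2 l2 r2" "\<forall>v\<in>S - A. y2 c \<le> y2 v"
      using IH[OF sub(2,3)] by (elim exE conjE)
    have f: "finite (insert c A)" "finite (S - A)" using fin A(1) finite_subset by (blast, blast)
    have i: "insert c A \<inter> (S - A) = {c}" "insert c A \<union> (S - A) = S" using A(1) cut(1) by blast+
    have no: "\<not> E u v" if "u \<in> insert c A - {c}" "v \<in> S - A - {c}" for u v using A(5) that by blast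
    obtain y x l r' where R: "bar_rep S E y x l r'" "\<And>v. v \<in> insert c A \<Longrightarrow> y v = y1 v" "\<And>v. v \<in> S - A - {c} \<Longrightarrow> y1 c < y v"
      by (rule bar_rep_merge[OF sym f i(1) no R1(1) R2(1), unfolded i(2)]) (use R2(2) in blast)+
    have "y r \<le> y v" if "v \<in> S" for v
    proof (cases "v \<in> insert c A")
      case True
      then show ?thesis using R(2) R1(2) A(4) by metis
    next
      case False
      then have "y1 c < y v" using R(3) that by blast
      moreover have "y r \<le> y1 c" using R(2) R1(2) A(4) by (metis insertI1)
      ultimately show ?thesis by simp
    qed
    then show ?thesis using R(1) by blast
  next
    case two
    \<comment> \<open>If the graph were disconnected, the side containing \<open>r\<close> would
      also contain \<open>t\<close>; deleting \<open>r\<close> would then leave both sides nonempty,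
      against the case assumption.\<close>
    have "connected_on E S"
    proof (rule ccontr)
      assume "\<not> connected_on E S"
      then obtain X where X: "X \<subseteq> S" "X \<noteq> {}" "X \<noteq> S" "\<And>a b. a \<in> X \<Longrightarrow> b \<in> S - X \<Longrightarrow> \<not> E a b"
        unfolding connected_on_def by blast
      obtain A where A: "A \<subseteq> S" "A \<noteq> S" "r \<in> A" "\<And>a b. a \<in> A \<Longrightarrow> b \<in> S - A \<Longrightarrow> \<not> E a b"
      proof (cases "r \<in> X")
        case True
        then show ?thesis using that X by blast
      next
        case False
        show ?thesis by (rule that[of "S - X"]) (use False X less.prems(2) sym in blast)+
      qed
      have "t \<in> A" "t \<noteq> r" using A two irr by blast+
      then have "A - {r} \<subseteq> S - {r}" "A - {r} \<noteq> {}" "A - {r} \<noteq> S - {r}" using A by blast+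
      then obtain a b where "a \<in> A - {r}" "b \<in> S - {r} - (A - {r})" "E a b"
        using two(3)[OF less.prems(2)] unfolding connected_on_def by metis
      then show False using A(4) by blast
    qed
    moreover have "r \<noteq> t" using two irr by blast
    ultimately obtain y where y: "st_order E S r t y"
      using st_order_exists[OF sym fin _ two(3) less.prems(2) two(1) _ two(2)] by blast
    interpret st_drawing S E p g r t y by unfold_locales (use y two(2) in auto)
    show ?thesis using exists_bar_rep s_min by blast
  qed
qed

lemma planar_imp_plane_drawing:
  assumes G: "graph V E" and "planar V E"
  obtains p g where "plane_drawing V E p g"
proof -
  obtain p :: "'a \<Rightarrow> real \<times> real" and g :: "'a \<Rightarrow> 'a \<Rightarrow> real \<Rightarrow> real \<times> real" where P: "inj_on p V \<and>
       (\<forall>u v. E u v \<longrightarrow> arc (g u v) \<and> pathstart (g u v) = p u \<and> pathfinish (g u v) = p v \<and>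
                path_image (g v u) = path_image (g u v) \<and>
                (\<forall>w\<in>V. p w \<in> path_image (g u v) \<longrightarrow> w = u \<or> w = v)) \<and>
       (\<forall>u v x y. E u v \<and> E x y \<and> {u, v} \<noteq> {x, y} \<longrightarrow>
          path_image (g u v) \<inter> path_image (g x y) \<subseteq> p ` ({u, v} \<inter> {x, y}))"
    using assms(2) unfolding planar_def by (elim exE)
  define c where "c q = Complex (fst q) (snd q)" for q :: "real \<times> real"
  have injc: "inj c" by (rule injI) (auto simp: c_def prod_eq_iff)
  have contc: "continuous_on T c" for T unfolding c_def by (intro continuous_intros)
  have edge_im: "path_image (c \<circ> g u v) = c ` path_image (g u v)" for u v by (simp add: path_image_compose)
  have "plane_drawing V E (c \<circ> p) (\<lambda>u v. c \<circ> g u v)"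
  proof
    show "finite V" "\<And>u v. E u v \<Longrightarrow> E v u" "\<And>u. \<not> E u u" using G unfolding graph_def by blast+
    show "inj_on (c \<circ> p) V" using P injc by (auto intro!: comp_inj_on inj_on_subset[OF injc])
    show "arc (c \<circ> g u v) \<and> pathstart (c \<circ> g u v) = (c \<circ> p) u \<and> pathfinish (c \<circ> g u v) = (c \<circ> p) v" if "E u v" for u v
    proof -
      have "arc (g u v)" "pathstart (g u v) = p u" "pathfinish (g u v) = p v" using P that by auto
      then show ?thesis
        by (auto simp: arc_def pathstart_compose pathfinish_compose
            intro!: path_continuous_image contc comp_inj_on inj_on_subset[OF injc])
    qed
    show "w = u \<or> w = v" if "E u v" "w \<in> V" "(c \<circ> p) w \<in> path_image (c \<circ> g u v)" for u v w
    proof -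
      have "p w \<in> path_image (g u v)" using that(3) injc by (simp add: edge_im inj_image_mem_iff)
      then show ?thesis using P that by blast
    qed
    show "path_image (c \<circ> g u v) \<inter> path_image (c \<circ> g u' v') \<subseteq> (c \<circ> p) ` ({u, v} \<inter> {u', v'})"
      if "E u v" "E u' v'" "{u, v} \<noteq> {u', v'}" for u v u' v'
    proof -
      have "path_image (g u v) \<inter> path_image (g u' v') \<subseteq> p ` ({u, v} \<inter> {u', v'})" using P that by blast
      then show ?thesis unfolding edge_im image_Int[OF injc, symmetric] image_comp[symmetric] by (rule image_mono)
    qed
  qed
  then show ?thesis by (rule that)
qed

theorem theorem5:
  fixes V :: "'a set" and E :: "'a \<Rightarrow> 'a \<Rightarrow> bool"
    and W :: "'b set" and F :: "'b \<Rightarrow> 'b \<Rightarrow> bool"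
  assumes "graph V E"
    and "full_subdivision V E W F"
  shows "(planar V E \<longrightarrow> L_graph W F) \<and> B_VPG 2 W (graph_complement W F)"
proof (intro conjI impI)
  assume "planar V E"
  then obtain p g where pd: "plane_drawing V E p g" using planar_imp_plane_drawing assms(1) by blast
  have "\<exists>y x l r. bar_rep V E y x l r"
  proof (cases "V = {}")
    case True
    then show ?thesis by (simp add: bar_rep_def)
  next
    case False
    then show ?thesis using plane_drawing_bar_rep[OF pd] by blast
  qed
  then show "L_graph W F" using L_graph_of_bar_rep[OF assms] by blast
qed (rule B_VPG_complement_subdivision[OF assms])

end
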